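(* Fix an arbitrary $\epsilon>0$, and let $d=d_n\ge 1$ be a sequence of dimensions with $d=o(n)$ as $n\to\infty$. For each $n$, let $y=\Pi_* X\beta_*+w$, where $X\in\mathbb{R}^{n\times d}$ has i.i.d. $\mathcal{N}(0,1)$ entries, $w\in\mathbb{R}^n$ is independent of $X$ with i.i.d. $\mathcal{N}(0,\sigma^2)$ entries ($\sigma>0$ may depend on $n$), $\Pi_*\in S_n$ is an unknown permutation matrix, and $\beta_*\in\mathbb{R}^d$ is an unknown vector. Let $\mathsf{SNR}=\|\beta_*\|_2^2/\sigma^2$ and let $$\hat\Pi\in\operatorname*{argmax}_{\Pi\in S_n}\ \|\mathcal{P}_{\Pi X}\,y\|_2^2 .$$ Then: (a) (Exact recovery) If $\mathsf{SNR}\ge n^{4+\epsilon}$, then $\mathbb{P}[\hat\Pi=\Pi_*]=1-o(1)$ as $n\to\infty$, where the $o(1)$ is uniform in $\Pi_*$ and $\beta_*$. (b) (Almost exact recovery) If $\mathsf{SNR}\ge n^{2+\epsilon}$, then $\mathbb{P}[\mathsf{overlap}(\hat\Pi,\Pi_* )=1-o(1)]=1-o(1)$ as $n\to\infty$, where the $o(1)$ is uniform in $\Pi_*$ and $\beta_*$.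
   Context: $S_n$ denotes the set of all $n\times n$ permutation matrices. For $\Pi\in S_n$, $\mathcal{P}_{\Pi X}=\Pi X(X^\top X)^{-1}X^\top\Pi^\top$ is the orthogonal projection matrix onto the column span of $\Pi X$ (well defined almost surely when $d\le n$). The estimator $\hat\Pi$ is equivalently the $\Pi$-component of the joint maximum likelihood estimator $(\hat\Pi,\hat\beta)\in\operatorname{argmin}_{\Pi\in S_n,\beta\in\mathbb{R}^d}\|y-\Pi X\beta\|_2^2$. The overlap is $\mathsf{overlap}(\hat\Pi,\Pi_* )=\frac1n\operatorname{Tr}(\hat\Pi^\top\Pi_* )$, i.e. the fraction of indices $i\in\{1,\dots,n\}$ on which the permutations corresponding to $\hat\Pi$ and $\Pi_*$ agree. The statement $\mathbb{P}[\mathsf{overlap}(\hat\Pi,\Pi_* )=1-o(1)]=1-o(1)$ means that there is a deterministic sequence $\eta_n\to0$ with $\mathbb{P}[\mathsf{overlap}(\hat\Pi,\Pi_* )\ge 1-\eta_n]\to1$. *)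

theory Defs
  imports
    "HOL-Probability.Probability"
    "HOL-Library.Landau_Symbols"
    "Jordan_Normal_Form.Gauss_Jordan_Elimination"
begin

definition perm_mats :: "nat \<Rightarrow> real mat set" where
  "perm_mats n = {mat n n (\<lambda>(i, j). if i = p j then 1 else 0) | p. p permutes {..<n}}"

definition sq_norm_vec :: "real Matrix.vec \<Rightarrow> real" where
  "sq_norm_vec v = scalar_prod v v"

definition mat_trace :: "real mat \<Rightarrow> real" where
  "mat_trace A = (\<Sum>i<dim_row A. A $$ (i, i))"

(* The projection onto the column span of P * X. The value is meaningful only if X\<^sup>T * X is
   invertible; otherwise mat_inverse returns None and the expression is unspecified. *)
definition proj_mat :: "real mat \<Rightarrow> real mat \<Rightarrow> real mat" where
  "proj_mat P X =
     P * X * the (mat_inverse (transpose_mat X * X)) * transpose_mat X * transpose_mat P"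

definition overlap :: "nat \<Rightarrow> real mat \<Rightarrow> real mat \<Rightarrow> real" where
  "overlap n P Q = mat_trace (transpose_mat P * Q) / real n"

definition SNR :: "real Matrix.vec \<Rightarrow> real \<Rightarrow> real" where
  "SNR b s = sq_norm_vec b / s\<^sup>2"

(* The last conjunct is independence of X and w, as independence of the sigma-algebras they
   generate. X and w are read as random elements of the product spaces of their entries, as there
   is no sigma-algebra on the types of matrices and vectors themselves; indep_var does not apply
   because it requires both variables to have the same value type. *)
definition gaussian_design ::
    "'a measure \<Rightarrow> nat \<Rightarrow> nat \<Rightarrow> real \<Rightarrow> ('a \<Rightarrow> real mat) \<Rightarrow> ('a \<Rightarrow> real Matrix.vec) \<Rightarrow> bool" where
  "gaussian_design M n d s X w \<longleftrightarrow>
     prob_space M \<and>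
     (\<forall>\<omega>\<in>space M. X \<omega> \<in> carrier_mat n d \<and> w \<omega> \<in> carrier_vec n) \<and>
     (\<forall>ij\<in>{..<n} \<times> {..<d}. distributed M lborel (\<lambda>\<omega>. X \<omega> $$ ij) (normal_density 0 1)) \<and>
     prob_space.indep_vars M (\<lambda>_. borel) (\<lambda>ij \<omega>. X \<omega> $$ ij) ({..<n} \<times> {..<d}) \<and>
     (\<forall>i<n. distributed M lborel (\<lambda>\<omega>. vec_index (w \<omega>) i) (normal_density 0 s)) \<and>
     prob_space.indep_vars M (\<lambda>_. borel) (\<lambda>i \<omega>. vec_index (w \<omega>) i) {..<n} \<and>
     prob_space.indep_set M
       (sets (vimage_algebra (space M) (\<lambda>\<omega>. \<lambda>ij\<in>{..<n} \<times> {..<d}. X \<omega> $$ ij)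
          (Pi\<^sub>M ({..<n} \<times> {..<d}) (\<lambda>_. borel))))
       (sets (vimage_algebra (space M) (\<lambda>\<omega>. \<lambda>i\<in>{..<n}. vec_index (w \<omega>) i)
          (Pi\<^sub>M {..<n} (\<lambda>_. borel))))"

definition observation ::
    "real mat \<Rightarrow> real Matrix.vec \<Rightarrow> real mat \<Rightarrow> real Matrix.vec \<Rightarrow> real Matrix.vec" where
  "observation P b X w = (P * X) *\<^sub>v b + w"

(* An arbitrary measurable selection from the set of maximizers. Membership is required almost
   surely, because the objective itself is defined only almost surely. *)
definition is_perm_estimator ::
    "'a measure \<Rightarrow> nat \<Rightarrow> ('a \<Rightarrow> real mat) \<Rightarrow> ('a \<Rightarrow> real Matrix.vec) \<Rightarrow> ('a \<Rightarrow> real mat) \<Rightarrow> bool" where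
  "is_perm_estimator M n X y P_hat \<longleftrightarrow>
     P_hat \<in> measurable M (count_space (perm_mats n)) \<and>
     (AE \<omega> in M. is_arg_max (\<lambda>P. sq_norm_vec (proj_mat P (X \<omega>) *\<^sub>v y \<omega>))
        (\<lambda>P. P \<in> perm_mats n) (P_hat \<omega>))"

end

theory Submission
  imports
    Defs
    "HOL-Real_Asymp.Real_Asymp"
    "HOL-Combinatorics.Permutations"
    "Jordan_Normal_Form.Determinant"
begin

text \<open>Relabel the rows by the true permutation. Then \<open>y = x + w\<close> with \<open>x = X \<beta>\<close>, and the
estimator returns a permutation \<open>f\<close> of the rows which, together with some coefficient vector \<open>b\<close>,
minimises \<open>\<Sum>j. (y (f j) - (X b) j)\<^sup>2\<close>, because maximising a projection is minimising a least-squares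
residual. Put \<open>B = \<parallel>\<beta>\<parallel>\<close> and \<open>c = b - \<beta>\<close>, and let \<open>a > 0\<close> be small, at most \<open>\<epsilon> / 20\<close>. The residual
\<open>N = \<parallel>x \<circ> f - X b\<parallel>\<close> is at most \<open>2 \<parallel>w\<parallel>\<close>, since the identity with coefficients \<open>\<beta>\<close> competes.
Three arguments, none of which is a union bound over permutations, exclude a wrong \<open>f\<close>.

Many moved rows (\<open>few_moved\<close>, \<open>near_rows_prob\<close>). If \<open>f\<close> moves more than \<open>n/4\<close> rows, then there is a
set \<open>C\<close> of at least \<open>n/24\<close> rows such that each \<open>x i\<close> with \<open>i \<in> C\<close> lies within \<open>n powr (-1-a) B\<close> of one of the
at most \<open>n\<close> values \<open>(X b) j\<close> with \<open>j \<notin> C\<close>. Given the rows outside \<open>C\<close>, these events are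
independent and have probability at most \<open>n powr (-a)\<close>. There are \<open>2 ^ n\<close> sets \<open>C\<close>, and \<open>b\<close> may be
rounded to a grid of \<open>n ^ (7 d)\<close> points, which is \<open>n ^ o(n)\<close>. So the failure probability
\<open>n powr (-a n / 24)\<close> wins. Nothing is counted per permutation; \<open>n!\<close> would be too much.

Few moved rows (\<open>well_spread\<close>, \<open>displacement_bound\<close>). The same grid argument shows that any \<open>3n/4\<close>
rows carry the norm of \<open>X c\<close>, for all \<open>c\<close> at once, up to a factor \<open>K = 32 n powr (3a/2)\<close>. On the fixed
rows the residual is \<open>- X c\<close>, so \<open>\<parallel>X c\<parallel> \<le> K N\<close>, and the displacement \<open>u = x \<circ> f - x\<close> satisfies
\<open>\<parallel>u\<parallel> \<le> (1 + K) N\<close>. For almost exact recovery this suffices (\<open>moved_bound\<close>): only about \<open>n powr (1-a)\<close> rows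
have a neighbour within \<open>n powr (-1-2a) B\<close>, and every other moved row makes \<open>u\<close> large.

No moved row (\<open>none_moved\<close>). For exact recovery the bound \<open>N \<le> 2 \<parallel>w\<parallel>\<close> loses a factor \<open>n\<close>, as a
transposition feels the noise in two rows only. Split \<open>w\<close> into its projection to the column space of
\<open>X\<close>, which is absorbed into \<open>x\<close>, and the rest \<open>w'\<close>. As \<open>w'\<close> is orthogonal to \<open>X c\<close>, the cross term
between \<open>w' \<circ> f\<close> and the residual only sees moved rows. Both sides of the resulting inequality then scale
with the square root of the number of moved rows, and the gaps of \<open>x\<close>, all at least
\<open>n powr (-2-a) B\<close>, contradict it. This needs the projection of \<open>w\<close> to be small in every row, which
holds because design and noise are independent and the rows of a projection have norm at most 1
(\<open>fitted_noise_rare\<close>).\<close>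

section \<open>Normal variables and independent blocks\<close>

text \<open>A design is a function on index pairs rather than a matrix, so that the design and the noise can be
columns of one array of independent variables.\<close>

definition lin :: "nat \<Rightarrow> (nat \<times> nat \<Rightarrow> real) \<Rightarrow> (nat \<Rightarrow> real) \<Rightarrow> nat \<Rightarrow> real" where
  "lin d A c i = (\<Sum>j<d. A (i, j) * c j)"

lemma normal_density_le: "s > 0 \<Longrightarrow> normal_density 0 s x \<le> 1 / (2 * s)"
proof -
  assume s: "s > 0"
  have "(2 * s)\<^sup>2 \<le> 2 * pi * s\<^sup>2"
    using s pi_gt3 by (auto simp: power2_eq_square)
  then have "2 * s \<le> sqrt (2 * pi * s\<^sup>2)"
    by (rule real_le_rsqrt)
  then have "1 / sqrt (2 * pi * s\<^sup>2) \<le> 1 / (2 * s)"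
    using s by (intro divide_left_mono) (auto intro: mult_pos_pos)
  moreover have "exp (- (x - 0)\<^sup>2 / (2 * s\<^sup>2)) \<le> 1"
    by simp
  ultimately show ?thesis
    unfolding normal_density_def using mult_mono[of "1 / sqrt (2 * pi * s\<^sup>2)" "1 / (2 * s)"
      "exp (- (x - 0)\<^sup>2 / (2 * s\<^sup>2))" 1] s by simp
qed

context prob_space begin

lemma normal_small_ball:
  assumes Y: "distributed M lborel Y (normal_density 0 s)" and "s > 0" "t \<ge> 0"
  shows "prob {\<omega>\<in>space M. \<bar>Y \<omega> - v\<bar> \<le> t} \<le> t / s"
proof -
  have eq: "{\<omega>\<in>space M. \<bar>Y \<omega> - v\<bar> \<le> t} = Y -` {v - t..v + t} \<inter> space M"
    by auto
  have "emeasure M (Y -` {v - t..v + t} \<inter> space M) =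
      (\<integral>\<^sup>+x. ennreal (normal_density 0 s x) * indicator {v - t..v + t} x \<partial>lborel)"
    using Y by (intro distributed_emeasure) auto
  also have "\<dots> \<le> (\<integral>\<^sup>+x. ennreal (1 / (2 * s)) * indicator {v - t..v + t} x \<partial>lborel)"
    using normal_density_le[OF \<open>s > 0\<close>]
    by (intro nn_integral_mono) (auto split: split_indicator intro: ennreal_leI)
  also have "\<dots> = ennreal (1 / (2 * s)) * ennreal (2 * t)"
    using \<open>t \<ge> 0\<close> by (subst nn_integral_cmult_indicator) auto
  also have "\<dots> = ennreal (t / s)"
    using assms by (simp add: ennreal_mult[symmetric])
  finally show ?thesis
    unfolding eq emeasure_eq_measure using assms by (simp add: ennreal_le_iff)
qed

text \<open>Tilting by this exponential doubles the variance of the normal law; \<open>sqrt 2\<close> is the ratio of the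
two normalising constants.\<close>

lemma normal_exp_square:
  assumes Y: "distributed M lborel Y (normal_density 0 s)" and s: "s > 0"
  shows "(\<integral>\<^sup>+\<omega>. ennreal (exp ((Y \<omega>)\<^sup>2 / (4 * s\<^sup>2))) \<partial>M) = ennreal (sqrt 2)"
proof -
  have "(\<integral>\<^sup>+\<omega>. ennreal (exp ((Y \<omega>)\<^sup>2 / (4 * s\<^sup>2))) \<partial>M) =
     (\<integral>\<^sup>+x. ennreal (normal_density 0 s x) * ennreal (exp (x\<^sup>2 / (4 * s\<^sup>2))) \<partial>lborel)"
    by (rule distributed_nn_integral[OF Y, symmetric]) simp
  also have "\<dots> = (\<integral>\<^sup>+x. ennreal (sqrt 2) * ennreal (normal_density 0 (sqrt 2 * s) x) \<partial>lborel)"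
  proof (intro nn_integral_cong)
    fix x :: real
    have e: "exp (- (x - 0)\<^sup>2 / (2 * s\<^sup>2)) * exp (x\<^sup>2 / (4 * s\<^sup>2)) =
        exp (- (x - 0)\<^sup>2 / (2 * (sqrt 2 * s)\<^sup>2))"
      unfolding exp_add[symmetric] using s
      by (intro arg_cong[of _ _ exp]) (simp add: field_simps power_mult_distrib)
    have q: "1 / sqrt (2 * pi * s\<^sup>2) = sqrt 2 * (1 / sqrt (2 * pi * (sqrt 2 * s)\<^sup>2))"
      using s by (simp add: real_sqrt_mult power_mult_distrib real_div_sqrt field_simps)
    have "normal_density 0 s x * exp (x\<^sup>2 / (4 * s\<^sup>2)) = sqrt 2 * normal_density 0 (sqrt 2 * s) x"
      unfolding normal_density_def e[symmetric] by (subst q) (simp only: mult_ac)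
    then show "ennreal (normal_density 0 s x) * ennreal (exp (x\<^sup>2 / (4 * s\<^sup>2))) =
       ennreal (sqrt 2) * ennreal (normal_density 0 (sqrt 2 * s) x)"
      by (metis ennreal_mult normal_density_nonneg exp_ge_zero real_sqrt_ge_zero zero_le_numeral)
  qed
  also have "\<dots> = ennreal (sqrt 2) * (\<integral>\<^sup>+x. ennreal (normal_density 0 (sqrt 2 * s) x) \<partial>lborel)"
    by (rule nn_integral_cmult) simp
  also have "(\<integral>\<^sup>+x. ennreal (normal_density 0 (sqrt 2 * s) x) \<partial>lborel) = 1"
    using s by (subst nn_integral_eq_integral) (auto intro: integrable_normal_density)
  finally show ?thesis by simp
qed

lemma normal_tail:
  assumes Y: "distributed M lborel Y (normal_density 0 s)" and s: "s > 0" and t: "t \<ge> 0"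
  shows "prob {\<omega>\<in>space M. \<bar>Y \<omega>\<bar> \<ge> t * s} \<le> 2 * exp (- t\<^sup>2 / 4)"
proof -
  have [measurable]: "random_variable borel Y"
    using Y distributed_measurable[OF Y] by simp
  have "emeasure M {\<omega>\<in>space M. \<bar>Y \<omega>\<bar> \<ge> t * s} \<le>
      emeasure M {\<omega>\<in>space M. 1 \<le> ennreal (exp (- t\<^sup>2 / 4)) * ennreal (exp ((Y \<omega>)\<^sup>2 / (4 * s\<^sup>2)))}"
  proof (intro emeasure_mono subsetI CollectI conjI)
    fix \<omega> assume w: "\<omega> \<in> {\<omega>\<in>space M. \<bar>Y \<omega>\<bar> \<ge> t * s}"
    then have "(t * s)\<^sup>2 \<le> \<bar>Y \<omega>\<bar>\<^sup>2"
      using s t by (intro power_mono) auto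
    then have "t\<^sup>2 / 4 \<le> (Y \<omega>)\<^sup>2 / (4 * s\<^sup>2)"
      using s by (simp add: field_simps power_mult_distrib)
    then have "1 \<le> exp (- t\<^sup>2 / 4) * exp ((Y \<omega>)\<^sup>2 / (4 * s\<^sup>2))"
      by (simp add: exp_add[symmetric])
    then show "1 \<le> ennreal (exp (- t\<^sup>2 / 4)) * ennreal (exp ((Y \<omega>)\<^sup>2 / (4 * s\<^sup>2)))"
      by (simp add: ennreal_mult[symmetric] )
  qed (auto)
  also have "\<dots> \<le> ennreal (exp (- t\<^sup>2 / 4)) * (\<integral>\<^sup>+\<omega>. ennreal (exp ((Y \<omega>)\<^sup>2 / (4 * s\<^sup>2))) * indicator (space M) \<omega> \<partial>M)"
    by (rule nn_integral_Markov_inequality) auto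
  also have "(\<integral>\<^sup>+\<omega>. ennreal (exp ((Y \<omega>)\<^sup>2 / (4 * s\<^sup>2))) * indicator (space M) \<omega> \<partial>M) = ennreal (sqrt 2)"
    unfolding normal_exp_square[OF Y s, symmetric] by (intro nn_integral_cong) auto
  also have "ennreal (exp (- t\<^sup>2 / 4)) * ennreal (sqrt 2) \<le> ennreal (2 * exp (- t\<^sup>2 / 4))"
    using sqrt2_less_2 by (subst ennreal_mult[symmetric]) (auto intro!: ennreal_leI)
  finally show ?thesis
    unfolding emeasure_eq_measure by (simp add: ennreal_le_iff)
qed

text \<open>Conditioning on the block \<open>K\<close>, by Fubini for the joint law of two disjoint blocks. Independent rows
are revealed one after the other with this lemma, and the noise is averaged with the design held fixed.\<close>

lemma indep_section_bound:
  fixes Z :: "'i \<Rightarrow> 'a \<Rightarrow> real"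
  assumes ind: "indep_vars (\<lambda>_. borel) Z I" and KL: "K \<inter> L = {}" "K \<subseteq> I" "L \<subseteq> I"
    and E: "{u\<in>space (Pi\<^sub>M K (\<lambda>_. borel)). E u} \<in> sets (Pi\<^sub>M K (\<lambda>_. borel))"
    and Q: "{x\<in>space (Pi\<^sub>M K (\<lambda>_. borel) \<Otimes>\<^sub>M Pi\<^sub>M L (\<lambda>_. borel)). Q (fst x) (snd x)} \<in>
      sets (Pi\<^sub>M K (\<lambda>_. borel) \<Otimes>\<^sub>M Pi\<^sub>M L (\<lambda>_. borel))"
    and q: "\<And>u. prob {\<omega>\<in>space M. Q u (\<lambda>i\<in>L. Z i \<omega>)} \<le> q" and q0: "q \<ge> 0"
  shows "prob {\<omega>\<in>space M. E (\<lambda>i\<in>K. Z i \<omega>) \<and> Q (\<lambda>i\<in>K. Z i \<omega>) (\<lambda>i\<in>L. Z i \<omega>)} \<le>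
    q * prob {\<omega>\<in>space M. E (\<lambda>i\<in>K. Z i \<omega>)}"
proof -
  let ?S = "Pi\<^sub>M K (\<lambda>_. borel :: real measure)" and ?T = "Pi\<^sub>M L (\<lambda>_. borel :: real measure)"
  define U where "U = (\<lambda>\<omega>. \<lambda>i\<in>K. Z i \<omega>)"
  define V where "V = (\<lambda>\<omega>. \<lambda>i\<in>L. Z i \<omega>)"
  have iv: "indep_var ?S U ?T V"
    unfolding U_def V_def by (rule indep_var_restrict[OF ind KL])
  then have rU[measurable]: "random_variable ?S U" and rV[measurable]: "random_variable ?T V"
    by (auto dest: indep_var_rv1 indep_var_rv2)
  have eq: "distr M ?S U \<Otimes>\<^sub>M distr M ?T V = distr M (?S \<Otimes>\<^sub>M ?T) (\<lambda>x. (U x, V x))"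
    using iv by (simp add: indep_var_distribution_eq)
  interpret X: prob_space "distr M ?S U" by (rule prob_space_distr) fact
  interpret Y: prob_space "distr M ?T V" by (rule prob_space_distr) fact
  interpret XY: pair_prob_space "distr M ?S U" "distr M ?T V" ..
  define C where "C = {x\<in>space (?S \<Otimes>\<^sub>M ?T). E (fst x) \<and> Q (fst x) (snd x)}"
  have "{x\<in>space (?S \<Otimes>\<^sub>M ?T). E (fst x)} = fst -` {u\<in>space ?S. E u} \<inter> space (?S \<Otimes>\<^sub>M ?T)"
    by (auto simp: space_pair_measure)
  also have "\<dots> \<in> sets (?S \<Otimes>\<^sub>M ?T)"
    using E by (intro measurable_sets[OF measurable_fst])
  finally have E': "{x\<in>space (?S \<Otimes>\<^sub>M ?T). E (fst x)} \<in> sets (?S \<Otimes>\<^sub>M ?T)" .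
  have "C = {x\<in>space (?S \<Otimes>\<^sub>M ?T). E (fst x)} \<inter> {x\<in>space (?S \<Otimes>\<^sub>M ?T). Q (fst x) (snd x)}"
    by (auto simp: C_def)
  then have C: "C \<in> sets (?S \<Otimes>\<^sub>M ?T)"
    using E' Q by auto
  have "emeasure M {\<omega>\<in>space M. E (U \<omega>) \<and> Q (U \<omega>) (V \<omega>)} =
      emeasure M ((\<lambda>x. (U x, V x)) -` C \<inter> space M)"
    using measurable_space[OF rU] measurable_space[OF rV]
    by (intro arg_cong[of _ _ "emeasure M"]) (auto simp: C_def space_pair_measure)
  also have "\<dots> = emeasure (distr M (?S \<Otimes>\<^sub>M ?T) (\<lambda>x. (U x, V x))) C"
    by (rule emeasure_distr[symmetric]) (use C in auto)
  also have "\<dots> = emeasure (distr M ?S U \<Otimes>\<^sub>M distr M ?T V) C"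
    by (simp add: eq)
  also have "\<dots> = (\<integral>\<^sup>+u. emeasure (distr M ?T V) (Pair u -` C) \<partial>distr M ?S U)"
    by (rule Y.emeasure_pair_measure_alt) (use C in simp)
  also have "\<dots> \<le> (\<integral>\<^sup>+u. ennreal q * indicator {u\<in>space ?S. E u} u \<partial>distr M ?S U)"
  proof (intro nn_integral_mono)
    fix u assume "u \<in> space (distr M ?S U)"
    then have u: "u \<in> space ?S" by simp
    have "emeasure (distr M ?T V) (Pair u -` C) = emeasure M (V -` (Pair u -` C) \<inter> space M)"
      by (rule emeasure_distr) (use C in \<open>auto intro: sets_Pair1\<close>)
    also have "\<dots> \<le> ennreal q * indicator {u\<in>space ?S. E u} u"
    proof (cases "E u")
      case True
      have "V -` (Pair u -` C) \<inter> space M = {\<omega>\<in>space M. Q u (V \<omega>)}"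
        using measurable_space[OF rV] u True by (auto simp: C_def space_pair_measure)
      then show ?thesis
        using q[of u] u True by (auto simp: emeasure_eq_measure V_def q0 intro!: ennreal_leI)
    next
      case False
      then have "V -` (Pair u -` C) \<inter> space M = {}" by (auto simp: C_def)
      then show ?thesis by simp
    qed
    finally show "emeasure (distr M ?T V) (Pair u -` C) \<le> ennreal q * indicator {u\<in>space ?S. E u} u" .
  qed
  also have "\<dots> = ennreal q * emeasure (distr M ?S U) {u\<in>space ?S. E u}"
    by (rule nn_integral_cmult_indicator) (use E in simp)
  also have "emeasure (distr M ?S U) {u\<in>space ?S. E u} = emeasure M (U -` {u\<in>space ?S. E u} \<inter> space M)"
    by (rule emeasure_distr) (use E in auto)
  also have "U -` {u\<in>space ?S. E u} \<inter> space M = {\<omega>\<in>space M. E (U \<omega>)}"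
    using measurable_space[OF rU] by auto
  also have "ennreal q * emeasure M {\<omega>\<in>space M. E (U \<omega>)} = ennreal (q * prob {\<omega>\<in>space M. E (U \<omega>)})"
    using q0 by (simp add: emeasure_eq_measure ennreal_mult)
  finally show ?thesis
    unfolding emeasure_eq_measure U_def V_def using q0 by (simp add: ennreal_le_iff)
qed

end

text \<open>Columns \<open>0, \<dots>, d - 1\<close> are the design and column \<open>d\<close> is the noise, scaled to variance 1.\<close>

locale gaussian_array = prob_space M for M :: "'a measure" +
  fixes Z :: "nat \<times> nat \<Rightarrow> 'a \<Rightarrow> real" and n d :: nat
  assumes indep: "indep_vars (\<lambda>_. borel) Z ({..<n} \<times> {..d})"
    and std_normal: "\<And>k. k \<in> {..<n} \<times> {..d} \<Longrightarrow> distributed M lborel (Z k) std_normal_density"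
begin

lemma Z_measurable[measurable (raw)]:
  "i < n \<Longrightarrow> j \<le> d \<Longrightarrow> random_variable borel (Z (i, j))"
  using distributed_measurable[OF std_normal[of "(i, j)"]] by simp

lemma normal_combination:
  assumes L: "L \<subseteq> {..<n} \<times> {..d}" and c: "k \<in> L" "c k \<noteq> 0"
  shows "distributed M lborel (\<lambda>\<omega>. \<Sum>k\<in>L. Z k \<omega> * c k) (normal_density 0 (L2_set c L))"
proof -
  \<comment> \<open>Summands with coefficient 0 have no density and are left out.\<close>
  let ?L = "{k\<in>L. c k \<noteq> 0}"
  have fin: "finite L"
    using L by (rule finite_subset) simp
  have "distributed M lborel (\<lambda>\<omega>. \<Sum>k\<in>?L. Z k \<omega> * c k)
      (normal_density (\<Sum>k\<in>?L. 0) (sqrt (\<Sum>k\<in>?L. \<bar>c k\<bar>\<^sup>2)))"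
  proof (rule sum_indep_normal)
    show "finite ?L" using fin by simp
    have "k \<in> ?L" using c by simp
    then show "?L \<noteq> {}" by blast
    have "indep_vars (\<lambda>_. borel) Z ?L"
      using L by (intro indep_vars_subset[OF indep]) auto
    then show "indep_vars (\<lambda>_. borel) (\<lambda>k \<omega>. Z k \<omega> * c k) ?L"
      by (rule indep_vars_compose2[where Y = "\<lambda>k x. x * c k"]) simp
    show "0 < \<bar>c k\<bar>" if "k \<in> ?L" for k using that by simp
    fix k assume k: "k \<in> ?L"
    have "distributed M lborel (\<lambda>\<omega>. 0 + c k * Z k \<omega>) (normal_density (0 + c k * 0) (\<bar>c k\<bar> * 1))"
      using k L by (intro normal_density_affine) (auto intro!: std_normal)
    then show "distributed M lborel (\<lambda>\<omega>. Z k \<omega> * c k) (normal_density 0 \<bar>c k\<bar>)"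
      by (simp add: mult.commute)
  qed
  moreover have "(\<Sum>k\<in>?L. Z k \<omega> * c k) = (\<Sum>k\<in>L. Z k \<omega> * c k)" for \<omega>
    using fin by (intro sum.mono_neutral_left) auto
  moreover have "(\<Sum>k\<in>?L. \<bar>c k\<bar>\<^sup>2) = (\<Sum>k\<in>L. (c k)\<^sup>2)"
    unfolding power2_abs using fin by (intro sum.mono_neutral_left) auto
  ultimately show ?thesis by (simp add: L2_set_def)
qed

end

section \<open>Anti-concentration of Gaussian rows\<close>

lemma lin_restrict: "(\<And>j. j < d \<Longrightarrow> (i, j) \<in> K) \<Longrightarrow> lin d (restrict A K) c i = lin d A c i"
  by (auto simp: lin_def intro!: sum.cong)

lemma lin_measurable:
  assumes "\<And>j. j < d \<Longrightarrow> (i, j) \<in> K"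
  shows "(\<lambda>u. lin d u c i) \<in> borel_measurable (Pi\<^sub>M K (\<lambda>_. borel))"
  unfolding lin_def using assms by (intro borel_measurable_sum borel_measurable_times) auto

context prob_space begin

text \<open>A union bound over all subsets of the rows costs only \<open>2 ^ n\<close>, which any negative power of \<open>n\<close> per
row outweighs.\<close>

lemma prob_large_subset:
  assumes ev: "\<And>A. A \<subseteq> {..<n} \<Longrightarrow> Ev A \<in> events"
    and pr: "\<And>A. A \<subseteq> {..<n} \<Longrightarrow> prob (Ev A) \<le> r ^ card A" and r: "0 < r" "r \<le> 1"
  shows "prob (\<Union>A\<in>{A. A \<subseteq> {..<n} \<and> m \<le> real (card A)}. Ev A) \<le> 2 ^ n * r powr m"
proof -
  let ?F = "{A. A \<subseteq> {..<n} \<and> m \<le> real (card A)}"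
  have sub: "?F \<subseteq> Pow {..<n}" by auto
  have fin: "finite ?F" by (rule finite_subset[OF sub]) simp
  have "prob (\<Union>A\<in>?F. Ev A) \<le> (\<Sum>A\<in>?F. prob (Ev A))"
    using ev fin by (intro finite_measure_subadditive_finite) auto
  also have "\<dots> \<le> (\<Sum>A\<in>?F. r powr m)"
  proof (intro sum_mono)
    fix A assume A: "A \<in> ?F"
    have "prob (Ev A) \<le> r powr real (card A)"
      using pr[of A] A r by (simp add: powr_realpow)
    also have "\<dots> \<le> r powr m"
      using A r by (intro powr_mono') auto
    finally show "prob (Ev A) \<le> r powr m" .
  qed
  also have "\<dots> \<le> real (card (Pow {..<n})) * r powr m"
    using card_mono[OF _ sub] by (simp add: card_Pow mult_right_mono)
  finally show ?thesis by (simp add: card_Pow)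
qed

end

context gaussian_array begin

lemma row_normal:
  assumes i: "i < n" and c: "0 < L2_set c {..<d}"
  shows "distributed M lborel (\<lambda>\<omega>. lin d (\<lambda>k. Z k \<omega>) c i) (normal_density 0 (L2_set c {..<d}))"
proof -
  have "\<exists>j<d. c j \<noteq> 0"
    using c by (metis L2_set_0' lessThan_iff less_irrefl)
  then obtain j where j: "j < d" "c j \<noteq> 0" by auto
  have r: "(\<Sum>k\<in>{i} \<times> {..<d}. f k) = (\<Sum>j<d. f (i, j))" for f :: "nat \<times> nat \<Rightarrow> real"
    using sum.cartesian_product[of "\<lambda>i j. f (i, j)" "{..<d}" "{i}"] by (simp add: case_prod_beta)
  have "distributed M lborel (\<lambda>\<omega>. \<Sum>k\<in>{i} \<times> {..<d}. Z k \<omega> * (c \<circ> snd) k)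
     (normal_density 0 (L2_set (c \<circ> snd) ({i} \<times> {..<d})))"
    using i j by (intro normal_combination[where k = "(i, j)"]) auto
  then show ?thesis
    by (simp add: r lin_def L2_set_def)
qed

text \<open>Reveal the rows of \<open>A\<close> one at a time. Whatever the other rows are, the density of the new linear form
is at most \<open>1 / (2 \<parallel>c\<parallel>)\<close>, so it comes close to one of \<open>card J\<close> targets with probability at most
\<open>card J * (t / \<parallel>c\<parallel>)\<close>. The targets may depend on the rows outside \<open>A0\<close> but not on those inside, which is why
the bounds multiply.\<close>

lemma near_targets_prob:
  fixes h :: "'j \<Rightarrow> (nat \<times> nat \<Rightarrow> real) \<Rightarrow> real" and A0 :: "nat set"
  defines "K0 \<equiv> ({..<n} - A0) \<times> {..<d}"
  assumes J: "finite J" and h: "\<And>j. j \<in> J \<Longrightarrow> h j \<in> borel_measurable (Pi\<^sub>M K0 (\<lambda>_. borel))"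
    and c: "0 < L2_set c {..<d}" and t: "t \<ge> 0" and A: "A \<subseteq> A0" "A0 \<subseteq> {..<n}"
  shows "prob {\<omega>\<in>space M. \<forall>i\<in>A. \<exists>j\<in>J. \<bar>lin d (\<lambda>k. Z k \<omega>) c i - h j (\<lambda>k\<in>K0. Z k \<omega>)\<bar> \<le> t}
    \<le> (real (card J) * (t / L2_set c {..<d})) ^ card A"
proof -
  have "finite A" using A by (meson finite_lessThan finite_subset)
  then show ?thesis
    using A(1)
  proof (induction A rule: finite_induct)
    case empty
    then show ?case by simp
  next
    case (insert i A)
    define K where "K = K0 \<union> A \<times> {..<d}"
    define L where "L = {i} \<times> {..<d}"
    let ?KL = "Pi\<^sub>M K (\<lambda>_. borel :: real measure) \<Otimes>\<^sub>M Pi\<^sub>M L (\<lambda>_. borel :: real measure)"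
    define E where "E = (\<lambda>u. \<forall>i'\<in>A. \<exists>j\<in>J. \<bar>lin d u c i' - h j (restrict u K0)\<bar> \<le> t)"
    define Q where "Q = (\<lambda>u v. \<exists>j\<in>J. \<bar>lin d v c i - h j (restrict u K0)\<bar> \<le> t)"
    have i: "i < n" "i \<in> A0" using insert A by auto
    have hK: "(\<lambda>u. h j (restrict u K0)) \<in> borel_measurable (Pi\<^sub>M K (\<lambda>_. borel))" if "j \<in> J" for j
      using measurable_compose[OF measurable_restrict_subset h[OF that], of K] by (simp add: K_def)
    have KL: "K \<inter> L = {}" "K \<subseteq> {..<n} \<times> {..d}" "L \<subseteq> {..<n} \<times> {..d}"
      using insert i A by (auto simp: K_def L_def K0_def)
    have resK: "K \<inter> K0 = K0"
      by (auto simp: K_def)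
    have linK: "lin d (\<lambda>k\<in>K. Z k \<omega>) c i' = lin d (\<lambda>k. Z k \<omega>) c i'" if "i' \<in> A" for i' \<omega>
      using that by (intro lin_restrict) (auto simp: K_def)
    have linL: "lin d (\<lambda>k\<in>L. Z k \<omega>) c i = lin d (\<lambda>k. Z k \<omega>) c i" for \<omega>
      by (intro lin_restrict) (auto simp: L_def)
    have "prob {\<omega>\<in>space M. E (\<lambda>k\<in>K. Z k \<omega>) \<and> Q (\<lambda>k\<in>K. Z k \<omega>) (\<lambda>k\<in>L. Z k \<omega>)} \<le>
      (real (card J) * (t / L2_set c {..<d})) * prob {\<omega>\<in>space M. E (\<lambda>k\<in>K. Z k \<omega>)}"
    proof (rule indep_section_bound[OF indep KL])
      have [measurable]: "(\<lambda>u. lin d u c i') \<in> borel_measurable (Pi\<^sub>M K (\<lambda>_. borel))" if "i' \<in> A" for i'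
        using that by (intro lin_measurable) (auto simp: K_def)
      note [measurable] = hK
      show "{u \<in> space (Pi\<^sub>M K (\<lambda>_. borel)). E u} \<in> sets (Pi\<^sub>M K (\<lambda>_. borel))"
        unfolding E_def using J \<open>finite A\<close>
        by (intro sets.sets_Collect_finite_All sets.sets_Collect_finite_Ex) auto
      have l: "(\<lambda>u. lin d u c i) \<in> borel_measurable (Pi\<^sub>M L (\<lambda>_. borel))"
        by (intro lin_measurable) (auto simp: L_def)
      show "{x \<in> space ?KL. Q (fst x) (snd x)}
        \<in> sets ?KL"
        unfolding Q_def
      proof (intro sets.sets_Collect_finite_Ex J)
        fix j assume j: "j \<in> J"
        have [measurable]: "(\<lambda>x. lin d (snd x) c i) \<in> borel_measurable ?KL"
          by (rule measurable_compose[OF measurable_snd l])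
        have [measurable]: "(\<lambda>x. h j (restrict (fst x) K0)) \<in> borel_measurable ?KL"
          by (rule measurable_compose[OF measurable_fst hK[OF j]])
        show "{x \<in> space ?KL.
          \<bar>lin d (snd x) c i - h j (restrict (fst x) K0)\<bar> \<le> t}
          \<in> sets ?KL"
          by measurable
      qed
      show "0 \<le> real (card J) * (t / L2_set c {..<d})" using c t by simp
      fix u
      have meas: "random_variable borel (\<lambda>\<omega>. lin d (\<lambda>k. Z k \<omega>) c i)"
        using distributed_measurable[OF row_normal[OF i(1) c]] by simp
      have "{\<omega> \<in> space M. Q u (\<lambda>k\<in>L. Z k \<omega>)} =
         (\<Union>j\<in>J. {\<omega> \<in> space M. \<bar>lin d (\<lambda>k. Z k \<omega>) c i - h j (restrict u K0)\<bar> \<le> t})"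
        by (auto simp: Q_def linL)
      also have "prob \<dots> \<le> (\<Sum>j\<in>J. prob {\<omega> \<in> space M. \<bar>lin d (\<lambda>k. Z k \<omega>) c i - h j (restrict u K0)\<bar> \<le> t})"
        using J meas by (intro finite_measure_subadditive_finite) auto
      also have "\<dots> \<le> (\<Sum>j\<in>J. t / L2_set c {..<d})"
        by (intro sum_mono normal_small_ball row_normal i c t)
      finally show "prob {\<omega> \<in> space M. Q u (\<lambda>k\<in>L. Z k \<omega>)} \<le> real (card J) * (t / L2_set c {..<d})"
        by simp
    qed
    also have "{\<omega>\<in>space M. E (\<lambda>k\<in>K. Z k \<omega>) \<and> Q (\<lambda>k\<in>K. Z k \<omega>) (\<lambda>k\<in>L. Z k \<omega>)} =
       {\<omega>\<in>space M. \<forall>i\<in>insert i A. \<exists>j\<in>J. \<bar>lin d (\<lambda>k. Z k \<omega>) c i - h j (\<lambda>k\<in>K0. Z k \<omega>)\<bar> \<le> t}"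
      by (auto simp: E_def Q_def linK linL resK)
    also have "{\<omega>\<in>space M. E (\<lambda>k\<in>K. Z k \<omega>)} =
       {\<omega>\<in>space M. \<forall>i\<in>A. \<exists>j\<in>J. \<bar>lin d (\<lambda>k. Z k \<omega>) c i - h j (\<lambda>k\<in>K0. Z k \<omega>)\<bar> \<le> t}"
      by (auto simp: E_def linK resK)
    also have "(real (card J) * (t / L2_set c {..<d})) * prob \<dots> \<le>
       (real (card J) * (t / L2_set c {..<d})) * (real (card J) * (t / L2_set c {..<d})) ^ card A"
    proof (rule mult_left_mono)
      show "prob {\<omega>\<in>space M. \<forall>i\<in>A. \<exists>j\<in>J. \<bar>lin d (\<lambda>k. Z k \<omega>) c i - h j (\<lambda>k\<in>K0. Z k \<omega>)\<bar> \<le> t}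
        \<le> (real (card J) * (t / L2_set c {..<d})) ^ card A"
        by (rule insert.IH) (use insert.prems in blast)
      show "0 \<le> real (card J) * (t / L2_set c {..<d})"
        using c t by simp
    qed
    finally show ?case
      unfolding card_insert_disjoint[OF insert.hyps] power_Suc .
  qed
qed

lemma row_measurable: "i < n \<Longrightarrow> random_variable borel (\<lambda>\<omega>. lin d (\<lambda>k. Z k \<omega>) c i)"
  unfolding lin_def by (intro borel_measurable_sum borel_measurable_times Z_measurable) auto

text \<open>The instance of \<open>near_targets_prob\<close> where 0 is the only target.\<close>

lemma small_rows_prob:
  assumes c: "0 < L2_set c {..<d}" and t: "0 < t" "t \<le> 1"
  shows "{\<omega>\<in>space M. \<exists>A\<subseteq>{..<n}. m \<le> real (card A) \<and> (\<forall>i\<in>A. \<bar>lin d (\<lambda>k. Z k \<omega>) c i\<bar> \<le> t * L2_set c {..<d})} \<in> events" (is "?S \<in> _")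
    and "prob {\<omega>\<in>space M. \<exists>A\<subseteq>{..<n}. m \<le> real (card A) \<and> (\<forall>i\<in>A. \<bar>lin d (\<lambda>k. Z k \<omega>) c i\<bar> \<le> t * L2_set c {..<d})}
      \<le> 2 ^ n * t powr m"
proof -
  define Ev where "Ev = (\<lambda>A. {\<omega>\<in>space M. \<forall>i\<in>A. \<exists>j\<in>{()}. \<bar>lin d (\<lambda>k. Z k \<omega>) c i - 0\<bar> \<le> t * L2_set c {..<d}})"
  have eq: "?S = (\<Union>A\<in>{A. A \<subseteq> {..<n} \<and> m \<le> real (card A)}. Ev A)"
    by (auto simp: Ev_def)
  have ev: "Ev A \<in> events" if "A \<subseteq> {..<n}" for A
  proof -
    have "finite A" using that by (rule finite_subset) simp
    then show ?thesis
      unfolding Ev_def using that row_measurable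
      by (intro sets.sets_Collect_finite_All sets.sets_Collect_finite_Ex) auto
  qed
  have pr: "prob (Ev A) \<le> t ^ card A" if "A \<subseteq> {..<n}" for A
    using near_targets_prob[of "{()}" "\<lambda>_ _. 0" A c "t * L2_set c {..<d}" A] that c t
    by (simp add: Ev_def)
  show "?S \<in> events"
    unfolding eq using ev by (intro sets.finite_UN) (auto intro: finite_subset[of _ "Pow {..<n}"])
  show "prob ?S \<le> 2 ^ n * t powr m"
    unfolding eq by (rule prob_large_subset[OF ev pr t])
qed

text \<open>The row \<open>j\<close> that is close to \<open>i\<close> is not part of the union bound: all candidates together are the
targets of row \<open>i\<close> and cost one factor \<open>n\<close> per row. The target rows lie outside \<open>A\<close>, so that the rows in
\<open>A\<close> stay independent of them.\<close>

lemma near_rows_prob: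
  assumes c: "0 < L2_set c {..<d}" and t: "0 < t" "real n * t \<le> 1" and n: "n > 0"
  shows "{\<omega>\<in>space M. \<exists>A\<subseteq>{..<n}. m \<le> real (card A) \<and> (\<forall>i\<in>A. \<exists>j\<in>{..<n} - A.
        \<bar>lin d (\<lambda>k. Z k \<omega>) c i - lin d (\<lambda>k. Z k \<omega>) b j\<bar> \<le> t * L2_set c {..<d})} \<in> events" (is "?S \<in> _")
    and "prob {\<omega>\<in>space M. \<exists>A\<subseteq>{..<n}. m \<le> real (card A) \<and> (\<forall>i\<in>A. \<exists>j\<in>{..<n} - A.
        \<bar>lin d (\<lambda>k. Z k \<omega>) c i - lin d (\<lambda>k. Z k \<omega>) b j\<bar> \<le> t * L2_set c {..<d})}
      \<le> 2 ^ n * (real n * t) powr m"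
proof -
  define Ev where "Ev = (\<lambda>A. {\<omega>\<in>space M. \<forall>i\<in>A. \<exists>j\<in>{..<n} - A.
     \<bar>lin d (\<lambda>k. Z k \<omega>) c i - lin d (\<lambda>k. Z k \<omega>) b j\<bar> \<le> t * L2_set c {..<d}})"
  have eq: "?S = (\<Union>A\<in>{A. A \<subseteq> {..<n} \<and> m \<le> real (card A)}. Ev A)"
    by (auto simp: Ev_def)
  have ev: "Ev A \<in> events" if "A \<subseteq> {..<n}" for A
  proof -
    have fin: "finite A" using that by (rule finite_subset) simp
    show ?thesis
      unfolding Ev_def
    proof (intro sets.sets_Collect_finite_All sets.sets_Collect_finite_Ex fin)
      fix i j assume "i \<in> A" "j \<in> {..<n} - A"
      then have [measurable]: "random_variable borel (\<lambda>\<omega>. lin d (\<lambda>k. Z k \<omega>) c i)"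
        "random_variable borel (\<lambda>\<omega>. lin d (\<lambda>k. Z k \<omega>) b j)"
        using that by (auto intro!: row_measurable)
      show "{\<omega>\<in>space M. \<bar>lin d (\<lambda>k. Z k \<omega>) c i - lin d (\<lambda>k. Z k \<omega>) b j\<bar> \<le> t * L2_set c {..<d}} \<in> events"
        by measurable
    qed simp
  qed
  have pr: "prob (Ev A) \<le> (real n * t) ^ card A" if A: "A \<subseteq> {..<n}" for A
  proof -
    let ?K = "({..<n} - A) \<times> {..<d}"
    have h: "lin d (\<lambda>k\<in>?K. Z k \<omega>) b j = lin d (\<lambda>k. Z k \<omega>) b j" if "j \<in> {..<n} - A" for j \<omega>
      using that by (intro lin_restrict) auto
    have "prob {\<omega>\<in>space M. \<forall>i\<in>A. \<exists>j\<in>{..<n} - A. \<bar>lin d (\<lambda>k. Z k \<omega>) c i - lin d (\<lambda>k\<in>?K. Z k \<omega>) b j\<bar> \<le> t * L2_set c {..<d}}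
      \<le> (real (card ({..<n} - A)) * (t * L2_set c {..<d} / L2_set c {..<d})) ^ card A"
      using A c t by (intro near_targets_prob lin_measurable) auto
    also have "\<dots> \<le> (real n * t) ^ card A"
      using c t A by (intro power_mono) (auto simp: card_Diff_subset finite_subset)
    finally show ?thesis
      by (simp add: Ev_def h)
  qed
  show "?S \<in> events"
    unfolding eq using ev by (intro sets.finite_UN) (auto intro: finite_subset[of _ "Pow {..<n}"])
  show "prob ?S \<le> 2 ^ n * (real n * t) powr m"
    unfolding eq using n t by (intro prob_large_subset[OF ev pr]) auto
qed

text \<open>Exponential Markov inequality at the parameter where each row contributes the factor \<open>sqrt 2\<close>.\<close>

lemma long_image_prob:
  assumes c: "0 < L2_set c {..<d}" and R: "R \<ge> 0"
  shows "{\<omega>\<in>space M. (\<Sum>i<n. (lin d (\<lambda>k. Z k \<omega>) c i)\<^sup>2) \<ge> R * (L2_set c {..<d})\<^sup>2} \<in> events" (is "?S \<in> _")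
    and "prob {\<omega>\<in>space M. (\<Sum>i<n. (lin d (\<lambda>k. Z k \<omega>) c i)\<^sup>2) \<ge> R * (L2_set c {..<d})\<^sup>2} \<le> 2 ^ n * exp (- R / 4)"
proof -
  let ?s = "L2_set c {..<d}"
  let ?f = "\<lambda>i \<omega>. exp ((lin d (\<lambda>k. Z k \<omega>) c i)\<^sup>2 / (4 * ?s\<^sup>2))"
  have [measurable]: "random_variable borel (\<lambda>\<omega>. lin d (\<lambda>k. Z k \<omega>) c i)" if "i < n" for i
    using that by (rule row_measurable)
  have [measurable]: "random_variable borel (\<lambda>\<omega>. \<Sum>i<n. (lin d (\<lambda>k. Z k \<omega>) c i)\<^sup>2)"
    by (intro borel_measurable_sum) auto
  show S: "?S \<in> events" by measurable
  have ind: "indep_vars (\<lambda>_. borel) ?f {..<n}"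
  proof -
    have "indep_vars (\<lambda>i. Pi\<^sub>M ({i} \<times> {..<d}) (\<lambda>_. borel)) (\<lambda>i \<omega>. restrict (\<lambda>k. Z k \<omega>) ({i} \<times> {..<d})) {..<n}"
      by (rule indep_vars_restrict[OF indep]) (auto simp: disjoint_family_on_def)
    moreover have "(\<lambda>u. exp ((lin d u c i)\<^sup>2 / (4 * ?s\<^sup>2))) \<in> borel_measurable (Pi\<^sub>M ({i} \<times> {..<d}) (\<lambda>_. borel))" for i
    proof -
      have [measurable]: "(\<lambda>u. lin d u c i) \<in> borel_measurable (Pi\<^sub>M ({i} \<times> {..<d}) (\<lambda>_. borel))"
        by (rule lin_measurable) auto
      show ?thesis by measurable
    qed
    ultimately have "indep_vars (\<lambda>_. borel)
       (\<lambda>i \<omega>. exp ((lin d (restrict (\<lambda>k. Z k \<omega>) ({i} \<times> {..<d})) c i)\<^sup>2 / (4 * ?s\<^sup>2))) {..<n}"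
      by (rule indep_vars_compose2)
    then show ?thesis
      by (simp add: lin_restrict)
  qed
  have "emeasure M ?S \<le> emeasure M {\<omega>\<in>space M. 1 \<le> ennreal (exp (- R / 4)) * ennreal (\<Prod>i<n. ?f i \<omega>)}"
  proof (intro emeasure_mono subsetI CollectI conjI)
    fix \<omega> assume w: "\<omega> \<in> ?S"
    have "R / 4 \<le> (\<Sum>i<n. (lin d (\<lambda>k. Z k \<omega>) c i)\<^sup>2) / (4 * ?s\<^sup>2)"
      using w c by (simp add: field_simps)
    then have "1 \<le> exp (- R / 4) * exp (\<Sum>i<n. (lin d (\<lambda>k. Z k \<omega>) c i)\<^sup>2 / (4 * ?s\<^sup>2))"
      by (simp add: exp_add[symmetric] sum_divide_distrib)
    then show "1 \<le> ennreal (exp (- R / 4)) * ennreal (\<Prod>i<n. ?f i \<omega>)"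
      by (simp add: ennreal_mult[symmetric] prod_nonneg exp_sum)
  qed auto
  also have "\<dots> \<le> ennreal (exp (- R / 4)) * (\<integral>\<^sup>+\<omega>. ennreal (\<Prod>i<n. ?f i \<omega>) * indicator (space M) \<omega> \<partial>M)"
    by (rule nn_integral_Markov_inequality) auto
  also have "(\<integral>\<^sup>+\<omega>. ennreal (\<Prod>i<n. ?f i \<omega>) * indicator (space M) \<omega> \<partial>M) =
      (\<integral>\<^sup>+\<omega>. (\<Prod>i<n. ennreal (?f i \<omega>)) \<partial>M)"
    by (intro nn_integral_cong) (auto simp: prod_ennreal)
  also have "\<dots> = (\<Prod>i<n. \<integral>\<^sup>+\<omega>. ennreal (?f i \<omega>) \<partial>M)"
    by (rule indep_vars_nn_integral) (auto intro!: indep_vars_compose2[OF ind])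
  also have "\<dots> = (\<Prod>i<n. ennreal (sqrt 2))"
    by (intro prod.cong refl normal_exp_square row_normal c) auto
  also have "\<dots> = ennreal (sqrt 2 ^ n)"
    by (simp add: ennreal_power)
  also have "ennreal (exp (- R / 4)) * ennreal (sqrt 2 ^ n) \<le> ennreal (2 ^ n * exp (- R / 4))"
    using sqrt2_less_2 by (subst ennreal_mult[symmetric]) (auto intro!: ennreal_leI power_mono)
  finally show "prob ?S \<le> 2 ^ n * exp (- R / 4)"
    unfolding emeasure_eq_measure by (simp add: ennreal_le_iff)
qed

end

section \<open>Norms, permutations and integer grids\<close>

lemma lin_add: "lin d A (\<lambda>j. b j + c j) i = lin d A b i + lin d A c i"
  by (simp add: lin_def ring_distribs sum.distrib)

lemma lin_diff: "lin d A (\<lambda>j. b j - c j) i = lin d A b i - lin d A c i"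
  by (simp add: lin_def ring_distribs sum_subtractf)

lemma lin_scale: "lin d A (\<lambda>j. s * c j) i = s * lin d A c i"
  by (simp add: lin_def sum_distrib_left mult_ac)

lemma L2_set_diff_le: "L2_set f A \<le> L2_set (\<lambda>i. f i - g i) A + L2_set g A"
  using L2_set_triangle_ineq[of "\<lambda>i. f i - g i" g A] by simp

lemma L2_set_subset: "A \<subseteq> B \<Longrightarrow> finite B \<Longrightarrow> L2_set f A \<le> L2_set f B"
  unfolding L2_set_def by (intro real_sqrt_le_mono sum_mono2) auto

lemma L2_set_minus: "L2_set (\<lambda>i. - f i) A = L2_set f A"
  by (simp add: L2_set_def)

lemma L2_set_scale: "s \<ge> 0 \<Longrightarrow> L2_set (\<lambda>j. s * f j) A = s * L2_set f A"
  by (simp add: L2_set_right_distrib)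

lemma L2_set_permute: "f permutes A \<Longrightarrow> L2_set (\<lambda>j. g (f j)) A = L2_set g A"
  unfolding L2_set_def by (subst sum.permute[of f A "\<lambda>j. (g j)\<^sup>2"]) (auto simp: o_def)

lemma L2_set_power2: "(L2_set f A)\<^sup>2 = (\<Sum>i\<in>A. (f i)\<^sup>2)"
  by (simp add: L2_set_def sum_nonneg)

lemma card_large_le:
  assumes "finite A" "t \<ge> 0"
  shows "real (card {j\<in>A. t < \<bar>g j\<bar>}) * t\<^sup>2 \<le> (L2_set g A)\<^sup>2"
proof -
  have "real (card {j\<in>A. t < \<bar>g j\<bar>}) * t\<^sup>2 = (\<Sum>j\<in>{j\<in>A. t < \<bar>g j\<bar>}. t\<^sup>2)"
    by simp
  also have "\<dots> \<le> (\<Sum>j\<in>{j\<in>A. t < \<bar>g j\<bar>}. (g j)\<^sup>2)"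
    using assms by (intro sum_mono) (auto simp: abs_le_square_iff[symmetric])
  also have "\<dots> \<le> (\<Sum>j\<in>A. (g j)\<^sup>2)"
    using assms by (intro sum_mono2) auto
  finally show ?thesis by (simp add: L2_set_power2)
qed

lemma L2_set_ge_card:
  assumes "finite A" "t \<ge> 0" "\<And>j. j \<in> A \<Longrightarrow> t \<le> \<bar>g j\<bar>"
  shows "sqrt (real (card A)) * t \<le> L2_set g A"
proof -
  have "sqrt (real (card A)) * t = sqrt (\<Sum>j\<in>A. t\<^sup>2)"
    using assms by (simp add: real_sqrt_mult)
  also have "\<dots> \<le> L2_set g A"
    unfolding L2_set_def using assms
    by (intro real_sqrt_le_mono sum_mono) (auto simp: abs_le_square_iff[symmetric])
  finally show ?thesis .
qed

lemma L2_set_le_card: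
  assumes "t \<ge> 0" "\<And>j. j \<in> A \<Longrightarrow> \<bar>g j\<bar> \<le> t"
  shows "L2_set g A \<le> sqrt (real (card A)) * t"
proof -
  have "L2_set g A \<le> sqrt (\<Sum>j\<in>A. t\<^sup>2)"
    unfolding L2_set_def using assms
    by (intro real_sqrt_le_mono sum_mono) (auto simp: abs_le_square_iff[symmetric])
  then show ?thesis
    using assms by (simp add: real_sqrt_mult)
qed

text \<open>Take \<open>A\<close> maximal with \<open>A \<inter> f ` A = {}\<close>. A point of \<open>G\<close> that cannot be added to \<open>A\<close> is the image of
a point of \<open>A\<close> or is mapped into \<open>A\<close>, and as \<open>f\<close> is injective there are at most \<open>card A\<close> points of
either kind.\<close>

lemma independent_subset:
  assumes fin: "finite G" and inj: "inj_on f G" and nofix: "\<And>i. i \<in> G \<Longrightarrow> f i \<noteq> i"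
  shows "\<exists>A\<subseteq>G. A \<inter> f ` A = {} \<and> card G \<le> 3 * card A"
proof -
  let ?P = "\<lambda>A. A \<subseteq> G \<and> A \<inter> f ` A = {}"
  have "?P {}" by simp
  moreover have "\<forall>A. ?P A \<longrightarrow> card A < Suc (card G)"
    using fin by (auto simp: less_Suc_eq_le intro: card_mono)
  ultimately obtain A where A: "?P A" and max: "\<And>B. ?P B \<Longrightarrow> card B \<le> card A"
    using ex_has_greatest_nat[of ?P "{}" card "Suc (card G)"] by blast
  have finA: "finite A" using A fin by (auto intro: finite_subset)
  have "G \<subseteq> A \<union> {i\<in>G. f i \<in> A} \<union> f ` A"
  proof
    fix i assume i: "i \<in> G"
    show "i \<in> A \<union> {i\<in>G. f i \<in> A} \<union> f ` A"
    proof (rule ccontr)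
      assume n: "\<not> ?thesis"
      then have "?P (insert i A)" using i A nofix[OF i] by auto
      then have "card (insert i A) \<le> card A" by (rule max)
      then show False using n finA by simp
    qed
  qed
  then have "card G \<le> card (A \<union> {i\<in>G. f i \<in> A} \<union> f ` A)"
    using fin finA by (intro card_mono) auto
  also have "\<dots> \<le> card A + card {i\<in>G. f i \<in> A} + card (f ` A)"
    by (meson card_Un_le add_le_mono order_trans order_refl)
  also have "card {i\<in>G. f i \<in> A} \<le> card A"
    using finA inj by (intro card_inj_on_le[where f = f]) (auto intro: inj_on_subset)
  also have "card (f ` A) \<le> card A" using finA by (rule card_image_le)
  finally show ?thesis using A by (intro exI[of _ A]) auto
qed

text \<open>Undefined outside \<open>{..<d}\<close>, which makes the grid finite.\<close>

definition int_grid :: "nat \<Rightarrow> nat \<Rightarrow> (nat \<Rightarrow> real) set" where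
  "int_grid N d = (\<Pi>\<^sub>E j\<in>{..<d}. real_of_int ` {- int N..int N})"

lemma finite_int_grid: "finite (int_grid N d)"
  unfolding int_grid_def by (intro finite_PiE) auto

lemma card_int_grid: "card (int_grid N d) = (2 * N + 1) ^ d"
  unfolding int_grid_def
  by (subst card_PiE) (auto simp: card_image inj_on_def nat_add_distrib nat_mult_distrib)

text \<open>That integer coordinates survive guarantees that a vector scaled to have a coordinate of size \<open>N\<close>
does not lose it.\<close>

lemma round_to_int_grid:
  assumes b: "\<And>j. j < d \<Longrightarrow> \<bar>b j\<bar> \<le> real N"
  obtains z where "z \<in> int_grid N d" "\<And>j. j < d \<Longrightarrow> \<bar>b j - z j\<bar> \<le> 1"
    "\<And>j. j < d \<Longrightarrow> b j \<in> \<int> \<Longrightarrow> z j = b j"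
proof -
  define z where "z = (\<lambda>j\<in>{..<d}. real_of_int \<lfloor>b j\<rfloor>)"
  have "\<lfloor>b j\<rfloor> \<in> {- int N..int N}" if "j < d" for j
    using b[OF that] by (auto simp: le_floor_iff floor_le_iff abs_le_iff)
  then have "z \<in> int_grid N d"
    by (auto simp: int_grid_def z_def)
  moreover have "\<bar>b j - z j\<bar> \<le> 1" if "j < d" for j
    using that by (auto simp: z_def abs_le_iff) linarith+
  moreover have "z j = b j" if "j < d" "b j \<in> \<int>" for j
    using that by (auto simp: z_def Ints_def)
  ultimately show ?thesis using that by blast
qed

lemma lin_le:
  assumes "\<And>j. j < d \<Longrightarrow> \<bar>A (i, j)\<bar> \<le> t" "\<And>j. j < d \<Longrightarrow> \<bar>e j\<bar> \<le> s" "t \<ge> 0"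
  shows "\<bar>lin d A e i\<bar> \<le> real d * (t * s)"
proof -
  have "\<bar>lin d A e i\<bar> \<le> (\<Sum>j<d. \<bar>A (i, j) * e j\<bar>)"
    unfolding lin_def by (rule sum_abs)
  also have "\<dots> \<le> (\<Sum>j<d. t * s)"
    using assms by (intro sum_mono) (auto simp: abs_mult intro!: mult_mono)
  finally show ?thesis by simp
qed

section \<open>Designs that spread every direction\<close>

text \<open>Up to powers of \<open>n\<close>, all singular values of the design are of order \<open>sqrt n\<close>, and the length of the
image of any \<open>c\<close> is not concentrated on a few rows: more than half of the rows see at least their
typical share.\<close>

definition well_spread :: "real \<Rightarrow> nat \<Rightarrow> nat \<Rightarrow> (nat \<times> nat \<Rightarrow> real) \<Rightarrow> bool" where
  "well_spread a n d A \<longleftrightarrow>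
     (\<forall>c. L2_set (lin d A c) {..<n} \<le> 4 * real n powr ((1 + a) / 2) * L2_set c {..<d}) \<and>
     (\<forall>c. 0 < L2_set c {..<d} \<longrightarrow>
        2 * card {i\<in>{..<n}. \<bar>lin d A c i\<bar> \<le> real n powr (- a) / 4 * L2_set c {..<d}} < n)"

text \<open>Both properties are homogeneous in \<open>c\<close>, so \<open>c\<close> may be scaled to maximum norm \<open>n ^ 5\<close> and rounded.
Rounding changes an entry of the image by at most \<open>d n ^ 2 \<le> n ^ 3\<close>, which is negligible compared with
\<open>n powr (-a) * n ^ 5\<close>.\<close>

lemma well_spread_from_grid:
  assumes n: "n \<ge> 2" and dn: "d \<le> n" and a: "0 < a" "a \<le> 1"
    and entries: "\<And>i j. i < n \<Longrightarrow> j < d \<Longrightarrow> \<bar>A (i, j)\<bar> \<le> real n ^ 2"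
    and up: "\<And>z. z \<in> int_grid (n ^ 5) d \<Longrightarrow> 0 < L2_set z {..<d} \<Longrightarrow>
       (\<Sum>i<n. (lin d A z i)\<^sup>2) < real n powr (1 + a) * (L2_set z {..<d})\<^sup>2"
    and low: "\<And>z. z \<in> int_grid (n ^ 5) d \<Longrightarrow> 0 < L2_set z {..<d} \<Longrightarrow>
       \<not> (\<exists>B\<subseteq>{..<n}. real n / 2 \<le> real (card B) \<and> (\<forall>i\<in>B. \<bar>lin d A z i\<bar> \<le> real n powr (- a) * L2_set z {..<d}))"
  shows "well_spread a n d A"
proof -
  have key: "L2_set (lin d A c) {..<n} \<le> 4 * real n powr ((1 + a) / 2) * L2_set c {..<d} \<and>
     2 * card {i\<in>{..<n}. \<bar>lin d A c i\<bar> \<le> real n powr (- a) / 4 * L2_set c {..<d}} < n"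
    if c0: "0 < L2_set c {..<d}" for c
  proof -
    define m where "m = Max ((\<lambda>j. \<bar>c j\<bar>) ` {..<d})"
    have "\<exists>j<d. c j \<noteq> 0"
      using c0 by (metis L2_set_0' lessThan_iff less_irrefl)
    then obtain j0 where j0: "j0 < d" "c j0 \<noteq> 0" by auto
    have m_ge: "\<bar>c j\<bar> \<le> m" if "j < d" for j
      unfolding m_def using that by (intro Max_ge) auto
    have m: "m > 0" using m_ge[OF j0(1)] j0(2) by simp
    have "m \<in> (\<lambda>j. \<bar>c j\<bar>) ` {..<d}"
      unfolding m_def using j0 by (intro Max_in) auto
    then obtain j1 where j1: "j1 < d" "\<bar>c j1\<bar> = m" by auto
    define \<mu> where "\<mu> = real n ^ 5 / m"
    have \<mu>: "\<mu> > 0" using m n by (simp add: \<mu>_def)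
    have bd: "\<bar>\<mu> * c j\<bar> \<le> real (n ^ 5)" if "j < d" for j
      using m_ge[OF that] m by (auto simp: \<mu>_def abs_mult field_simps intro: mult_right_mono)
    obtain z where z: "z \<in> int_grid (n ^ 5) d" "\<And>j. j < d \<Longrightarrow> \<bar>\<mu> * c j - z j\<bar> \<le> 1"
      "\<And>j. j < d \<Longrightarrow> \<mu> * c j \<in> \<int> \<Longrightarrow> z j = \<mu> * c j"
      using round_to_int_grid[of d "\<lambda>j. \<mu> * c j", OF bd] by blast
    have "\<mu> * c j1 = real n ^ 5 \<or> \<mu> * c j1 = - (real n ^ 5)"
      using j1 m by (auto simp: \<mu>_def field_simps abs_if split: if_splits)
    then have zj1: "\<bar>z j1\<bar> = real n ^ 5"
      using z(3)[OF j1(1)] by (auto simp: abs_if)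
    have zN: "real n ^ 5 \<le> L2_set z {..<d}"
      using member_le_L2_set[of "{..<d}" j1 "\<lambda>j. \<bar>z j\<bar>"] j1 zj1
      by (simp add: L2_set_def)
    let ?e = "\<lambda>j. \<mu> * c j - z j"
    have e: "\<bar>lin d A ?e i\<bar> \<le> real n ^ 3" if "i < n" for i
    proof -
      have "\<bar>lin d A ?e i\<bar> \<le> real d * (real n ^ 2 * 1)"
        using that z(2) entries by (intro lin_le) auto
      also have "\<dots> \<le> real n * (real n ^ 2 * 1)"
        using dn by (intro mult_right_mono) auto
      finally show ?thesis by (simp add: power3_eq_cube power2_eq_square)
    qed
    have eN: "L2_set ?e {..<d} \<le> real n"
    proof -
      have "L2_set ?e {..<d} \<le> (\<Sum>j<d. \<bar>?e j\<bar>)" by (rule L2_set_le_sum_abs)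
      also have "\<dots> \<le> (\<Sum>j<d. 1)" using z(2) by (intro sum_mono) auto
      finally show ?thesis using dn by simp
    qed
    have n2: "2 \<le> real n" using n by simp
    have p: "1 \<le> real n ^ k" for k using n by simp
    have nN: "2 * real n \<le> real n ^ 5"
    proof -
      have "2 * real n \<le> real n * real n" using n2 by (intro mult_right_mono) auto
      also have "\<dots> = real n ^ 2" by (simp add: power2_eq_square)
      also have "\<dots> \<le> real n ^ 5" using n by (intro power_increasing) auto
      finally show ?thesis .
    qed
    have \<mu>c: "L2_set (\<lambda>j. \<mu> * c j) {..<d} = \<mu> * L2_set c {..<d}"
      using \<mu> by (simp add: L2_set_right_distrib)
    have cz: "\<mu> * L2_set c {..<d} \<le> 2 * L2_set z {..<d}"
      using L2_set_diff_le[of "\<lambda>j. \<mu> * c j" "{..<d}" z] eN zN nN \<mu>c by simp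
    have zc: "L2_set z {..<d} \<le> 2 * (\<mu> * L2_set c {..<d})"
    proof -
      have "L2_set z {..<d} \<le> L2_set ?e {..<d} + \<mu> * L2_set c {..<d}"
        using L2_set_diff_le[of z "{..<d}" "\<lambda>j. \<mu> * c j"] \<mu>c L2_set_minus[of ?e "{..<d}"] by simp
      then show ?thesis using eN zN nN by simp
    qed
    have z0: "0 < L2_set z {..<d}" using zN p[of 5] by linarith
    have lc: "lin d A (\<lambda>j. \<mu> * c j) i = lin d A z i + lin d A ?e i" for i
      using lin_add[of d A z ?e i] by simp
    have half: "real n ^ 3 \<le> real n powr (- a) / 2 * L2_set z {..<d}"
    proof -
      have "2 * real n ^ 3 \<le> real n powr (- 1) * real n ^ 5"
        using n n2 by (simp add: powr_minus field_simps eval_nat_numeral)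
      also have "\<dots> \<le> real n powr (- a) * real n ^ 5"
        using a n by (intro mult_right_mono powr_mono) auto
      also have "\<dots> \<le> real n powr (- a) * L2_set z {..<d}"
        using zN by (intro mult_left_mono) auto
      finally show ?thesis by simp
    qed
    have "L2_set (lin d A (\<lambda>j. \<mu> * c j)) {..<n} \<le> L2_set (lin d A z) {..<n} + L2_set (lin d A ?e) {..<n}"
      unfolding lc[abs_def] by (rule L2_set_triangle_ineq)
    also have "L2_set (lin d A z) {..<n} \<le> real n powr ((1 + a) / 2) * L2_set z {..<d}"
    proof -
      have "real n powr (1 + a) = (real n powr ((1 + a) / 2))\<^sup>2"
        by (simp add: powr_powr powr_realpow[symmetric] power2_eq_square powr_add[symmetric])
      then have "(L2_set (lin d A z) {..<n})\<^sup>2 \<le> (real n powr ((1 + a) / 2) * L2_set z {..<d})\<^sup>2"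
        using up[OF z(1) z0] by (simp add: L2_set_power2 power_mult_distrib)
      then show ?thesis by (rule power2_le_imp_le) simp
    qed
    also have "L2_set (lin d A ?e) {..<n} \<le> real n powr ((1 + a) / 2) * L2_set z {..<d}"
    proof -
      have "L2_set (lin d A ?e) {..<n} \<le> (\<Sum>i<n. \<bar>lin d A ?e i\<bar>)" by (rule L2_set_le_sum_abs)
      also have "\<dots> \<le> (\<Sum>i<n. real n ^ 3)" using e by (intro sum_mono) auto
      also have "\<dots> = real n ^ 4" by (simp add: eval_nat_numeral)
      also have "\<dots> \<le> real n ^ 5" using n by (intro power_increasing) auto
      also have "\<dots> \<le> 1 * L2_set z {..<d}" using zN by simp
      also have "\<dots> \<le> real n powr ((1 + a) / 2) * L2_set z {..<d}"
        using n a by (intro mult_right_mono ge_one_powr_ge_zero) auto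
      finally show ?thesis .
    qed
    finally have "\<mu> * L2_set (lin d A c) {..<n} \<le> 2 * real n powr ((1 + a) / 2) * L2_set z {..<d}"
      using \<mu> by (simp add: lin_scale[abs_def] L2_set_scale mult_ac)
    also have "\<dots> \<le> 2 * real n powr ((1 + a) / 2) * (2 * (\<mu> * L2_set c {..<d}))"
      using zc by (intro mult_left_mono) auto
    also have "\<dots> = \<mu> * (4 * real n powr ((1 + a) / 2) * L2_set c {..<d})" by simp
    finally have 1: "L2_set (lin d A c) {..<n} \<le> 4 * real n powr ((1 + a) / 2) * L2_set c {..<d}"
      using \<mu> by simp
    have "\<bar>lin d A z i\<bar> \<le> real n powr (- a) * L2_set z {..<d}"
      if i: "i < n" "\<bar>lin d A c i\<bar> \<le> real n powr (- a) / 4 * L2_set c {..<d}" for i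
    proof -
      have "lin d A z i = \<mu> * lin d A c i - lin d A ?e i"
        using lc[of i] by (simp add: lin_scale)
      then have "\<bar>lin d A z i\<bar> \<le> \<mu> * \<bar>lin d A c i\<bar> + real n ^ 3"
        using e[OF i(1)] \<mu> abs_triangle_ineq4[of "\<mu> * lin d A c i" "lin d A ?e i"] by (simp add: abs_mult)
      also have "\<dots> \<le> \<mu> * (real n powr (- a) / 4 * L2_set c {..<d}) + real n powr (- a) / 2 * L2_set z {..<d}"
        using i(2) \<mu> half by (intro add_mono mult_left_mono) auto
      also have "\<dots> = real n powr (- a) / 4 * (\<mu> * L2_set c {..<d}) + real n powr (- a) / 2 * L2_set z {..<d}"
        by simp
      also have "\<dots> \<le> real n powr (- a) / 4 * (2 * L2_set z {..<d}) + real n powr (- a) / 2 * L2_set z {..<d}"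
        using cz by (intro add_mono mult_left_mono) auto
      finally show ?thesis by (simp add: mult_ac)
    qed
    then have "\<not> real n / 2 \<le> real (card {i\<in>{..<n}. \<bar>lin d A c i\<bar> \<le> real n powr (- a) / 4 * L2_set c {..<d}})"
      using low[OF z(1) z0] by (metis (no_types, lifting) lessThan_iff mem_Collect_eq subsetI)
    then show ?thesis using 1 by linarith
  qed
  have "L2_set (lin d A c) {..<n} \<le> 4 * real n powr ((1 + a) / 2) * L2_set c {..<d}" for c
  proof (cases "0 < L2_set c {..<d}")
    case False
    then have 0: "L2_set c {..<d} = 0" using L2_set_nonneg[of c "{..<d}"] by linarith
    then have "\<forall>j<d. c j = 0" by (simp add: L2_set_eq_0_iff)
    then have "lin d A c i = 0" for i by (simp add: lin_def)
    then have "L2_set (lin d A c) {..<n} = 0" by (simp add: L2_set_eq_0_iff)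
    then show ?thesis by (simp add: 0)
  qed (use key in blast)
  then show ?thesis using key by (auto simp: well_spread_def)
qed

text \<open>Fewer than \<open>n/2\<close> rows are small, so at least \<open>n/4\<close> of the rows in \<open>F\<close> are not.\<close>

lemma well_spread_lower:
  assumes ws: "well_spread a n d A" and F: "F \<subseteq> {..<n}" "3 * n \<le> 4 * card F"
  shows "sqrt (real n) / 8 * real n powr (- a) * L2_set c {..<d} \<le> L2_set (lin d A c) F"
proof (cases "0 < L2_set c {..<d}")
  case False
  then have "L2_set c {..<d} = 0" using L2_set_nonneg[of c "{..<d}"] by linarith
  then show ?thesis by simp
next
  case True
  let ?t = "real n powr (- a) / 4 * L2_set c {..<d}"
  let ?S = "{i\<in>{..<n}. \<bar>lin d A c i\<bar> \<le> ?t}"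
  have fF: "finite F" using F(1) by (rule finite_subset) simp
  have "2 * card ?S < n" using ws True by (auto simp: well_spread_def)
  moreover have "card F \<le> card (F - ?S) + card ?S"
    using card_Un_le[of "F - ?S" ?S] card_mono[of "(F - ?S) \<union> ?S" F] fF by fastforce
  ultimately have "n \<le> 4 * card (F - ?S)" using F(2) by linarith
  then have c: "sqrt (real n) / 2 \<le> sqrt (real (card (F - ?S)))"
    by (intro real_le_rsqrt) (simp add: power_divide)
  have "sqrt (real n) / 8 * real n powr (- a) * L2_set c {..<d} = sqrt (real n) / 2 * ?t" by simp
  also have "\<dots> \<le> sqrt (real (card (F - ?S))) * ?t"
    using c True by (intro mult_right_mono) auto
  also have "\<dots> \<le> L2_set (lin d A c) (F - ?S)"
    using F True fF by (intro L2_set_ge_card) auto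
  also have "\<dots> \<le> L2_set (lin d A c) F" using fF by (intro L2_set_subset) auto
  finally show ?thesis .
qed

text \<open>Any three quarters of the rows control the whole image. As this holds for all \<open>F\<close> and \<open>c\<close> at once, the
set of rows fixed by the estimate need not be independent of the design.\<close>

lemma well_spread_dominated:
  assumes ws: "well_spread a n d A" and F: "F \<subseteq> {..<n}" "3 * n \<le> 4 * card F" and n: "n > 0"
  shows "L2_set (lin d A c) {..<n} \<le> 32 * real n powr (3 * a / 2) * L2_set (lin d A c) F"
proof -
  have e: "real n powr ((1 + a) / 2) = real n powr (3 * a / 2) * (sqrt (real n) * real n powr (- a))"
    using n by (simp add: powr_half_sqrt[symmetric] powr_add[symmetric] field_simps)
  have "L2_set (lin d A c) {..<n} \<le> 4 * real n powr ((1 + a) / 2) * L2_set c {..<d}"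
    using ws by (auto simp: well_spread_def)
  also have "\<dots> = 32 * real n powr (3 * a / 2) * (sqrt (real n) / 8 * real n powr (- a) * L2_set c {..<d})"
    by (simp add: e)
  also have "\<dots> \<le> 32 * real n powr (3 * a / 2) * L2_set (lin d A c) F"
    using well_spread_lower[OF ws F] by (intro mult_left_mono) auto
  finally show ?thesis .
qed


section \<open>Least-squares fits under a permutation\<close>

lemma card_moved_add_fixed:
  "real (card {j\<in>{..<n}. f j \<noteq> j}) + real (card {j\<in>{..<n}. f j = j}) = real n"
proof -
  have "card {j\<in>{..<n}. f j \<noteq> j} + card {j\<in>{..<n}. f j = j} =
      card ({j\<in>{..<n}. f j \<noteq> j} \<union> {j\<in>{..<n}. f j = j})"
    by (subst card_Un_disjoint) auto
  also have "{j\<in>{..<n}. f j \<noteq> j} \<union> {j\<in>{..<n}. f j = j} = {..<n}" by auto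
  finally show ?thesis by simp
qed

text \<open>A small residual puts most \<open>x (f j)\<close> close to \<open>(X b) j\<close>. Among the moved rows where this happens, choose
\<open>j\<close> ranging over a set disjoint from its image under \<open>f\<close>; the image is then a set of rows that are all
close to targets outside it, which \<open>far\<close> excludes for \<open>b\<close> in the grid. The vector \<open>b\<close> itself has norm
at most \<open>n B\<close>, as its image is not much longer than \<open>x\<close>.\<close>

lemma few_moved:
  assumes n: "n > 0" and a: "a > 0" "40 * real n powr (3 * a / 2) \<le> real n" and dn: "d \<le> n"
    and ws: "well_spread a n d A" and f: "f permutes {..<n}" and B: "0 < L2_set \<beta> {..<d}"
    and entries: "\<And>i j. i < n \<Longrightarrow> j < d \<Longrightarrow> \<bar>A (i, j)\<bar> \<le> real n ^ 2"
    and S: "L2_set (\<lambda>j. lin d A \<beta> (f j) - lin d A b j) {..<n} \<le> S"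
      "8 * S\<^sup>2 \<le> real n * (real n powr (- 1 - a) / 2 * L2_set \<beta> {..<d})\<^sup>2" "S \<le> L2_set \<beta> {..<d}"
    and far: "\<And>z. z \<in> int_grid (n ^ 6) d \<Longrightarrow>
      \<not> (\<exists>C\<subseteq>{..<n}. real n / 24 \<le> real (card C) \<and> (\<forall>i\<in>C. \<exists>j\<in>{..<n} - C.
        \<bar>lin d A \<beta> i - lin d A (\<lambda>l. L2_set \<beta> {..<d} / real n ^ 5 * z l) j\<bar>
          \<le> real n powr (- 1 - a) * L2_set \<beta> {..<d}))"
  shows "real (card {j\<in>{..<n}. f j \<noteq> j}) \<le> real n / 4"
proof (rule ccontr)
  assume many: "\<not> ?thesis"
  let ?B = "L2_set \<beta> {..<d}" and ?x = "lin d A \<beta>" and ?v = "lin d A b"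
  let ?t = "real n powr (- 1 - a)"
  have n1: "real n \<ge> 1" using n by simp
  have bn: "L2_set b {..<d} \<le> real n * ?B"
  proof -
    have "sqrt (real n) / 8 * real n powr (- a) * L2_set b {..<d} \<le> L2_set ?v {..<n}"
      by (rule well_spread_lower[OF ws]) auto
    moreover have "L2_set ?v {..<n} \<le> L2_set (\<lambda>j. ?v j - ?x (f j)) {..<n} + L2_set (\<lambda>j. ?x (f j)) {..<n}"
      by (rule L2_set_diff_le)
    moreover have "L2_set (\<lambda>j. ?v j - ?x (f j)) {..<n} \<le> ?B"
      using L2_set_minus[of "\<lambda>j. ?x (f j) - ?v j"] S by simp
    moreover have "L2_set (\<lambda>j. ?x (f j)) {..<n} \<le> 4 * real n powr ((1 + a) / 2) * ?B"
      using L2_set_permute[OF f, of ?x] ws by (simp add: well_spread_def)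
    moreover have "?B \<le> real n powr ((1 + a) / 2) * ?B"
      using n1 a B by (simp add: ge_one_powr_ge_zero)
    ultimately have "sqrt (real n) / 8 * real n powr (- a) * L2_set b {..<d} \<le>
        real n powr ((1 + a) / 2) * ?B + 4 * real n powr ((1 + a) / 2) * ?B"
      by linarith
    also have "real n powr ((1 + a) / 2) * ?B + 4 * real n powr ((1 + a) / 2) * ?B
      = sqrt (real n) / 8 * real n powr (- a) * ((40 * real n powr (3 * a / 2)) * ?B)"
    proof -
      have "real n powr ((1 + a) / 2) = real n powr (3 * a / 2) * (sqrt (real n) * real n powr (- a))"
        using n by (simp add: powr_half_sqrt[symmetric] powr_add[symmetric] field_simps)
      then show ?thesis by simp
    qed
    finally have "L2_set b {..<d} \<le> 40 * real n powr (3 * a / 2) * ?B"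
      using n by (simp add: mult_ac)
    also have "\<dots> \<le> real n * ?B" using a B by (intro mult_right_mono) auto
    finally show ?thesis by simp
  qed
  \<comment> \<open>Rounding \<open>b\<close> at spacing \<open>\<mu>\<close> moves an entry of its image by at most \<open>n ^ 3 * \<mu> = n powr (-2) * B\<close>, which is below half of the tolerance.\<close>
  define \<mu> where "\<mu> = ?B / real n ^ 5"
  have \<mu>: "\<mu> > 0" using B n by (simp add: \<mu>_def)
  have "\<bar>b j / \<mu>\<bar> \<le> real (n ^ 6)" if "j < d" for j
  proof -
    have "\<bar>b j\<bar> \<le> L2_set b {..<d}"
      using that member_le_L2_set[of "{..<d}" j "\<lambda>j. \<bar>b j\<bar>"] by (simp add: L2_set_def)
    also note bn
    also have "real n * ?B = real n ^ 6 * \<mu>" using n by (simp add: \<mu>_def eval_nat_numeral)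
    finally show ?thesis using \<mu> by (simp add: field_simps)
  qed
  then obtain z where z: "z \<in> int_grid (n ^ 6) d" "\<And>j. j < d \<Longrightarrow> \<bar>b j / \<mu> - z j\<bar> \<le> 1"
    using round_to_int_grid[of d "\<lambda>j. b j / \<mu>" "n ^ 6"] by blast
  define b' where "b' = (\<lambda>l. \<mu> * z l)"
  have bb': "\<bar>?v j - lin d A b' j\<bar> \<le> ?t / 2 * ?B" if j: "j < n" for j
  proof -
    have e: "\<bar>b l - b' l\<bar> \<le> \<mu>" if "l < d" for l
    proof -
      have "b l - b' l = \<mu> * (b l / \<mu> - z l)" using \<mu> by (simp add: b'_def field_simps)
      then have "\<bar>b l - b' l\<bar> = \<mu> * \<bar>b l / \<mu> - z l\<bar>" using \<mu> by (simp add: abs_mult)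
      also have "\<dots> \<le> \<mu>" using z(2)[OF that] \<mu> by simp
      finally show ?thesis .
    qed
    have "\<bar>lin d A (\<lambda>l. b l - b' l) j\<bar> \<le> real d * (real n ^ 2 * \<mu>)"
      using entries[OF j] e by (intro lin_le) auto
    also have "\<dots> \<le> real n * (real n ^ 2 * \<mu>)"
      using dn \<mu> by (intro mult_right_mono) auto
    also have "\<dots> = real n powr (- 2) * ?B"
      using n by (simp add: \<mu>_def powr_minus eval_nat_numeral powr_numeral field_simps)
    also have "real n powr (- 2) = real n powr (- 1 - a) * (real n powr a / real n)"
      using n by (simp add: powr_diff powr_minus powr_numeral field_simps power2_eq_square)
    also have "real n powr a / real n \<le> 1 / 2"
    proof -
      have "real n powr a \<le> real n powr (3 * a / 2)"
        using n1 a by (intro powr_mono) auto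
      then have "2 * real n powr a \<le> real n" using a powr_ge_zero[of "real n" a] by linarith
      then show ?thesis using n by (simp add: field_simps)
    qed
    finally show ?thesis
      using B by (simp add: lin_diff mult_right_mono mult_left_mono)
  qed
  let ?g = "\<lambda>j. ?x (f j) - ?v j"
  \<comment> \<open>The residual exceeds half of the tolerance in at most \<open>n/8\<close> rows, so \<open>n/8\<close> of the moved rows are left, and a third of them forms \<open>C\<close>.\<close>
  define G where "G = {j\<in>{..<n}. f j \<noteq> j \<and> \<bar>?g j\<bar> \<le> ?t / 2 * ?B}"
  have t0: "0 < ?t / 2 * ?B" using B n by simp
  have "real (card {j\<in>{..<n}. ?t / 2 * ?B < \<bar>?g j\<bar>}) * (?t / 2 * ?B)\<^sup>2 \<le> (L2_set ?g {..<n})\<^sup>2"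
    using t0 by (intro card_large_le) auto
  also have "\<dots> \<le> S\<^sup>2" using S(1) by (intro power_mono) auto
  also have "\<dots> \<le> real n / 8 * (?t / 2 * ?B)\<^sup>2" using S(2) by simp
  finally have "real (card {j\<in>{..<n}. ?t / 2 * ?B < \<bar>?g j\<bar>}) * (?t / 2 * ?B)\<^sup>2 \<le> real n / 8 * (?t / 2 * ?B)\<^sup>2" .
  then have bad: "real (card {j\<in>{..<n}. ?t / 2 * ?B < \<bar>?g j\<bar>}) \<le> real n / 8"
    by (rule mult_right_le_imp_le) (rule zero_less_power[OF t0])
  have "card {j\<in>{..<n}. f j \<noteq> j} \<le> card (G \<union> {j\<in>{..<n}. ?t / 2 * ?B < \<bar>?g j\<bar>})"
    by (intro card_mono) (auto simp: G_def)
  also have "\<dots> \<le> card G + card {j\<in>{..<n}. ?t / 2 * ?B < \<bar>?g j\<bar>}" by (rule card_Un_le)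
  finally have G: "real n / 8 \<le> real (card G)" using many bad by linarith
  have injf: "inj_on f X" for X using f by (meson inj_on_subset permutes_inj subset_UNIV)
  obtain C where C: "C \<subseteq> G" "C \<inter> f ` C = {}" "card G \<le> 3 * card C"
  proof -
    have "finite G" "\<And>i. i \<in> G \<Longrightarrow> f i \<noteq> i" by (simp_all add: G_def)
    then show ?thesis using independent_subset[of G f] injf that by blast
  qed
  have "f ` C \<subseteq> {..<n}"
    using C(1) permutes_in_image[OF f] by (auto simp: G_def)
  moreover have "real n / 24 \<le> real (card (f ` C))"
    using C(3) G card_image[OF injf, of C] by simp
  moreover have "\<exists>j\<in>{..<n} - f ` C. \<bar>?x i - lin d A b' j\<bar> \<le> ?t * ?B" if i: "i \<in> f ` C" for i
  proof -
    obtain j where j: "j \<in> C" "i = f j" using i by auto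
    then have "j \<in> G" using C by auto
    then have jn: "j < n" "\<bar>?x (f j) - ?v j\<bar> \<le> ?t / 2 * ?B" by (auto simp: G_def)
    have "\<bar>?x i - lin d A b' j\<bar> \<le> ?t * ?B"
    proof -
      have "\<bar>?x i - lin d A b' j\<bar> \<le> \<bar>?x (f j) - ?v j\<bar> + \<bar>?v j - lin d A b' j\<bar>"
        using abs_triangle_ineq[of "?x (f j) - ?v j" "?v j - lin d A b' j"] j(2) by simp
      also have "\<dots> \<le> ?t / 2 * ?B + ?t / 2 * ?B"
        by (intro add_mono jn(2) bb' jn(1))
      finally show ?thesis by (simp add: mult_ac)
    qed
    then show ?thesis using j C(2) jn by blast
  qed
  ultimately show False
    using far[OF z(1)] unfolding b'_def \<mu>_def by blast
qed

text \<open>Where \<open>f\<close> fixes a row the vector \<open>u\<close> vanishes, so there the residual \<open>u - X c\<close> is the error \<open>- X c\<close>.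
The fixed rows, at least \<open>3n/4\<close> in number, thus control \<open>X c\<close>, and then \<open>u\<close>.\<close>

lemma displacement_bound:
  assumes n: "n > 0" and ws: "well_spread a n d A"
    and few: "real (card {j\<in>{..<n}. f j \<noteq> j}) \<le> real n / 4"
    and u0: "\<And>j. j < n \<Longrightarrow> f j = j \<Longrightarrow> u j = 0"
  defines "K \<equiv> 32 * real n powr (3 * a / 2)"
  shows "L2_set (lin d A c) {..<n} \<le> K * L2_set (\<lambda>j. u j - lin d A c j) {..<n}"
    and "L2_set u {..<n} \<le> (1 + K) * L2_set (\<lambda>j. u j - lin d A c j) {..<n}"
proof -
  let ?F = "{j\<in>{..<n}. f j = j}" and ?N = "L2_set (\<lambda>j. u j - lin d A c j) {..<n}"
  have "real (3 * n) \<le> real (4 * card ?F)"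
    using few card_moved_add_fixed[of n f] by simp
  then have dom: "L2_set (lin d A c) {..<n} \<le> K * L2_set (lin d A c) ?F"
    unfolding K_def of_nat_le_iff by (intro well_spread_dominated[OF ws _ _ n]) auto
  have "L2_set (lin d A c) ?F = L2_set (\<lambda>j. - (u j - lin d A c j)) ?F"
    using u0 by (intro L2_set_cong) auto
  also have "\<dots> \<le> ?N"
    unfolding L2_set_minus by (rule L2_set_subset) auto
  finally have "K * L2_set (lin d A c) ?F \<le> K * ?N"
    by (intro mult_left_mono) (auto simp: K_def)
  then show 1: "L2_set (lin d A c) {..<n} \<le> K * ?N"
    using dom by linarith
  show "L2_set u {..<n} \<le> (1 + K) * ?N"
    using L2_set_diff_le[of u "{..<n}" "lin d A c"] 1 by (simp add: ring_distribs)
qed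

text \<open>A moved row either has a close neighbour or is displaced by more than \<open>g\<close>; the norm of the displacement
bounds the number of rows of the second kind.\<close>

lemma moved_bound:
  assumes n: "n > 0" and ws: "well_spread a n d A"
    and few: "real (card {j\<in>{..<n}. f j \<noteq> j}) \<le> real n / 4" and f: "f permutes {..<n}"
    and S: "L2_set (\<lambda>j. lin d A \<beta> (f j) - lin d A b j) {..<n} \<le> S"
    and g: "g > 0"
    and close: "real (card {i\<in>{..<n}. \<exists>j\<in>{..<n}. j \<noteq> i \<and> \<bar>lin d A \<beta> i - lin d A \<beta> j\<bar> \<le> g}) \<le> r"
  shows "real (card {j\<in>{..<n}. f j \<noteq> j}) \<le> r + ((1 + 32 * real n powr (3 * a / 2)) * S / g)\<^sup>2"
proof -
  let ?x = "lin d A \<beta>"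
  define u where "u = (\<lambda>j. ?x (f j) - ?x j)"
  define c where "c = (\<lambda>l. b l - \<beta> l)"
  let ?K = "32 * real n powr (3 * a / 2)"
  have "(\<lambda>j. ?x (f j) - lin d A b j) = (\<lambda>j. u j - lin d A c j)"
    by (simp add: u_def c_def lin_diff)
  then have S': "L2_set (\<lambda>j. u j - lin d A c j) {..<n} \<le> S" using S by simp
  have "L2_set u {..<n} \<le> (1 + ?K) * L2_set (\<lambda>j. u j - lin d A c j) {..<n}"
    by (rule displacement_bound(2)[OF n ws few]) (simp add: u_def)
  also have "\<dots> \<le> (1 + ?K) * S"
    using S' by (intro mult_left_mono) auto
  finally have u: "L2_set u {..<n} \<le> (1 + ?K) * S" .
  have "real (card {j\<in>{..<n}. g < \<bar>u j\<bar>}) * g\<^sup>2 \<le> (L2_set u {..<n})\<^sup>2"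
    using g by (intro card_large_le) auto
  also have "\<dots> \<le> ((1 + ?K) * S)\<^sup>2" using u by (intro power_mono) auto
  finally have 1: "real (card {j\<in>{..<n}. g < \<bar>u j\<bar>}) \<le> ((1 + ?K) * S / g)\<^sup>2"
    using g by (simp add: power_divide field_simps)
  have "card {j\<in>{..<n}. f j \<noteq> j} \<le> card ({i\<in>{..<n}. \<exists>j\<in>{..<n}. j \<noteq> i \<and> \<bar>?x i - ?x j\<bar> \<le> g}
     \<union> {j\<in>{..<n}. g < \<bar>u j\<bar>})"
    using permutes_in_image[OF f] abs_minus_commute
    by (intro card_mono) (force simp: u_def)+
  also have "\<dots> \<le> card {i\<in>{..<n}. \<exists>j\<in>{..<n}. j \<noteq> i \<and> \<bar>?x i - ?x j\<bar> \<le> g} + card {j\<in>{..<n}. g < \<bar>u j\<bar>}"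
    by (rule card_Un_le)
  finally show ?thesis using 1 close by linarith
qed

text \<open>Here \<open>X c0\<close> is the projection of the noise to the column space of the design. The norm of the
displacement is at least \<open>sqrt k (g - 2 \<rho>)\<close> if \<open>k\<close> rows move, while the noise, seen through its
orthogonal part on the moved rows only, allows at most a multiple of \<open>sqrt k \<rho>\<close>. The factor \<open>sqrt k\<close>
cancels, so a single condition on \<open>g\<close> and \<open>\<rho>\<close> excludes every \<open>k > 0\<close>.\<close>

lemma none_moved:
  assumes n: "n > 0" and ws: "well_spread a n d A"
    and few: "real (card {j\<in>{..<n}. f j \<noteq> j}) \<le> real n / 4" and f: "f permutes {..<n}"
    and ls: "L2_set (\<lambda>j. lin d A \<beta> (f j) + w (f j) - lin d A b j) {..<n} \<le> L2_set (\<lambda>j. w j - lin d A c0 j) {..<n}"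
    and orth: "\<And>c. (\<Sum>j<n. lin d A c j * (w j - lin d A c0 j)) = 0"
    and w: "\<And>j. j < n \<Longrightarrow> \<bar>w j\<bar> \<le> \<rho>" and p: "\<And>j. j < n \<Longrightarrow> \<bar>lin d A c0 j\<bar> \<le> \<rho>"
    and gap: "\<And>i j. i < n \<Longrightarrow> j < n \<Longrightarrow> i \<noteq> j \<Longrightarrow> g \<le> \<bar>lin d A \<beta> i - lin d A \<beta> j\<bar>"
    and g: "2 * \<rho> + 4 * \<rho> * (1 + 32 * real n powr (3 * a / 2)) * (1 + 3 * (32 * real n powr (3 * a / 2))) < g"
  shows "\<forall>j<n. f j = j"
proof (rule ccontr)
  assume "\<not> ?thesis"
  then obtain j0 where j0: "j0 < n" "f j0 \<noteq> j0" by auto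
  define Mv where "Mv = {j\<in>{..<n}. f j \<noteq> j}"
  define K where "K = 32 * real n powr (3 * a / 2)"
  have K0: "K \<ge> 0" by (simp add: K_def)
  have \<rho>0: "\<rho> \<ge> 0" using w[OF j0(1)] by linarith
  have finM: "finite Mv" by (simp add: Mv_def)
  define k where "k = sqrt (real (card Mv))"
  have "j0 \<in> Mv" using j0 by (simp add: Mv_def)
  then have "card Mv > 0" using finM by (auto simp: card_gt_0_iff)
  then have k0: "k > 0" by (simp add: k_def)
  \<comment> \<open>The fitted part of the noise becomes part of the signal, the orthogonal part \<open>wp\<close> remains as noise.\<close>
  define x where "x = (\<lambda>j. lin d A \<beta> j + lin d A c0 j)"
  define wp where "wp = (\<lambda>j. w j - lin d A c0 j)"
  define u where "u = (\<lambda>j. x (f j) - x j)"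
  define c where "c = (\<lambda>l. b l - (\<beta> l + c0 l))"
  define D where "D = (\<lambda>j. u j - lin d A c j)"
  define N where "N = L2_set D {..<n}"
  have N0: "N \<ge> 0" by (simp add: N_def)
  have u0: "u j = 0" if "j < n" "f j = j" for j using that by (simp add: u_def)
  have dc: "L2_set (lin d A c) {..<n} \<le> K * N" and du: "L2_set u {..<n} \<le> (1 + K) * N"
    using displacement_bound[OF n ws few u0, where c = c] by (auto simp: K_def N_def D_def)
  have wp: "\<bar>wp j\<bar> \<le> 2 * \<rho>" if "j < n" for j
    using w[OF that] p[OF that] by (auto simp: wp_def abs_le_iff)
  have eq: "(\<lambda>j. lin d A \<beta> (f j) + w (f j) - lin d A b j) = (\<lambda>j. D j + wp (f j))"
    by (simp add: D_def u_def c_def x_def wp_def lin_diff lin_add fun_eq_iff)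
  have "(L2_set (\<lambda>j. D j + wp (f j)) {..<n})\<^sup>2 \<le> (L2_set wp {..<n})\<^sup>2"
    using ls unfolding eq wp_def[symmetric] by (intro power_mono) auto
  also have "\<dots> = (L2_set (\<lambda>j. wp (f j)) {..<n})\<^sup>2"
    by (simp add: L2_set_permute[OF f])
  finally have "N\<^sup>2 + 2 * (\<Sum>j<n. D j * wp (f j)) \<le> 0"
    by (simp add: L2_set_power2 N_def power2_sum sum.distrib sum_distrib_left mult_ac)
  \<comment> \<open>Since \<open>X c\<close> is orthogonal to \<open>wp\<close>, it may be paired with \<open>wp \<circ> f - wp\<close>, which vanishes on fixed rows.\<close>
  moreover have "(\<Sum>j<n. D j * wp (f j)) = (\<Sum>j\<in>Mv. u j * wp (f j)) - (\<Sum>j\<in>Mv. lin d A c j * (wp (f j) - wp j))"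
  proof -
    have "(\<Sum>j<n. u j * wp (f j)) = (\<Sum>j\<in>Mv. u j * wp (f j))"
      by (rule sum.mono_neutral_right) (auto simp: Mv_def u0)
    moreover have "(\<Sum>j<n. lin d A c j * wp (f j)) = (\<Sum>j<n. lin d A c j * (wp (f j) - wp j))"
      using orth[of c] by (simp add: wp_def ring_distribs sum_subtractf)
    moreover have "\<dots> = (\<Sum>j\<in>Mv. lin d A c j * (wp (f j) - wp j))"
      by (rule sum.mono_neutral_right) (auto simp: Mv_def)
    ultimately show ?thesis by (simp add: D_def left_diff_distrib sum_subtractf)
  qed
  moreover have "\<bar>\<Sum>j\<in>Mv. u j * wp (f j)\<bar> \<le> (1 + K) * N * (k * (2 * \<rho>))"
  proof -
    have "\<bar>\<Sum>j\<in>Mv. u j * wp (f j)\<bar> \<le> (\<Sum>j\<in>Mv. \<bar>u j\<bar> * \<bar>wp (f j)\<bar>)"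
      unfolding abs_mult[symmetric] by (rule sum_abs)
    also have "\<dots> \<le> L2_set u Mv * L2_set (\<lambda>j. wp (f j)) Mv" by (rule L2_set_mult_ineq)
    also have "\<dots> \<le> L2_set u {..<n} * (k * (2 * \<rho>))"
      unfolding k_def using \<rho>0 wp permutes_in_image[OF f]
      by (intro mult_mono L2_set_subset L2_set_le_card) (auto simp: Mv_def)
    also have "\<dots> \<le> (1 + K) * N * (k * (2 * \<rho>))"
      using du k0 \<rho>0 by (intro mult_right_mono) auto
    finally show ?thesis .
  qed
  moreover have "\<bar>\<Sum>j\<in>Mv. lin d A c j * (wp (f j) - wp j)\<bar> \<le> K * N * (k * (4 * \<rho>))"
  proof -
    have "\<bar>\<Sum>j\<in>Mv. lin d A c j * (wp (f j) - wp j)\<bar> \<le> (\<Sum>j\<in>Mv. \<bar>lin d A c j\<bar> * \<bar>wp (f j) - wp j\<bar>)"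
      unfolding abs_mult[symmetric] by (rule sum_abs)
    also have "\<dots> \<le> L2_set (lin d A c) Mv * L2_set (\<lambda>j. wp (f j) - wp j) Mv" by (rule L2_set_mult_ineq)
    also have "\<dots> \<le> L2_set (lin d A c) {..<n} * (k * (4 * \<rho>))"
    proof -
      have "\<bar>wp (f j) - wp j\<bar> \<le> 4 * \<rho>" if "j \<in> Mv" for j
        using wp[of j] wp[of "f j"] permutes_in_image[OF f, of j] that
        by (auto simp: Mv_def abs_le_iff)
      then show ?thesis
        unfolding k_def using \<rho>0
        by (intro mult_mono L2_set_subset L2_set_le_card) (auto simp: Mv_def)
    qed
    also have "\<dots> \<le> K * N * (k * (4 * \<rho>))"
      using dc k0 \<rho>0 by (intro mult_right_mono) auto
    finally show ?thesis .
  qed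
  moreover have "y \<le> 2 * (P + Q)" if "y + 2 * s \<le> 0" "s = p - q" "\<bar>p\<bar> \<le> P" "\<bar>q\<bar> \<le> Q"
    for y s p q P Q :: real
    using that unfolding abs_le_iff by argo
  ultimately have "N\<^sup>2 \<le> 2 * ((1 + K) * N * (k * (2 * \<rho>)) + K * N * (k * (4 * \<rho>)))"
    by blast
  also have "\<dots> = (4 * \<rho> * (1 + 3 * K) * k) * N" by (simp add: algebra_simps)
  finally have "N \<le> 4 * \<rho> * (1 + 3 * K) * k"
    using N0 \<rho>0 K0 k0 by (cases "N = 0") (auto simp: power2_eq_square)
  then have "(1 + K) * N \<le> (1 + K) * (4 * \<rho> * (1 + 3 * K) * k)"
    using K0 by (intro mult_left_mono) auto
  also have "\<dots> = k * (4 * \<rho> * (1 + K) * (1 + 3 * K))"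
    by (simp only: mult_ac)
  finally have up: "L2_set u {..<n} \<le> k * (4 * \<rho> * (1 + K) * (1 + 3 * K))"
    by (rule order_trans[OF du])
  have "g - 2 * \<rho> \<le> \<bar>u j\<bar>" if "j \<in> Mv" for j
  proof -
    have j: "j < n" "f j < n" "f j \<noteq> j" using that permutes_in_image[OF f, of j] by (auto simp: Mv_def)
    show ?thesis using gap[OF j(2,1,3)] p[OF j(1)] p[OF j(2)] by (auto simp: u_def x_def)
  qed
  moreover have "0 \<le> g - 2 * \<rho>"
  proof -
    have "0 \<le> 4 * \<rho> * (1 + K) * (1 + 3 * K)" using \<rho>0 K0 by simp
    then show ?thesis using g by (simp add: K_def)
  qed
  ultimately have "k * (g - 2 * \<rho>) \<le> L2_set u Mv"
    unfolding k_def using finM by (intro L2_set_ge_card)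
  also have "\<dots> \<le> L2_set u {..<n}" by (rule L2_set_subset) (auto simp: Mv_def)
  also note up
  finally have "g - 2 * \<rho> \<le> 4 * \<rho> * (1 + K) * (1 + 3 * K)" using k0 by simp
  then show False using g by (simp add: K_def)
qed

section \<open>Projections and least squares\<close>

lemma perm_mat_mult_vec:
  assumes p: "p permutes {..<n}" and v: "v \<in> carrier_vec n" and j: "j < n"
    and P: "P = mat n n (\<lambda>(i, j). if i = p j then 1 else 0 :: real)"
  shows "vec_index (P *\<^sub>v v) (p j) = vec_index v j"
proof -
  have pj: "p j < n" using permutes_in_image[OF p, of j] j by simp
  have "vec_index (P *\<^sub>v v) (p j) = (\<Sum>k<n. (if p j = p k then 1 else 0) * vec_index v k)"
    using pj v by (simp add: P scalar_prod_def atLeast0LessThan)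
  also have "\<dots> = (\<Sum>k<n. if k = j then vec_index v k else 0)"
    using permutes_inj[OF p] by (intro sum.cong) (auto dest: injD)
  finally show ?thesis using j by simp
qed

text \<open>The Gram matrix of \<open>P X\<close> is therefore that of \<open>X\<close>, so one inverse serves all permutations.\<close>

lemma perm_mat_orthogonal:
  assumes p: "p permutes {..<n}"
    and P: "P = mat n n (\<lambda>(i, j). if i = p j then 1 else 0 :: real)"
  shows "transpose_mat P * P = 1\<^sub>m n"
proof (rule eq_matI)
  fix i j assume "i < dim_row (1\<^sub>m n :: real mat)" "j < dim_col (1\<^sub>m n :: real mat)"
  then have ij: "i < n" "j < n" by auto
  have "(transpose_mat P * P) $$ (i, j) = (\<Sum>k<n. (if k = p i then 1 else 0) * (if k = p j then 1 else 0))"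
    using ij by (simp add: P scalar_prod_def atLeast0LessThan)
  also have "\<dots> = (\<Sum>k<n. if k = p i then (if p i = p j then 1 else 0) else 0)"
    by (intro sum.cong) auto
  also have "\<dots> = (if p i = p j then 1 else 0)"
    using permutes_in_image[OF p, of i] ij by simp
  also have "\<dots> = 1\<^sub>m n $$ (i, j)"
    using permutes_inj[OF p] ij by (auto dest: injD)
  finally show "(transpose_mat P * P) $$ (i, j) = 1\<^sub>m n $$ (i, j)" .
qed (auto simp: P)

lemma sq_norm_vec_add:
  assumes "u \<in> carrier_vec n" "v \<in> carrier_vec n" "scalar_prod u v = 0"
  shows "sq_norm_vec (u + v) = sq_norm_vec u + sq_norm_vec v"
  using assms comm_scalar_prod[of u n v]
  by (simp add: sq_norm_vec_def scalar_prod_add_distrib[of _ n] add_scalar_prod_distrib[of _ n])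

text \<open>The normal equations make \<open>y - W b\<close> orthogonal to the range of \<open>W = P X\<close>; the identity is then the
theorem of Pythagoras, applied once to \<open>c\<close> and once to the zero vector.\<close>

lemma proj_mat_least_squares:
  assumes X: "X \<in> carrier_mat n d" and inv: "det (transpose_mat X * X) \<noteq> 0"
    and P: "P \<in> perm_mats n" and y: "y \<in> carrier_vec n"
  obtains b where "b \<in> carrier_vec d" "proj_mat P X *\<^sub>v y = (P * X) *\<^sub>v b"
    "\<And>c. c \<in> carrier_vec d \<Longrightarrow> sq_norm_vec (y - (P * X) *\<^sub>v c) =
       sq_norm_vec y - sq_norm_vec (proj_mat P X *\<^sub>v y) + sq_norm_vec ((P * X) *\<^sub>v (b - c))"
proof -
  obtain p where p: "p permutes {..<n}" and Pp: "P = mat n n (\<lambda>(i, j). if i = p j then 1 else 0)"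
    using P by (auto simp: perm_mats_def)
  have Pc: "P \<in> carrier_mat n n" by (simp add: Pp)
  define S where "S = transpose_mat X * X"
  have S: "S \<in> carrier_mat d d" using X by (simp add: S_def)
  obtain G where G: "mat_inverse S = Some G"
    using mat_inverse(1)[OF S] det_non_zero_imp_unit[OF S] inv by (fastforce simp: S_def)
  have SG: "S * G = 1\<^sub>m d" and Gc: "G \<in> carrier_mat d d"
    using mat_inverse(2)[OF S G] by auto
  define W where "W = P * X"
  have W: "W \<in> carrier_mat n d" using Pc X by (simp add: W_def)
  have WT: "transpose_mat W = transpose_mat X * transpose_mat P"
    using Pc X by (simp add: W_def transpose_mult)
  have WW: "transpose_mat W * W = S"
  proof -
    have "transpose_mat W * W = (transpose_mat X * transpose_mat P) * W"
      by (simp only: WT)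
    also have "\<dots> = transpose_mat X * (transpose_mat P * W)"
      using Pc X W by (intro assoc_mult_mat) auto
    also have "transpose_mat P * W = (transpose_mat P * P) * X"
      unfolding W_def using Pc X by (intro assoc_mult_mat[symmetric]) auto
    finally have "transpose_mat W * W = transpose_mat X * ((transpose_mat P * P) * X)" .
    then show ?thesis
      using perm_mat_orthogonal[OF p Pp] X by (simp add: S_def)
  qed
  define b where "b = G *\<^sub>v (transpose_mat W *\<^sub>v y)"
  have b: "b \<in> carrier_vec d" using Gc W y by (simp add: b_def)
  have proj: "proj_mat P X *\<^sub>v y = W *\<^sub>v b"
  proof -
    have "proj_mat P X = (W * G * transpose_mat X) * transpose_mat P"
      by (simp only: proj_mat_def S_def[symmetric] G option.sel W_def)
    also have "\<dots> = (W * G) * transpose_mat W"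
      unfolding WT using W Gc X Pc by (intro assoc_mult_mat) auto
    finally have "proj_mat P X *\<^sub>v y = ((W * G) * transpose_mat W) *\<^sub>v y" by simp
    also have "\<dots> = (W * G) *\<^sub>v (transpose_mat W *\<^sub>v y)"
      using W Gc y by (intro assoc_mult_mat_vec) auto
    also have "\<dots> = W *\<^sub>v b"
      unfolding b_def using W Gc y by (intro assoc_mult_mat_vec) auto
    finally show ?thesis .
  qed
  define r where "r = y - W *\<^sub>v b"
  have r: "r \<in> carrier_vec n" using y W b by (simp add: r_def)
  have "transpose_mat W *\<^sub>v r = transpose_mat W *\<^sub>v y - transpose_mat W *\<^sub>v (W *\<^sub>v b)"
    unfolding r_def using y W b by (intro mult_minus_distrib_mat_vec[of _ d n]) auto
  also have "transpose_mat W *\<^sub>v (W *\<^sub>v b) = S *\<^sub>v b"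
    unfolding WW[symmetric] using W b by (simp add: assoc_mult_mat_vec[of _ d n _ d])
  also have "S *\<^sub>v b = transpose_mat W *\<^sub>v y"
    unfolding b_def using S Gc W y SG by (simp add: assoc_mult_mat_vec[of S d d G d, symmetric])
  finally have Wr: "transpose_mat W *\<^sub>v r = 0\<^sub>v d"
    using W y by simp
  have orth: "scalar_prod r (W *\<^sub>v e) = 0" if e: "e \<in> carrier_vec d" for e
    using transpose_vec_mult_scalar[OF W e r] Wr e by simp
  have dec: "sq_norm_vec (y - W *\<^sub>v c) = sq_norm_vec r + sq_norm_vec (W *\<^sub>v (b - c))"
    if c: "c \<in> carrier_vec d" for c
  proof -
    have "y - W *\<^sub>v c = r + W *\<^sub>v (b - c)"
      using y W b c by (intro eq_vecI) (auto simp: r_def mult_minus_distrib_mat_vec[of _ n d])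
    then show ?thesis
      using r W b c orth[of "b - c"] by (simp add: sq_norm_vec_add[of _ n])
  qed
  have "y - W *\<^sub>v 0\<^sub>v d = y" "b - 0\<^sub>v d = b" using y W b by auto
  then have "sq_norm_vec y = sq_norm_vec r + sq_norm_vec (W *\<^sub>v b)"
    using dec[of "0\<^sub>v d"] by simp
  then show ?thesis
    using that[of b] b proj dec by (simp add: W_def)
qed

lemma sq_norm_vec_nonneg: "0 \<le> sq_norm_vec v"
  by (auto simp: sq_norm_vec_def scalar_prod_def intro!: sum_nonneg)

lemma sq_norm_vec_zero: "sq_norm_vec (0\<^sub>v n) = 0"
  by (simp add: sq_norm_vec_def)

text \<open>The longest projection leaves the smallest residual, so a maximiser is optimal jointly in the permutation
and in the coefficients.\<close>

lemma arg_max_least_squares: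
  assumes X: "X \<in> carrier_mat n d" and inv: "det (transpose_mat X * X) \<noteq> 0"
    and y: "y \<in> carrier_vec n"
    and max: "is_arg_max (\<lambda>P. sq_norm_vec (proj_mat P X *\<^sub>v y)) (\<lambda>P. P \<in> perm_mats n) Q"
  obtains b where "Q \<in> perm_mats n" "b \<in> carrier_vec d"
    "\<And>P c. P \<in> perm_mats n \<Longrightarrow> c \<in> carrier_vec d \<Longrightarrow>
       sq_norm_vec (y - (Q * X) *\<^sub>v b) \<le> sq_norm_vec (y - (P * X) *\<^sub>v c)"
proof -
  have Q: "Q \<in> perm_mats n"
    and le: "\<And>P. P \<in> perm_mats n \<Longrightarrow> sq_norm_vec (proj_mat P X *\<^sub>v y) \<le> sq_norm_vec (proj_mat Q X *\<^sub>v y)"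
    using max by (auto simp: is_arg_max_def not_less)
  obtain b where b: "b \<in> carrier_vec d"
    "\<And>c. c \<in> carrier_vec d \<Longrightarrow> sq_norm_vec (y - (Q * X) *\<^sub>v c) =
       sq_norm_vec y - sq_norm_vec (proj_mat Q X *\<^sub>v y) + sq_norm_vec ((Q * X) *\<^sub>v (b - c))"
    using proj_mat_least_squares[OF X inv Q y] by metis
  have "W *\<^sub>v (b - b) = 0\<^sub>v n" if "W \<in> carrier_mat n d" for W
    using that b(1) by (intro eq_vecI) auto
  moreover have "Q * X \<in> carrier_mat n d" using Q X by (auto simp: perm_mats_def)
  ultimately have "(Q * X) *\<^sub>v (b - b) = 0\<^sub>v n" by blast
  then have bq: "sq_norm_vec (y - (Q * X) *\<^sub>v b) = sq_norm_vec y - sq_norm_vec (proj_mat Q X *\<^sub>v y)"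
    using b by (simp add: sq_norm_vec_zero)
  have "sq_norm_vec (y - (Q * X) *\<^sub>v b) \<le> sq_norm_vec (y - (P * X) *\<^sub>v c)"
    if P: "P \<in> perm_mats n" and c: "c \<in> carrier_vec d" for P c
  proof -
    obtain b' where b': "\<And>c. c \<in> carrier_vec d \<Longrightarrow> sq_norm_vec (y - (P * X) *\<^sub>v c) =
       sq_norm_vec y - sq_norm_vec (proj_mat P X *\<^sub>v y) + sq_norm_vec ((P * X) *\<^sub>v (b' - c))"
      using proj_mat_least_squares[OF X inv P y] by metis
    show ?thesis
      using b'[OF c] bq le[OF P] sq_norm_vec_nonneg[of "(P * X) *\<^sub>v (b' - c)"] by linarith
  qed
  then show ?thesis using that Q b(1) by blast
qed

lemma mult_mat_vec_lin:
  assumes "X \<in> carrier_mat n d" "c \<in> carrier_vec d" "j < n"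
  shows "vec_index (X *\<^sub>v c) j = lin d (\<lambda>k. X $$ k) (vec_index c) j"
  using assms by (simp add: scalar_prod_def lin_def atLeast0LessThan)

lemma sq_norm_vec_sum: "r \<in> carrier_vec n \<Longrightarrow> sq_norm_vec r = (\<Sum>i<n. (vec_index r i)\<^sup>2)"
  by (auto simp: sq_norm_vec_def scalar_prod_def atLeast0LessThan power2_eq_square)

text \<open>Reading the residual in the order \<open>p\<close> moves the permutation from the design to the observation.\<close>

lemma sq_norm_vec_permuted:
  assumes X: "X \<in> carrier_mat n d" and c: "c \<in> carrier_vec d" and y: "y \<in> carrier_vec n"
    and p: "p permutes {..<n}" and P: "P = mat n n (\<lambda>(i, j). if i = p j then 1 else 0)"
  shows "sq_norm_vec (y - (P * X) *\<^sub>v c) =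
    (L2_set (\<lambda>j. vec_index y (p j) - lin d (\<lambda>k. X $$ k) (vec_index c) j) {..<n})\<^sup>2"
proof -
  have Pc: "P \<in> carrier_mat n n" by (simp add: P)
  let ?r = "y - (P * X) *\<^sub>v c"
  have r: "?r \<in> carrier_vec n" using Pc X y c by simp
  have "sq_norm_vec ?r = (\<Sum>i<n. (vec_index ?r i)\<^sup>2)"
    using r by (rule sq_norm_vec_sum)
  also have "\<dots> = (\<Sum>j<n. (vec_index ?r (p j))\<^sup>2)"
    by (subst sum.permute[OF p]) (simp add: o_def)
  also have "\<dots> = (\<Sum>j<n. (vec_index y (p j) - lin d (\<lambda>k. X $$ k) (vec_index c) j)\<^sup>2)"
  proof (intro sum.cong refl)
    fix j assume "j \<in> {..<n}"
    then have j: "j < n" "p j < n" using permutes_in_image[OF p, of j] by auto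
    have "vec_index ((P * X) *\<^sub>v c) (p j) = vec_index (P *\<^sub>v (X *\<^sub>v c)) (p j)"
      using Pc X c by (simp add: assoc_mult_mat_vec[of _ n n _ d])
    also have "\<dots> = vec_index (X *\<^sub>v c) j"
      using X c by (intro perm_mat_mult_vec[OF p _ j(1) P]) auto
    finally have "vec_index ((P * X) *\<^sub>v c) (p j) = lin d (\<lambda>k. X $$ k) (vec_index c) j"
      using mult_mat_vec_lin[OF X c j(1)] by simp
    then show "(vec_index ?r (p j))\<^sup>2 = (vec_index y (p j) - lin d (\<lambda>k. X $$ k) (vec_index c) j)\<^sup>2"
      using j y Pc X c by simp
  qed
  finally show ?thesis by (simp add: L2_set_power2)
qed

lemma overlap_perm_mats:
  assumes p: "p permutes {..<n}" and P: "P = mat n n (\<lambda>(i, j). if i = p j then 1 else 0)"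
    and q: "q permutes {..<n}" and Q: "Q = mat n n (\<lambda>(i, j). if i = q j then 1 else 0)"
  shows "overlap n Q P = real (card {j\<in>{..<n}. q j = p j}) / real n"
proof -
  have "mat_trace (transpose_mat Q * P) = (\<Sum>j<n. \<Sum>i<n. (if i = q j then 1 else 0) * (if i = p j then 1 else 0))"
    unfolding mat_trace_def by (intro sum.cong) (auto simp: P Q scalar_prod_def atLeast0LessThan)
  also have "\<dots> = (\<Sum>j<n. \<Sum>i<n. if i = q j then (if q j = p j then 1 else 0) else 0)"
    by (intro sum.cong refl) auto
  also have "\<dots> = (\<Sum>j<n. if q j = p j then 1 else 0)"
    using permutes_in_image[OF q] by (intro sum.cong refl) simp
  also have "\<dots> = real (card {j\<in>{..<n}. q j = p j})"
    by (simp add: sum.If_cases Int_def)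
  finally show ?thesis by (simp add: overlap_def)
qed

text \<open>If \<open>p\<close> is the true and \<open>q\<close> the estimated permutation, then \<open>f = inv p \<circ> q\<close> moves exactly the rows
on which they differ. The fit is compared only with fits that use the true permutation.\<close>

lemma estimator_least_squares:
  assumes X: "X \<in> carrier_mat n d" and inv: "det (transpose_mat X * X) \<noteq> 0"
    and p: "p permutes {..<n}" and P: "P = mat n n (\<lambda>(i, j). if i = p j then 1 else 0)"
    and \<beta>: "\<beta> \<in> carrier_vec d" and w: "w \<in> carrier_vec n" and n: "n > 0"
    and max: "is_arg_max (\<lambda>R. sq_norm_vec (proj_mat R X *\<^sub>v observation P \<beta> X w)) (\<lambda>R. R \<in> perm_mats n) Q"
  defines "A \<equiv> \<lambda>k. X $$ k"
  obtains f b where "f permutes {..<n}"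
    "\<And>c. L2_set (\<lambda>j. lin d A (vec_index \<beta>) (f j) + vec_index w (p (f j)) - lin d A b j) {..<n} \<le>
      L2_set (\<lambda>j. lin d A (vec_index \<beta>) j + vec_index w (p j) - lin d A c j) {..<n}"
    "(\<forall>j<n. f j = j) \<Longrightarrow> Q = P"
    "overlap n Q P = 1 - real (card {j\<in>{..<n}. f j \<noteq> j}) / real n"
proof -
  let ?y = "observation P \<beta> X w"
  have Pc: "P \<in> carrier_mat n n" by (simp add: P)
  have y: "?y \<in> carrier_vec n" using Pc X \<beta> w by (simp add: observation_def)
  have Pp: "P \<in> perm_mats n" using p P by (auto simp: perm_mats_def)
  obtain b where Qp: "Q \<in> perm_mats n" and b: "b \<in> carrier_vec d"
    and le: "\<And>P c. P \<in> perm_mats n \<Longrightarrow> c \<in> carrier_vec d \<Longrightarrow>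
       sq_norm_vec (?y - (Q * X) *\<^sub>v b) \<le> sq_norm_vec (?y - (P * X) *\<^sub>v c)"
    using arg_max_least_squares[OF X inv y max] by metis
  obtain q where q: "q permutes {..<n}" and Q: "Q = mat n n (\<lambda>(i, j). if i = q j then 1 else 0)"
    using Qp by (auto simp: perm_mats_def)
  define f where "f = Hilbert_Choice.inv p \<circ> q"
  have f: "f permutes {..<n}"
    unfolding f_def using permutes_compose[OF q permutes_inv[OF p]] .
  have pf: "p (f j) = q j" for j
    using permutes_inverses(1)[OF p] by (simp add: f_def)
  have ypj: "vec_index ?y (p j) = lin d A (vec_index \<beta>) j + vec_index w (p j)" if j: "j < n" for j
  proof -
    have "p j < n" using permutes_in_image[OF p, of j] j by simp
    have "vec_index ((P * X) *\<^sub>v \<beta>) (p j) = vec_index (P *\<^sub>v (X *\<^sub>v \<beta>)) (p j)"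
      using Pc X \<beta> by (simp add: assoc_mult_mat_vec[of _ n n _ d])
    also have "\<dots> = vec_index (X *\<^sub>v \<beta>) j"
      using X \<beta> by (intro perm_mat_mult_vec[OF p _ j P]) auto
    finally show ?thesis
      using mult_mat_vec_lin[OF X \<beta> j] \<open>p j < n\<close> w by (simp add: observation_def A_def)
  qed
  have 1: "L2_set (\<lambda>j. lin d A (vec_index \<beta>) (f j) + vec_index w (p (f j)) - lin d A (vec_index b) j) {..<n} \<le>
      L2_set (\<lambda>j. lin d A (vec_index \<beta>) j + vec_index w (p j) - lin d A c j) {..<n}" for c
  proof -
    have "(L2_set (\<lambda>j. lin d A (vec_index \<beta>) (f j) + vec_index w (p (f j)) - lin d A (vec_index b) j) {..<n})\<^sup>2
      = (L2_set (\<lambda>j. vec_index ?y (q j) - lin d A (vec_index b) j) {..<n})\<^sup>2"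
      unfolding L2_set_power2 using permutes_in_image[OF f] by (intro sum.cong refl) (simp add: ypj pf[symmetric])
    also have "\<dots> = sq_norm_vec (?y - (Q * X) *\<^sub>v b)"
      unfolding A_def by (rule sq_norm_vec_permuted[OF X b y q Q, symmetric])
    also have "\<dots> \<le> sq_norm_vec (?y - (P * X) *\<^sub>v Matrix.vec d c)"
      using Pp by (intro le) auto
    also have "\<dots> = (L2_set (\<lambda>j. vec_index ?y (p j) - lin d A (vec_index (Matrix.vec d c)) j) {..<n})\<^sup>2"
      unfolding A_def by (rule sq_norm_vec_permuted[OF X _ y p P]) simp
    also have "\<dots> = (L2_set (\<lambda>j. lin d A (vec_index \<beta>) j + vec_index w (p j) - lin d A c j) {..<n})\<^sup>2"
      unfolding L2_set_power2 by (intro sum.cong refl) (simp add: ypj lin_def)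
    finally show ?thesis by (rule power2_le_imp_le) simp
  qed
  have 2: "Q = P" if "\<forall>j<n. f j = j"
  proof -
    have "q j = p j" if "j < n" for j
      using \<open>\<forall>j<n. f j = j\<close> that pf[of j] by metis
    then show ?thesis
      unfolding P Q by (intro eq_matI) simp_all
  qed
  have "{j\<in>{..<n}. q j = p j} = {j\<in>{..<n}. f j = j}"
    using pf permutes_inj[OF p] by (metis (no_types, opaque_lifting) injD)
  then have 3: "overlap n Q P = 1 - real (card {j\<in>{..<n}. f j \<noteq> j}) / real n"
    using overlap_perm_mats[OF p P q Q] card_moved_add_fixed[of n f] n
    by (simp add: field_simps)
  show ?thesis using that[OF f 1 2 3] .
qed

section \<open>The hat matrix\<close>

definition gram :: "nat \<Rightarrow> nat \<Rightarrow> (nat \<times> nat \<Rightarrow> real) \<Rightarrow> real mat" where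
  "gram n d A = mat d d (\<lambda>(k, l). \<Sum>i<n. A (i, k) * A (i, l))"

lemma gram_carrier[simp]: "gram n d A \<in> carrier_mat d d"
  by (simp add: gram_def)

lemma gram_mat: "X \<in> carrier_mat n d \<Longrightarrow> gram n d (\<lambda>k. X $$ k) = transpose_mat X * X"
  by (intro eq_matI) (auto simp: gram_def scalar_prod_def atLeast0LessThan)

lemma gram_inner:
  "(\<Sum>i<n. A (i, k) * lin d A c i) = (\<Sum>l<d. (\<Sum>i<n. A (i, k) * A (i, l)) * c l)"
proof -
  have "(\<Sum>i<n. A (i, k) * lin d A c i) = (\<Sum>i<n. \<Sum>l<d. A (i, k) * A (i, l) * c l)"
    by (simp add: lin_def sum_distrib_left mult.assoc)
  also have "\<dots> = (\<Sum>l<d. \<Sum>i<n. A (i, k) * A (i, l) * c l)" by (rule sum.swap)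
  finally show ?thesis by (simp add: sum_distrib_right)
qed

lemma lin_inner: "(\<Sum>i<n. lin d A c i * g i) = (\<Sum>k<d. c k * (\<Sum>i<n. A (i, k) * g i))"
proof -
  have "(\<Sum>i<n. lin d A c i * g i) = (\<Sum>i<n. \<Sum>k<d. c k * (A (i, k) * g i))"
    by (simp add: lin_def sum_distrib_right sum_distrib_left mult_ac)
  also have "\<dots> = (\<Sum>k<d. \<Sum>i<n. c k * (A (i, k) * g i))" by (rule sum.swap)
  finally show ?thesis by (simp add: sum_distrib_left)
qed

text \<open>A kernel vector of the Gram matrix would have image 0 under the design.\<close>

lemma det_gram_nonzero:
  assumes ws: "well_spread a n d A" and n: "n > 0"
  shows "det (gram n d A) \<noteq> 0"
proof
  assume "det (gram n d A) = 0"
  then obtain v where v: "v \<in> carrier_vec d" "v \<noteq> 0\<^sub>v d" "gram n d A *\<^sub>v v = 0\<^sub>v d"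
    using det_0_iff_vec_prod_zero[OF gram_carrier[of n d A]] by auto
  let ?c = "vec_index v"
  have z: "(\<Sum>i<n. A (i, k) * lin d A ?c i) = 0" if "k < d" for k
  proof -
    have "(\<Sum>i<n. A (i, k) * lin d A ?c i) = vec_index (gram n d A *\<^sub>v v) k"
      using that v(1) by (simp add: gram_inner gram_def scalar_prod_def atLeast0LessThan)
    then show ?thesis using v(3) that by simp
  qed
  have "(\<Sum>i<n. lin d A ?c i * lin d A ?c i) = 0"
    using z by (simp add: lin_inner)
  then have "L2_set (lin d A ?c) {..<n} = 0"
    by (simp add: L2_set_def power2_eq_square)
  then have "sqrt (real n) / 8 * real n powr (- a) * L2_set ?c {..<d} \<le> 0"
    using well_spread_lower[OF ws, of "{..<n}" ?c] by simp
  then have "L2_set ?c {..<d} \<le> 0"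
    using n by (simp add: mult_le_0_iff)
  then have "L2_set ?c {..<d} = 0" using L2_set_nonneg[of ?c "{..<d}"] by linarith
  then have "v = 0\<^sub>v d" using v(1) by (intro eq_vecI) (auto simp: L2_set_eq_0_iff)
  then show False using v(2) by simp
qed

text \<open>The entries of \<open>A (A\<^sup>T A)\<^sup>-\<^sup>1 A\<^sup>T\<close>, the orthogonal projection to the column space. Cramer's rule
makes them measurable functions of the design. If the Gram matrix is singular, division by 0 makes them
0.\<close>

definition hat :: "nat \<Rightarrow> nat \<Rightarrow> (nat \<times> nat \<Rightarrow> real) \<Rightarrow> nat \<Rightarrow> nat \<Rightarrow> real" where
  "hat n d A j i = lin d A (\<lambda>k. (\<Sum>l<d. adj_mat (gram n d A) $$ (k, l) * A (i, l)) / det (gram n d A)) j"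

text \<open>The normal equations, solved with the adjugate of the Gram matrix.\<close>

lemma hat_projection:
  fixes w :: "nat \<Rightarrow> real"
  assumes "det (gram n d A) \<noteq> 0"
  obtains c0 where "\<And>j. (\<Sum>i<n. hat n d A j i * w i) = lin d A c0 j"
    "\<And>c. (\<Sum>j<n. lin d A c j * (w j - lin d A c0 j)) = 0"
proof -
  let ?S = "gram n d A" and ?D = "det (gram n d A)"
  define t where "t = (\<lambda>l. \<Sum>i<n. A (i, l) * w i)"
  define c0 where "c0 = (\<lambda>k. (\<Sum>l<d. adj_mat ?S $$ (k, l) * t l) / ?D)"
  have "(\<Sum>i<n. hat n d A j i * w i) = lin d A c0 j" for j
  proof -
    define g where "g = (\<lambda>i k. (\<Sum>l<d. adj_mat ?S $$ (k, l) * A (i, l)) / ?D)"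
    have "(\<Sum>i<n. hat n d A j i * w i) = (\<Sum>i<n. \<Sum>k<d. A (j, k) * (g i k * w i))"
      by (simp add: hat_def lin_def g_def sum_distrib_right mult.assoc)
    also have "\<dots> = (\<Sum>k<d. \<Sum>i<n. A (j, k) * (g i k * w i))" by (rule sum.swap)
    finally have "(\<Sum>i<n. hat n d A j i * w i) =
        (\<Sum>k<d. A (j, k) * (\<Sum>i<n. (\<Sum>l<d. adj_mat ?S $$ (k, l) * A (i, l)) / ?D * w i))"
      by (simp add: g_def sum_distrib_left)
    moreover have "(\<Sum>i<n. (\<Sum>l<d. adj_mat ?S $$ (k, l) * A (i, l)) / ?D * w i) = c0 k" for k
    proof -
      have "(\<Sum>i<n. (\<Sum>l<d. adj_mat ?S $$ (k, l) * A (i, l)) / ?D * w i) =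
         (\<Sum>i<n. \<Sum>l<d. adj_mat ?S $$ (k, l) * A (i, l) * w i) / ?D"
        by (simp add: sum_divide_distrib sum_distrib_right)
      also have "(\<Sum>i<n. \<Sum>l<d. adj_mat ?S $$ (k, l) * A (i, l) * w i) =
         (\<Sum>l<d. \<Sum>i<n. adj_mat ?S $$ (k, l) * A (i, l) * w i)" by (rule sum.swap)
      finally show ?thesis by (simp add: c0_def t_def sum_distrib_left mult.assoc)
    qed
    ultimately show ?thesis by (simp add: lin_def)
  qed
  moreover have "(\<Sum>j<n. lin d A c j * (w j - lin d A c0 j)) = 0" for c
  proof -
    have "(\<Sum>i<n. A (i, k) * (w i - lin d A c0 i)) = 0" if k: "k < d" for k
    proof -
      have "(\<Sum>i<n. A (i, k) * lin d A c0 i) = (\<Sum>m<d. ?S $$ (k, m) * c0 m)"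
        using k by (simp add: gram_inner gram_def)
      also have "\<dots> = (\<Sum>m<d. \<Sum>l<d. ?S $$ (k, m) * (adj_mat ?S $$ (m, l) * t l)) / ?D"
        by (simp add: c0_def sum_divide_distrib sum_distrib_left)
      also have "(\<Sum>m<d. \<Sum>l<d. ?S $$ (k, m) * (adj_mat ?S $$ (m, l) * t l)) =
         (\<Sum>l<d. (\<Sum>m<d. ?S $$ (k, m) * adj_mat ?S $$ (m, l)) * t l)"
        by (subst sum.swap) (simp add: sum_distrib_right mult.assoc)
      also have "\<dots> = (\<Sum>l<d. (if l = k then ?D else 0) * t l)"
      proof (intro sum.cong refl arg_cong2[where f = "(*)"])
        fix l assume l: "l \<in> {..<d}"
        have "(\<Sum>m<d. ?S $$ (k, m) * adj_mat ?S $$ (m, l)) = (?S * adj_mat ?S) $$ (k, l)"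
        proof -
          have "(\<Sum>m<d. S $$ (k, m) * T $$ (m, l)) = (S * T) $$ (k, l)"
            if "S \<in> carrier_mat d d" "T \<in> carrier_mat d d" for S T :: "real mat"
            using that k l by (simp add: scalar_prod_def atLeast0LessThan)
          then show ?thesis using adj_mat(1)[OF gram_carrier[of n d A]] gram_carrier by blast
        qed
        then show "(\<Sum>m<d. ?S $$ (k, m) * adj_mat ?S $$ (m, l)) = (if l = k then ?D else 0)"
          using k l by (simp add: adj_mat(2)[OF gram_carrier])
      qed
      also have "\<dots> / ?D = t k"
        using k assms by (simp add: if_distrib[of "\<lambda>x. x * _"] cong: if_cong)
      finally show ?thesis
        by (simp add: right_diff_distrib sum_subtractf t_def)
    qed
    then show ?thesis by (simp add: lin_inner)
  qed
  ultimately show ?thesis using that by blast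
qed

text \<open>If \<open>h\<close> is row \<open>j\<close> of the projection \<open>H\<close>, then \<open>\<parallel>h\<parallel>\<^sup>2 = (H h) j \<le> \<parallel>H h\<parallel> \<le> \<parallel>h\<parallel>\<close>.\<close>

lemma hat_row_norm: 
  assumes j: "j < n"
  shows "L2_set (hat n d A j) {..<n} \<le> 1"
proof (cases "det (gram n d A) = 0")
  case True
  then have "hat n d A j i = 0" for i by (simp add: hat_def lin_def)
  then have "L2_set (hat n d A j) {..<n} = 0" by (simp add: L2_set_eq_0_iff)
  then show ?thesis by simp
next
  case False
  let ?w = "hat n d A j" and ?N = "L2_set (hat n d A j) {..<n}"
  obtain c0 where c0: "\<And>j'. (\<Sum>i<n. hat n d A j' i * ?w i) = lin d A c0 j'"
    and orth: "\<And>c. (\<Sum>j'<n. lin d A c j' * (?w j' - lin d A c0 j')) = 0"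
    using hat_projection[OF False, of ?w] by metis
  let ?p = "lin d A c0"
  have "(L2_set ?p {..<n})\<^sup>2 = (\<Sum>j'<n. ?p j' * ?w j')"
    unfolding L2_set_power2 using orth[of c0] by (simp add: right_diff_distrib sum_subtractf power2_eq_square)
  also have "\<dots> \<le> (\<Sum>j'<n. \<bar>?p j'\<bar> * \<bar>?w j'\<bar>)"
    unfolding abs_mult[symmetric] by (intro sum_mono) auto
  also have "\<dots> \<le> L2_set ?p {..<n} * ?N" by (rule L2_set_mult_ineq)
  finally have "L2_set ?p {..<n} \<le> ?N"
    using L2_set_nonneg[of ?p "{..<n}"] by (cases "L2_set ?p {..<n} = 0") (auto simp: power2_eq_square)
  moreover have "?N\<^sup>2 = ?p j"
    unfolding L2_set_power2 using c0[of j] by (simp add: power2_eq_square)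
  moreover have "?p j \<le> L2_set ?p {..<n}"
    using member_le_L2_set[of "{..<n}" j "\<lambda>j. \<bar>?p j\<bar>"] j by (simp add: L2_set_def)
  ultimately have "?N * ?N \<le> ?N * 1" by (simp add: power2_eq_square)
  then show ?thesis
    using L2_set_nonneg[of ?w "{..<n}"] by (cases "?N = 0") auto
qed

lemma det_measurable:
  assumes F: "\<And>x. F x \<in> carrier_mat m m"
    and meas: "\<And>i j. i < m \<Longrightarrow> j < m \<Longrightarrow> (\<lambda>x. F x $$ (i, j)) \<in> borel_measurable N"
  shows "(\<lambda>x. det (F x) :: real) \<in> borel_measurable N"
proof -
  have "(\<lambda>x. det (F x)) = (\<lambda>x. \<Sum>p\<in>{p. p permutes {0..<m}}. signof p * (\<Prod>i = 0..<m. F x $$ (i, p i)))"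
    using det_def'[OF F] by auto
  also have "\<dots> \<in> borel_measurable N"
  proof (intro borel_measurable_sum borel_measurable_times borel_measurable_const borel_measurable_prod)
    fix p i assume "p \<in> {p. p permutes {0..<m}}" "i \<in> {0..<m}"
    then show "(\<lambda>x. F x $$ (i, p i)) \<in> borel_measurable N"
      using permutes_in_image[of p "{0..<m}" i] by (intro meas) auto
  qed
  finally show ?thesis .
qed

lemma hat_cong:
  assumes "\<And>i k. i < n \<Longrightarrow> k < d \<Longrightarrow> A (i, k) = B (i, k)" "i < n" "j < n"
  shows "hat n d A j i = hat n d B j i"
proof -
  have "gram n d A = gram n d B" using assms(1) by (intro eq_matI) (auto simp: gram_def)
  then show ?thesis using assms by (auto simp: hat_def lin_def intro!: sum.cong)
qed

lemma hat_measurable: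
  assumes "j < n" "i < n"
  shows "(\<lambda>A. hat n d A j i) \<in> borel_measurable (Pi\<^sub>M ({..<n} \<times> {..<d}) (\<lambda>_. borel))"
proof -
  let ?N = "Pi\<^sub>M ({..<n} \<times> {..<d}) (\<lambda>_. borel :: real measure)"
  have e: "(\<lambda>A. A (i, k)) \<in> borel_measurable ?N" if "i < n" "k < d" for i k
    using that by (intro measurable_component_singleton) auto
  have g: "(\<lambda>A. gram n d A $$ (k, l)) \<in> borel_measurable ?N" if "k < d" "l < d" for k l
    using that by (simp add: gram_def e)
  have c: "(\<lambda>A. adj_mat (gram n d A) $$ (k, l)) \<in> borel_measurable ?N" if kl: "k < d" "l < d" for k l
  proof -
    have "(\<lambda>A. adj_mat (gram n d A) $$ (k, l)) = (\<lambda>A. (-1) ^ (l + k) * det (mat_delete (gram n d A) l k))"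
      using kl by (simp add: adj_mat_def cofactor_def gram_def)
    also have "\<dots> \<in> borel_measurable ?N"
    proof (intro borel_measurable_times borel_measurable_const det_measurable)
      show "mat_delete (gram n d A) l k \<in> carrier_mat (d - 1) (d - 1)" for A
        by (rule mat_delete_carrier) simp
      fix a b assume ab: "a < d - 1" "b < d - 1"
      have "(\<lambda>A. mat_delete (gram n d A) l k $$ (a, b)) =
        (\<lambda>A. gram n d A $$ (if a < l then a else Suc a, if b < k then b else Suc b))"
        using ab by (simp add: mat_delete_def gram_def)
      then show "(\<lambda>A. mat_delete (gram n d A) l k $$ (a, b)) \<in> borel_measurable ?N"
        using ab by (simp add: g)
    qed
    finally show ?thesis .
  qed
  show ?thesis
    unfolding hat_def lin_def using assms
    by (intro borel_measurable_sum borel_measurable_times borel_measurable_divide e c det_measurable[of _ d] g) auto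
qed

section \<open>Exceptional events\<close>

context prob_space begin

text \<open>Measurability is part of the notion because \<open>measure\<close> is 0 on sets that are not measurable.\<close>

definition rare :: "'a set \<Rightarrow> real \<Rightarrow> bool" where
  "rare S q \<longleftrightarrow> S \<in> events \<and> prob S \<le> q"

lemma rare_Un: "rare S q \<Longrightarrow> rare T r \<Longrightarrow> rare (S \<union> T) (q + r)"
  unfolding rare_def using measure_Un_le[of S M T] by auto

lemma rare_mono: "rare S q \<Longrightarrow> q \<le> r \<Longrightarrow> rare S r"
  by (auto simp: rare_def)

lemma rare_UN:
  assumes "finite F" "\<And>z. z \<in> F \<Longrightarrow> rare (S z) q"
  shows "rare (\<Union>z\<in>F. S z) (real (card F) * q)"
proof -
  have "prob (\<Union>z\<in>F. S z) \<le> (\<Sum>z\<in>F. prob (S z))"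
    using assms by (intro finite_measure_subadditive_finite) (auto simp: rare_def)
  also have "\<dots> \<le> (\<Sum>z\<in>F. q)"
    using assms by (intro sum_mono) (auto simp: rare_def)
  finally show ?thesis using assms by (auto simp: rare_def)
qed

lemma rare_UN_le:
  assumes "finite F" "real (card F) \<le> m" "0 \<le> q" "\<And>z. z \<in> F \<Longrightarrow> rare (S z) q"
  shows "rare (\<Union>z\<in>F. S z) (m * q)"
proof (rule rare_mono)
  show "rare (\<Union>z\<in>F. S z) (real (card F) * q)" by (rule rare_UN[OF assms(1,4)])
  show "real (card F) * q \<le> m * q" by (rule mult_right_mono[OF assms(2,3)])
qed

text \<open>Markov's inequality for the number of the events \<open>S i\<close> that occur.\<close>

lemma rare_count:
  assumes fin: "finite F" and r: "\<And>i. i \<in> F \<Longrightarrow> rare (S i) q" and m: "m > 0"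
  shows "rare {\<omega>\<in>space M. m \<le> real (card {i\<in>F. \<omega> \<in> S i})} (real (card F) * q / m)"
proof -
  have meas: "S i \<in> events" if "i \<in> F" for i using r[OF that] by (simp add: rare_def)
  have c: "real (card {i\<in>F. \<omega> \<in> S i}) = (\<Sum>i\<in>F. indicator (S i) \<omega>)" for \<omega>
    using fin by (simp add: indicator_def sum.If_cases Int_def)
  have cm[measurable]: "(\<lambda>\<omega>. real (card {i\<in>F. \<omega> \<in> S i})) \<in> borel_measurable M"
    unfolding c using meas by (intro borel_measurable_sum borel_measurable_indicator) auto
  have T: "{\<omega>\<in>space M. m \<le> real (card {i\<in>F. \<omega> \<in> S i})} \<in> events" (is "?T \<in> _") by measurable
  have "emeasure M ?T \<le> emeasure M {\<omega>\<in>space M. 1 \<le> ennreal (1 / m) * ennreal (real (card {i\<in>F. \<omega> \<in> S i}))}"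
    using m by (intro emeasure_mono) (auto simp: ennreal_mult[symmetric] field_simps)
  also have "\<dots> \<le> ennreal (1 / m) * (\<integral>\<^sup>+\<omega>. ennreal (real (card {i\<in>F. \<omega> \<in> S i})) * indicator (space M) \<omega> \<partial>M)"
    by (rule nn_integral_Markov_inequality) auto
  also have "(\<integral>\<^sup>+\<omega>. ennreal (real (card {i\<in>F. \<omega> \<in> S i})) * indicator (space M) \<omega> \<partial>M)
      = (\<integral>\<^sup>+\<omega>. (\<Sum>i\<in>F. indicator (S i) \<omega>) \<partial>M)"
    unfolding c by (intro nn_integral_cong) (auto simp: sum_ennreal[symmetric] ennreal_indicator)
  also have "\<dots> = (\<Sum>i\<in>F. emeasure M (S i))"
    using meas by (subst nn_integral_sum) auto
  also have "\<dots> \<le> (\<Sum>i\<in>F. ennreal q)"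
    using r by (intro sum_mono) (auto simp: rare_def emeasure_eq_measure intro!: ennreal_leI)
  also have "\<dots> = ennreal (real (card F) * q)"
    by (simp add: ennreal_mult' ennreal_of_nat_eq_real_of_nat)
  finally have le: "emeasure M ?T \<le> ennreal (1 / m) * ennreal (real (card F) * q)"
    by (simp add: mult_left_mono)
  show ?thesis
  proof (cases "F = {}")
    case True
    then show ?thesis using m by (simp add: rare_def)
  next
    case False
    then obtain i where "i \<in> F" by auto
    then have "0 \<le> q" using r[of i] order_trans[OF measure_nonneg[of M "S i"]] by (auto simp: rare_def)
    then have "emeasure M ?T \<le> ennreal (real (card F) * q / m)"
      using le m by (simp add: ennreal_mult[symmetric])
    then show ?thesis
      using T m \<open>0 \<le> q\<close> by (auto simp: rare_def emeasure_eq_measure ennreal_le_iff)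
  qed
qed

end

context gaussian_array begin

lemma entry_tail:
  assumes "i < n" "j \<le> d" "t \<ge> 0"
  shows "rare {\<omega>\<in>space M. t \<le> \<bar>Z (i, j) \<omega>\<bar>} (2 * exp (- t\<^sup>2 / 4))"
proof -
  have [measurable]: "random_variable borel (Z (i, j))" using assms by (intro Z_measurable)
  show ?thesis
    using normal_tail[OF std_normal[of "(i, j)"], of t] assms by (simp add: rare_def)
qed

lemma well_spread_rare:
  assumes n: "n \<ge> 2" and dn: "d \<le> n" and a: "0 < a" "a \<le> 1"
  shows "\<exists>S. rare S (2 * real n ^ 2 * exp (- (real n ^ 4) / 4) +
      ((2 * real n ^ 5 + 1) ^ d * (2 ^ n * real n powr (- (a * real n / 2))) +
       (2 * real n ^ 5 + 1) ^ d * (2 ^ n * exp (- (real n powr (1 + a)) / 4)))) \<and>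
    (\<forall>\<omega>\<in>space M - S. (\<forall>i<n. \<forall>j<d. \<bar>Z (i, j) \<omega>\<bar> \<le> real n ^ 2) \<and> well_spread a n d (\<lambda>k. Z k \<omega>))"
proof -
  define S1 where "S1 = (\<Union>k\<in>{..<n} \<times> {..<d}. {\<omega>\<in>space M. real n ^ 2 \<le> \<bar>Z k \<omega>\<bar>})"
  define F where "F = {z\<in>int_grid (n ^ 5) d. 0 < L2_set z {..<d}}"
  define S2 where "S2 = (\<Union>z\<in>F. {\<omega>\<in>space M. \<exists>A\<subseteq>{..<n}. real n / 2 \<le> real (card A) \<and>
     (\<forall>i\<in>A. \<bar>lin d (\<lambda>k. Z k \<omega>) z i\<bar> \<le> real n powr (- a) * L2_set z {..<d})})"
  define S3 where "S3 = (\<Union>z\<in>F. {\<omega>\<in>space M. (\<Sum>i<n. (lin d (\<lambda>k. Z k \<omega>) z i)\<^sup>2) \<ge> real n powr (1 + a) * (L2_set z {..<d})\<^sup>2})"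
  have F: "finite F" "real (card F) \<le> (2 * real n ^ 5 + 1) ^ d"
  proof -
    show "finite F" using finite_int_grid by (simp add: F_def)
    have "card F \<le> card (int_grid (n ^ 5) d)"
      using finite_int_grid by (intro card_mono) (auto simp: F_def)
    then have "real (card F) \<le> real ((2 * n ^ 5 + 1) ^ d)"
      unfolding card_int_grid of_nat_le_iff .
    then show "real (card F) \<le> (2 * real n ^ 5 + 1) ^ d" by (simp add: add.commute)
  qed
  have "rare S1 (real n ^ 2 * (2 * exp (- (real n ^ 2)\<^sup>2 / 4)))"
    unfolding S1_def
  proof (rule rare_UN_le)
    have "real n * real d \<le> real n * real n" using dn by (intro mult_left_mono) auto
    then show "real (card ({..<n} \<times> {..<d})) \<le> real n ^ 2" by (simp add: power2_eq_square)
    fix k assume "k \<in> {..<n} \<times> {..<d}"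
    then obtain i j where "k = (i, j)" "i < n" "j < d" by auto
    then show "rare {\<omega>\<in>space M. real n ^ 2 \<le> \<bar>Z k \<omega>\<bar>} (2 * exp (- (real n ^ 2)\<^sup>2 / 4))"
      using entry_tail[of i j "real n ^ 2"] by simp
  qed auto
  then have r1: "rare S1 (2 * real n ^ 2 * exp (- (real n ^ 4) / 4))"
    by (simp add: mult_ac)
  have r2: "rare S2 ((2 * real n ^ 5 + 1) ^ d * (2 ^ n * real n powr (- (a * real n / 2))))"
    unfolding S2_def
  proof (rule rare_UN_le[OF F])
    fix z assume "z \<in> F"
    then have z: "0 < L2_set z {..<d}" by (simp add: F_def)
    have t: "0 < real n powr (- a)" "real n powr (- a) \<le> 1"
      using n a powr_mono[of "-a" 0 "real n"] by auto
    show "rare {\<omega>\<in>space M. \<exists>A\<subseteq>{..<n}. real n / 2 \<le> real (card A) \<and>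
       (\<forall>i\<in>A. \<bar>lin d (\<lambda>k. Z k \<omega>) z i\<bar> \<le> real n powr (- a) * L2_set z {..<d})}
      (2 ^ n * real n powr (- (a * real n / 2)))"
      using small_rows_prob[OF z t, of "real n / 2"] by (simp add: rare_def powr_powr)
  qed auto
  have r3: "rare S3 ((2 * real n ^ 5 + 1) ^ d * (2 ^ n * exp (- (real n powr (1 + a)) / 4)))"
    unfolding S3_def
  proof (rule rare_UN_le[OF F])
    fix z assume "z \<in> F"
    then have z: "0 < L2_set z {..<d}" by (simp add: F_def)
    show "rare {\<omega>\<in>space M. (\<Sum>i<n. (lin d (\<lambda>k. Z k \<omega>) z i)\<^sup>2) \<ge> real n powr (1 + a) * (L2_set z {..<d})\<^sup>2}
      (2 ^ n * exp (- (real n powr (1 + a)) / 4))"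
      unfolding rare_def by (intro conjI long_image_prob z powr_ge_zero)
  qed auto
  have good: "(\<forall>i<n. \<forall>j<d. \<bar>Z (i, j) \<omega>\<bar> \<le> real n ^ 2) \<and> well_spread a n d (\<lambda>k. Z k \<omega>)"
    if w: "\<omega> \<in> space M - (S1 \<union> (S2 \<union> S3))" for \<omega>
  proof -
    have e: "\<bar>Z (i, j) \<omega>\<bar> \<le> real n ^ 2" if "i < n" "j < d" for i j
      using w that by (force simp: S1_def)
    moreover have "well_spread a n d (\<lambda>k. Z k \<omega>)"
    proof (rule well_spread_from_grid[OF n dn a])
      show "\<bar>Z (i, j) \<omega>\<bar> \<le> real n ^ 2" if "i < n" "j < d" for i j
        by (rule e[OF that])
    next
      fix z assume "z \<in> int_grid (n ^ 5) d" "0 < L2_set z {..<d}"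
      then have z: "z \<in> F" by (simp add: F_def)
      show "(\<Sum>i<n. (lin d (\<lambda>k. Z k \<omega>) z i)\<^sup>2) < real n powr (1 + a) * (L2_set z {..<d})\<^sup>2"
        using w z by (auto simp: S3_def not_le)
      show "\<not> (\<exists>B\<subseteq>{..<n}. real n / 2 \<le> real (card B) \<and>
         (\<forall>i\<in>B. \<bar>lin d (\<lambda>k. Z k \<omega>) z i\<bar> \<le> real n powr (- a) * L2_set z {..<d}))"
        using w z unfolding S2_def by blast
    qed
    ultimately show ?thesis by blast
  qed
  have "rare (S1 \<union> (S2 \<union> S3)) (2 * real n ^ 2 * exp (- (real n ^ 4) / 4) +
      ((2 * real n ^ 5 + 1) ^ d * (2 ^ n * real n powr (- (a * real n / 2))) +
       (2 * real n ^ 5 + 1) ^ d * (2 ^ n * exp (- (real n powr (1 + a)) / 4))))"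
    by (intro rare_Un r1 r2 r3)
  then show ?thesis using good by blast
qed

text \<open>The factor \<open>B / n ^ 5\<close> turns the integer grid into one of side length of order \<open>n B\<close> with a spacing
small enough for \<open>few_moved\<close>.\<close>

lemma near_grid_rare:
  assumes n: "n > 0" and a: "a > 0" and B: "0 < L2_set \<beta> {..<d}"
  shows "rare (\<Union>z\<in>int_grid (n ^ 6) d. {\<omega>\<in>space M. \<exists>C\<subseteq>{..<n}. real n / 24 \<le> real (card C) \<and>
      (\<forall>i\<in>C. \<exists>j\<in>{..<n} - C. \<bar>lin d (\<lambda>k. Z k \<omega>) \<beta> i -
         lin d (\<lambda>k. Z k \<omega>) (\<lambda>l. L2_set \<beta> {..<d} / real n ^ 5 * z l) j\<bar> \<le> real n powr (- 1 - a) * L2_set \<beta> {..<d})})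
    ((2 * real n ^ 6 + 1) ^ d * (2 ^ n * real n powr (- (a * real n / 24))))"
proof (rule rare_UN_le)
  show "real (card (int_grid (n ^ 6) d)) \<le> (2 * real n ^ 6 + 1) ^ d"
    unfolding card_int_grid by (simp add: add.commute)
  have "real n * real n powr (- 1 - a) = real n powr (- a)"
    using n by (simp add: powr_mult_base)
  moreover have "real n powr (- a) \<le> 1"
    using n a powr_mono[of "-a" 0 "real n"] by auto
  ultimately show "rare {\<omega>\<in>space M. \<exists>C\<subseteq>{..<n}. real n / 24 \<le> real (card C) \<and>
      (\<forall>i\<in>C. \<exists>j\<in>{..<n} - C. \<bar>lin d (\<lambda>k. Z k \<omega>) \<beta> i -
         lin d (\<lambda>k. Z k \<omega>) (\<lambda>l. L2_set \<beta> {..<d} / real n ^ 5 * z l) j\<bar> \<le> real n powr (- 1 - a) * L2_set \<beta> {..<d})}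
     (2 ^ n * real n powr (- (a * real n / 24)))" for z
    using near_rows_prob[OF B, of "real n powr (- 1 - a)" "real n / 24"] n
    by (simp add: rare_def powr_powr)
qed (auto simp: finite_int_grid)

lemma noise_rare:
  assumes t: "t \<ge> 0"
  shows "rare (\<Union>j\<in>{..<n}. {\<omega>\<in>space M. t \<le> \<bar>Z (j, d) \<omega>\<bar>}) (real n * (2 * exp (- t\<^sup>2 / 4)))"
  using t by (intro rare_UN_le entry_tail) auto

lemma pair_rare:
  assumes c: "0 < L2_set c {..<d}" and t: "t \<ge> 0" and ij: "i < n" "j < n" "i \<noteq> j"
  shows "rare {\<omega>\<in>space M. \<bar>lin d (\<lambda>k. Z k \<omega>) c i - lin d (\<lambda>k. Z k \<omega>) c j\<bar> \<le> t * L2_set c {..<d}} t"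
proof -
  have [measurable]: "random_variable borel (\<lambda>\<omega>. lin d (\<lambda>k. Z k \<omega>) c i)"
    "random_variable borel (\<lambda>\<omega>. lin d (\<lambda>k. Z k \<omega>) c j)"
    using ij by (auto intro: row_measurable)
  let ?K = "({..<n} - {i}) \<times> {..<d}"
  have h: "lin d (\<lambda>k\<in>?K. Z k \<omega>) c j = lin d (\<lambda>k. Z k \<omega>) c j" for \<omega>
    using ij by (intro lin_restrict) auto
  have "prob {\<omega>\<in>space M. \<forall>i\<in>{i}. \<exists>j\<in>{j}. \<bar>lin d (\<lambda>k. Z k \<omega>) c i - lin d (\<lambda>k\<in>?K. Z k \<omega>) c j\<bar> \<le> t * L2_set c {..<d}}
     \<le> (real (card {j}) * (t * L2_set c {..<d} / L2_set c {..<d})) ^ card {i}"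
    using ij c t by (intro near_targets_prob lin_measurable) auto
  then show ?thesis
    using c by (simp add: rare_def h)
qed

lemma close_pairs_rare:
  assumes c: "0 < L2_set c {..<d}" and t: "t \<ge> 0"
  shows "rare (\<Union>(i, j)\<in>{(i, j). i < n \<and> j < n \<and> i \<noteq> j}.
     {\<omega>\<in>space M. \<bar>lin d (\<lambda>k. Z k \<omega>) c i - lin d (\<lambda>k. Z k \<omega>) c j\<bar> \<le> t * L2_set c {..<d}}) (real n ^ 2 * t)"
proof (rule rare_UN_le)
  have sub: "{(i, j). i < n \<and> j < n \<and> i \<noteq> j} \<subseteq> {..<n} \<times> {..<n}" by auto
  show "finite {(i, j). i < n \<and> j < n \<and> i \<noteq> j}" by (rule finite_subset[OF sub]) simp
  have "card {(i, j). i < n \<and> j < n \<and> i \<noteq> j} \<le> n * n"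
    using card_mono[OF _ sub] by simp
  then show "real (card {(i, j). i < n \<and> j < n \<and> i \<noteq> j}) \<le> real n ^ 2"
    unfolding power2_eq_square of_nat_mult[symmetric] of_nat_le_iff .
qed (use t c in \<open>auto intro: pair_rare\<close>)

text \<open>The expected number of rows with a close neighbour is at most \<open>n * (n * t)\<close>.\<close>

lemma many_close_rare:
  assumes c: "0 < L2_set c {..<d}" and t: "t \<ge> 0" and m: "m > 0"
  shows "rare {\<omega>\<in>space M. m \<le> real (card {i\<in>{..<n}. \<exists>j\<in>{..<n}. j \<noteq> i \<and>
      \<bar>lin d (\<lambda>k. Z k \<omega>) c i - lin d (\<lambda>k. Z k \<omega>) c j\<bar> \<le> t * L2_set c {..<d}})} (real n ^ 2 * t / m)"
proof -
  define S where "S i = (\<Union>j\<in>{..<n} - {i}. {\<omega>\<in>space M. \<bar>lin d (\<lambda>k. Z k \<omega>) c i - lin d (\<lambda>k. Z k \<omega>) c j\<bar> \<le> t * L2_set c {..<d}})" for i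
  have "rare (S i) (real n * t)" if "i < n" for i
    unfolding S_def using that t c by (intro rare_UN_le pair_rare) auto
  then have "rare {\<omega>\<in>space M. m \<le> real (card {i\<in>{..<n}. \<omega> \<in> S i})} (real (card {..<n}) * (real n * t) / m)"
    using m by (intro rare_count) auto
  moreover have "{i\<in>{..<n}. \<omega> \<in> S i} = {i\<in>{..<n}. \<exists>j\<in>{..<n}. j \<noteq> i \<and>
      \<bar>lin d (\<lambda>k. Z k \<omega>) c i - lin d (\<lambda>k. Z k \<omega>) c j\<bar> \<le> t * L2_set c {..<d}}" if "\<omega> \<in> space M" for \<omega>
    using that by (auto simp: S_def)
  ultimately show ?thesis
    by (simp add: power2_eq_square mult.assoc cong: conj_cong)
qed

text \<open>Design and noise are disjoint blocks of the array. For a fixed design the projected noise in row \<open>j\<close> is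
normal, and its standard deviation is the norm of a row of the hat matrix, hence at most 1.\<close>

lemma fitted_noise_rare:
  assumes t: "t > 0"
  shows "rare (\<Union>j\<in>{..<n}. {\<omega>\<in>space M. t \<le> \<bar>\<Sum>i<n. hat n d (\<lambda>k. Z k \<omega>) j i * Z (i, d) \<omega>\<bar>})
    (real n * (2 * exp (- t\<^sup>2 / 4)))"
proof (rule rare_UN_le)
  fix j assume "j \<in> {..<n}"
  then have j: "j < n" by simp
  define K where "K = {..<n} \<times> {..<d}"
  define L where "L = {..<n} \<times> {d}"
  let ?KL = "Pi\<^sub>M K (\<lambda>_. borel :: real measure) \<Otimes>\<^sub>M Pi\<^sub>M L (\<lambda>_. borel :: real measure)"
  define Q where "Q = (\<lambda>u v. t \<le> \<bar>\<Sum>i<n. hat n d u j i * v (i, d)\<bar>)"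
  have KL: "K \<inter> L = {}" "K \<subseteq> {..<n} \<times> {..d}" "L \<subseteq> {..<n} \<times> {..d}"
    by (auto simp: K_def L_def)
  have Qeq: "Q (\<lambda>k\<in>K. Z k \<omega>) (\<lambda>k\<in>L. Z k \<omega>) \<longleftrightarrow> t \<le> \<bar>\<Sum>i<n. hat n d (\<lambda>k. Z k \<omega>) j i * Z (i, d) \<omega>\<bar>" for \<omega>
  proof -
    have "(\<Sum>i<n. hat n d (\<lambda>k\<in>K. Z k \<omega>) j i * (\<lambda>k\<in>L. Z k \<omega>) (i, d)) =
      (\<Sum>i<n. hat n d (\<lambda>k. Z k \<omega>) j i * Z (i, d) \<omega>)"
      using j by (intro sum.cong arg_cong2[where f = "(*)"] hat_cong) (auto simp: K_def L_def)
    then show ?thesis by (simp add: Q_def)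
  qed
  have r_L: "(\<Sum>k\<in>L. f k) = (\<Sum>i<n. f (i, d))" for f :: "nat \<times> nat \<Rightarrow> real"
    unfolding L_def using sum.cartesian_product[of "\<lambda>i j. f (i, j)" "{d}" "{..<n}"] by (simp add: case_prod_beta)
  have "prob {\<omega>\<in>space M. True \<and> Q (\<lambda>k\<in>K. Z k \<omega>) (\<lambda>k\<in>L. Z k \<omega>)} \<le>
      (2 * exp (- t\<^sup>2 / 4)) * prob {\<omega>\<in>space M. True}"
  proof (rule indep_section_bound[OF indep KL])
    have h: "(\<lambda>x. hat n d (fst x) j i) \<in> borel_measurable ?KL" if "i < n" for i
      using measurable_compose[OF measurable_fst hat_measurable[OF j that]] by (simp add: K_def)
    have v: "(\<lambda>x. snd x (i, d)) \<in> borel_measurable ?KL" if "i < n" for i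
      using that by (intro measurable_compose[OF measurable_snd measurable_component_singleton]) (auto simp: L_def)
    have [measurable]: "(\<lambda>x. \<Sum>i<n. hat n d (fst x) j i * snd x (i, d)) \<in> borel_measurable ?KL"
      using h v by (intro borel_measurable_sum borel_measurable_times) auto
    show "{x \<in> space ?KL. Q (fst x) (snd x)}
      \<in> sets ?KL"
      unfolding Q_def by measurable
    fix u
    let ?c = "\<lambda>k. hat n d u j (fst k)" and ?Y = "\<lambda>\<omega>. \<Sum>i<n. hat n d u j i * Z (i, d) \<omega>"
    have Qu: "Q u (\<lambda>k\<in>L. Z k \<omega>) \<longleftrightarrow> t \<le> \<bar>?Y \<omega>\<bar>" for \<omega>
      by (simp add: Q_def L_def)
    have sL: "(\<Sum>k\<in>L. Z k \<omega> * ?c k) = ?Y \<omega>" for \<omega>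
      by (simp add: r_L mult.commute)
    have nL: "L2_set ?c L = L2_set (hat n d u j) {..<n}"
      by (simp add: L2_set_def r_L)
    show "prob {\<omega> \<in> space M. Q u (\<lambda>k\<in>L. Z k \<omega>)} \<le> 2 * exp (- t\<^sup>2 / 4)"
    proof (cases "\<exists>k\<in>L. ?c k \<noteq> 0")
      case True
      then obtain k where k: "k \<in> L" "?c k \<noteq> 0" by auto
      define s where "s = L2_set (hat n d u j) {..<n}"
      have Y: "distributed M lborel ?Y (normal_density 0 s)"
        using normal_combination[of L k ?c, OF KL(3) k] unfolding sL nL s_def .
      have "s \<noteq> 0" using k by (auto simp: s_def L2_set_eq_0_iff L_def)
      then have s: "0 < s" "s \<le> 1"
        using hat_row_norm[OF j, of d u] by (auto simp: s_def less_le)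
      have [measurable]: "random_variable borel ?Y" using distributed_measurable[OF Y] by simp
      have "t * s \<le> t" using s t by simp
      then have "prob {\<omega> \<in> space M. Q u (\<lambda>k\<in>L. Z k \<omega>)} \<le> prob {\<omega>\<in>space M. t * s \<le> \<bar>?Y \<omega>\<bar>}"
        unfolding Qu by (intro finite_measure_mono) auto
      also have "\<dots> \<le> 2 * exp (- t\<^sup>2 / 4)"
        using normal_tail[OF Y s(1), of t] t by simp
      finally show ?thesis .
    next
      case False
      then have "?Y \<omega> = 0" for \<omega> unfolding sL[symmetric] by (intro sum.neutral) auto
      then show ?thesis using t by (simp add: Qu)
    qed
  qed auto
  then have le: "prob {\<omega>\<in>space M. t \<le> \<bar>\<Sum>i<n. hat n d (\<lambda>k. Z k \<omega>) j i * Z (i, d) \<omega>\<bar>} \<le> 2 * exp (- t\<^sup>2 / 4)"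
    by (simp add: Qeq prob_space)
  have hm: "(\<lambda>\<omega>. hat n d (\<lambda>k. Z k \<omega>) j i) \<in> borel_measurable M" if i: "i < n" for i
  proof -
    have rm: "random_variable (Pi\<^sub>M K (\<lambda>_. borel)) (\<lambda>\<omega>. \<lambda>k\<in>K. Z k \<omega>)"
      by (intro measurable_restrict) (auto simp: K_def intro: Z_measurable)
    have "(\<lambda>\<omega>. hat n d (\<lambda>k\<in>K. Z k \<omega>) j i) \<in> borel_measurable M"
      using measurable_compose[OF rm hat_measurable[OF j i, of d, folded K_def]] .
    moreover have "hat n d (\<lambda>k\<in>K. Z k \<omega>) j i = hat n d (\<lambda>k. Z k \<omega>) j i" for \<omega>
      using i j by (intro hat_cong) (auto simp: K_def)
    ultimately show ?thesis by simp
  qed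
  have [measurable]: "(\<lambda>\<omega>. \<Sum>i<n. hat n d (\<lambda>k. Z k \<omega>) j i * Z (i, d) \<omega>) \<in> borel_measurable M"
    using hm by (intro borel_measurable_sum borel_measurable_times Z_measurable) auto
  show "rare {\<omega>\<in>space M. t \<le> \<bar>\<Sum>i<n. hat n d (\<lambda>k. Z k \<omega>) j i * Z (i, d) \<omega>\<bar>} (2 * exp (- t\<^sup>2 / 4))"
    using le by (simp add: rare_def)
qed auto

end

section \<open>Failure probabilities\<close>

lemma powr_square: "(x powr b)\<^sup>2 = x powr (2 * b)" for x b :: real
  by (simp add: power2_eq_square powr_add[symmetric])

lemma square_times_powr: "x > 0 \<Longrightarrow> x ^ 2 * x powr b = x powr (2 + b)" for x b :: real
  by (simp add: powr_add)

text \<open>The summands belong, in this order, to a large entry of the design, to grid vectors whose image has too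
many small entries or is too long, to grid vectors with many near coincidences, and to a large noise entry.\<close>

definition core_risk :: "real \<Rightarrow> nat \<Rightarrow> nat \<Rightarrow> real" where
  "core_risk a n d =
     2 * real n ^ 2 * exp (- (real n ^ 4) / 4) +
     ((2 * real n ^ 5 + 1) ^ d * (2 ^ n * real n powr (- (a * real n / 2))) +
      (2 * real n ^ 5 + 1) ^ d * (2 ^ n * exp (- (real n powr (1 + a)) / 4))) +
     (2 * real n ^ 6 + 1) ^ d * (2 ^ n * real n powr (- (a * real n / 24))) +
     real n * (2 * exp (- (real n powr (a / 2))\<^sup>2 / 4))"

text \<open>The inequalities by which powers of \<open>n\<close> absorb the constants of \<open>few_moved\<close> and \<open>none_moved\<close>.\<close>

definition large :: "real \<Rightarrow> nat \<Rightarrow> bool" where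
  "large a n \<longleftrightarrow> n \<ge> 4 \<and> 40 * real n powr (3 * a / 2) \<le> real n \<and> 128 * real n powr (- 16 * a) \<le> 1 \<and>
     real n powr (- 9 * a) * (2 + 4 * (1 + 32 * real n powr (3 * a / 2)) * (1 + 3 * (32 * real n powr (3 * a / 2))))
       < real n powr (- a)"

lemma eventually_large: "a > 0 \<Longrightarrow> a \<le> 1 / 20 \<Longrightarrow> eventually (large a) sequentially"
proof -
  assume a: "a > 0" "a \<le> 1 / 20"
  have "eventually (\<lambda>n. n \<ge> (4::nat)) sequentially" by (rule eventually_ge_at_top)
  moreover have "eventually (\<lambda>n. 40 * real n powr (3 * a / 2) \<le> real n) sequentially"
    using a by real_asymp
  moreover have "eventually (\<lambda>n. 128 * real n powr (- 16 * a) \<le> 1) sequentially"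
    using a by real_asymp
  moreover have "eventually (\<lambda>n. real n powr (- 9 * a) * (2 + 4 * (1 + 32 * real n powr (3 * a / 2)) * (1 + 3 * (32 * real n powr (3 * a / 2))))
       < real n powr (- a)) sequentially"
    using a by real_asymp
  ultimately show ?thesis unfolding large_def[abs_def] by (intro eventually_conj)
qed

text \<open>The grids have at most \<open>n ^ (7 d)\<close> points, and eventually \<open>d \<le> a n / 400\<close>. As \<open>7/400 < 1/48\<close>, a
per-point probability of \<open>2 ^ n * n powr (-a n / 24)\<close> leaves \<open>2 ^ n * n powr (-a n / 48)\<close> after the
union bound. This is where \<open>d = o(n)\<close> is needed and \<open>d \<le> n\<close>
would not do.\<close>

lemma core_risk_tendsto_zero:
  assumes a: "a > 0" and d: "(\<lambda>n. real (d n)) \<in> o(\<lambda>n. real n)"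
  shows "(\<lambda>n. core_risk a n (d n)) \<longlonglongrightarrow> 0"
proof -
  define u where "u = (\<lambda>n. 2 * real n ^ 2 * exp (- (real n ^ 4) / 4) +
     3 * (2 powr real n * real n powr (- (a / 48 * real n))) + real n * (2 * exp (- (real n powr (a / 2))\<^sup>2 / 4)))"
  have "(\<lambda>n. 2 * real n ^ 2 * exp (- (real n ^ 4) / 4)) \<longlonglongrightarrow> 0" by real_asymp
  moreover have "(\<lambda>n. 2 powr real n * real n powr (- (a / 48 * real n))) \<longlonglongrightarrow> 0"
    using a by real_asymp
  moreover have "(\<lambda>n. real n * (2 * exp (- (real n powr (a / 2))\<^sup>2 / 4))) \<longlonglongrightarrow> 0"
    using a by real_asymp
  ultimately have "u \<longlonglongrightarrow> 0 + 3 * 0 + 0"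
    unfolding u_def by (intro tendsto_intros)
  then have u: "u \<longlonglongrightarrow> 0" by simp
  have 1: "eventually (\<lambda>n. real (d n) \<le> a / 400 * real n) sequentially"
    using landau_o.smallD[OF d, of "a / 400"] a by simp
  have 2: "eventually (\<lambda>n. exp (- (real n powr (1 + a)) / 4) \<le> real n powr (- (a * real n / 24))) sequentially"
    using a by real_asymp
  have 3: "eventually (\<lambda>n. 4 \<le> n) sequentially" by (rule eventually_ge_at_top)
  have "eventually (\<lambda>n. core_risk a n (d n) \<le> u n) sequentially"
    using 1 2 3
  proof eventually_elim
    fix n assume d: "real (d n) \<le> a / 400 * real n" and e: "exp (- (real n powr (1 + a)) / 4) \<le> real n powr (- (a * real n / 24))"
      and n: "4 \<le> n"
    have n1: "real n \<ge> 1" "real n \<ge> 4" using n by auto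
    have grid: "(2 * real n ^ k + 1) ^ d n \<le> real n powr (7 * a / 400 * real n)" if "k \<le> 6" for k
    proof -
      have p: "1 \<le> real n ^ k" using n1 by simp
      have "2 * real n ^ k + 1 \<le> 4 * real n ^ k" using p by linarith
      also have "\<dots> \<le> real n * real n ^ k" using n1 by (intro mult_right_mono) auto
      also have "\<dots> = real n ^ Suc k" by simp
      also have "\<dots> \<le> real n ^ 7" using n1 that by (intro power_increasing) auto
      finally have "(2 * real n ^ k + 1) ^ d n \<le> (real n ^ 7) ^ d n"
        by (intro power_mono) auto
      also have "\<dots> = real n ^ (7 * d n)" by (rule power_mult[symmetric])
      also have "\<dots> = real n powr real (7 * d n)"
        using n1 by (intro powr_realpow[symmetric]) auto
      also have "\<dots> \<le> real n powr (7 * a / 400 * real n)"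
        using n1 d by (intro powr_mono) auto
      finally show ?thesis .
    qed
    have an: "0 \<le> a * real n" using a by simp
    have two: "(2::real) ^ n = 2 powr real n" by (simp add: powr_realpow)
    have key: "(2 * real n ^ k + 1) ^ d n * (2 ^ n * x) \<le> 2 powr real n * real n powr (- (a / 48 * real n))"
      if "k \<le> 6" "0 \<le> x" "x \<le> real n powr (- (a * real n / 24))" for k x
    proof -
      have "(2 * real n ^ k + 1) ^ d n * (2 ^ n * x) \<le>
          real n powr (7 * a / 400 * real n) * (2 ^ n * real n powr (- (a * real n / 24)))"
        using that by (intro mult_mono grid) auto
      also have "\<dots> = 2 powr real n * (real n powr (7 * a / 400 * real n) * real n powr (- (a * real n / 24)))"
        by (simp only: two mult_ac)
      also have "\<dots> = 2 powr real n * real n powr (7 * a / 400 * real n + - (a * real n / 24))"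
        by (simp only: powr_add)
      also have "\<dots> \<le> 2 powr real n * real n powr (- (a / 48 * real n))"
      proof (intro mult_left_mono powr_mono)
        show "7 * a / 400 * real n + - (a * real n / 24) \<le> - (a / 48 * real n)"
          using an by linarith
      qed (use n1 in auto)
      finally show ?thesis .
    qed
    have half: "real n powr (- (a * real n / 2)) \<le> real n powr (- (a * real n / 24))"
    proof (intro powr_mono)
      show "- (a * real n / 2) \<le> - (a * real n / 24)" using an by linarith
    qed (use n1 in auto)
    show "core_risk a n (d n) \<le> u n"
    proof -
      have "3 * x = x + x + x" for x :: real by simp
      then show ?thesis
        unfolding core_risk_def u_def add.assoc
        using add_mono[OF key[of 5 "real n powr (- (a * real n / 2))"]
            add_mono[OF key[of 5 "exp (- (real n powr (1 + a)) / 4)"]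
              key[of 6 "real n powr (- (a * real n / 24))"]]] half e
        by simp
    qed
  qed
  moreover have "eventually (\<lambda>n. 0 \<le> core_risk a n (d n)) sequentially"
    by (intro always_eventually allI) (simp add: core_risk_def)
  ultimately show ?thesis
    by (intro tendsto_sandwich[OF _ _ tendsto_const u])
qed

context gaussian_array begin

definition ls_fit :: "real \<Rightarrow> (nat \<Rightarrow> real) \<Rightarrow> 'a \<Rightarrow> (nat \<Rightarrow> nat) \<Rightarrow> (nat \<Rightarrow> real) \<Rightarrow> bool" where
  "ls_fit s \<beta> \<omega> f b \<longleftrightarrow> f permutes {..<n} \<and> (\<forall>c.
     L2_set (\<lambda>j. lin d (\<lambda>k. Z k \<omega>) \<beta> (f j) + s * Z (f j, d) \<omega> - lin d (\<lambda>k. Z k \<omega>) b j) {..<n} \<le>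
     L2_set (\<lambda>j. lin d (\<lambda>k. Z k \<omega>) \<beta> j + s * Z (j, d) \<omega> - lin d (\<lambda>k. Z k \<omega>) c j) {..<n})"

text \<open>Collects the exceptional events that both parts of the theorem share. The bound on \<open>s\<close> keeps the
residual, of norm at most \<open>2 \<parallel>w\<parallel>\<close>, below \<open>2 B n powr (-1/2 - 9 a)\<close>.\<close>

lemma few_moved_rare:
  assumes n: "large a n" and dn: "d \<le> n" and a: "0 < a" "a \<le> 1 / 20"
    and B: "0 < L2_set \<beta> {..<d}" and s: "0 < s" "s \<le> L2_set \<beta> {..<d} * real n powr (- 1 - 10 * a)"
  obtains S where "rare S (core_risk a n d)"
    "\<And>\<omega>. \<omega> \<in> space M - S \<Longrightarrow> well_spread a n d (\<lambda>k. Z k \<omega>)"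
    "\<And>\<omega> j. \<omega> \<in> space M - S \<Longrightarrow> j < n \<Longrightarrow> \<bar>Z (j, d) \<omega>\<bar> \<le> real n powr (a / 2)"
    "\<And>\<omega> f b. \<omega> \<in> space M - S \<Longrightarrow> ls_fit s \<beta> \<omega> f b \<Longrightarrow> real (card {j\<in>{..<n}. f j \<noteq> j}) \<le> real n / 4"
    "\<And>\<omega> f b. \<omega> \<in> space M - S \<Longrightarrow> ls_fit s \<beta> \<omega> f b \<Longrightarrow>
      L2_set (\<lambda>j. lin d (\<lambda>k. Z k \<omega>) \<beta> (f j) - lin d (\<lambda>k. Z k \<omega>) b j) {..<n}
        \<le> 2 * L2_set \<beta> {..<d} * real n powr (- 1 / 2 - 9 * a)"
proof -
  let ?B = "L2_set \<beta> {..<d}"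
  have n4: "n \<ge> 4" "n > 0" "n \<ge> 2" and n1: "real n \<ge> 1"
    and l1: "40 * real n powr (3 * a / 2) \<le> real n" and l2: "128 * real n powr (- 16 * a) \<le> 1"
    using n by (auto simp: large_def)
  obtain S1 where S1: "rare S1 (2 * real n ^ 2 * exp (- (real n ^ 4) / 4) +
      ((2 * real n ^ 5 + 1) ^ d * (2 ^ n * real n powr (- (a * real n / 2))) +
       (2 * real n ^ 5 + 1) ^ d * (2 ^ n * exp (- (real n powr (1 + a)) / 4))))"
    and g1: "\<And>\<omega>. \<omega> \<in> space M - S1 \<Longrightarrow> (\<forall>i<n. \<forall>j<d. \<bar>Z (i, j) \<omega>\<bar> \<le> real n ^ 2) \<and> well_spread a n d (\<lambda>k. Z k \<omega>)"
    using well_spread_rare[OF n4(3) dn a(1)] a by auto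
  define near where "near = (\<lambda>z. {\<omega>\<in>space M. \<exists>C\<subseteq>{..<n}. real n / 24 \<le> real (card C) \<and>
      (\<forall>i\<in>C. \<exists>j\<in>{..<n} - C. \<bar>lin d (\<lambda>k. Z k \<omega>) \<beta> i -
         lin d (\<lambda>k. Z k \<omega>) (\<lambda>l. ?B / real n ^ 5 * z l) j\<bar> \<le> real n powr (- 1 - a) * ?B)})"
  define S2 where "S2 = (\<Union>z\<in>int_grid (n ^ 6) d. near z)"
  have S2: "rare S2 ((2 * real n ^ 6 + 1) ^ d * (2 ^ n * real n powr (- (a * real n / 24))))"
    unfolding S2_def near_def by (rule near_grid_rare[OF n4(2) a(1) B])
  define S3 where "S3 = (\<Union>j\<in>{..<n}. {\<omega>\<in>space M. real n powr (a / 2) \<le> \<bar>Z (j, d) \<omega>\<bar>})"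
  have S3: "rare S3 (real n * (2 * exp (- (real n powr (a / 2))\<^sup>2 / 4)))"
    unfolding S3_def by (rule noise_rare) simp
  define S where "S = S1 \<union> S2 \<union> S3"
  have rare: "rare S (core_risk a n d)"
    unfolding S_def core_risk_def by (intro rare_Un S1 S2 S3)
  have noise: "\<bar>Z (j, d) \<omega>\<bar> \<le> real n powr (a / 2)" if "\<omega> \<in> space M - S" "j < n" for \<omega> j
    using that by (force simp: S_def S3_def)
  have res: "L2_set (\<lambda>j. lin d (\<lambda>k. Z k \<omega>) \<beta> (f j) - lin d (\<lambda>k. Z k \<omega>) b j) {..<n}
        \<le> 2 * ?B * real n powr (- 1 / 2 - 9 * a)"
    if w: "\<omega> \<in> space M - S" and ls: "ls_fit s \<beta> \<omega> f b" for \<omega> f b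
  proof -
    let ?x = "lin d (\<lambda>k. Z k \<omega>) \<beta>" and ?v = "lin d (\<lambda>k. Z k \<omega>) b" and ?w = "\<lambda>j. s * Z (j, d) \<omega>"
    have f: "f permutes {..<n}" using ls by (simp add: ls_fit_def)
    \<comment> \<open>The competitor is the identity with the true coefficients.\<close>
    have le: "L2_set (\<lambda>j. ?x (f j) + ?w (f j) - ?v j) {..<n} \<le> L2_set (\<lambda>j. ?x j + ?w j - ?x j) {..<n}"
      using ls unfolding ls_fit_def by blast
    have "L2_set (\<lambda>j. ?x (f j) - ?v j) {..<n} \<le>
        L2_set (\<lambda>j. (?x (f j) - ?v j) - - ?w (f j)) {..<n} + L2_set (\<lambda>j. - ?w (f j)) {..<n}"
      by (rule L2_set_diff_le)
    also have "L2_set (\<lambda>j. - ?w (f j)) {..<n} = L2_set ?w {..<n}"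
      unfolding L2_set_minus by (rule L2_set_permute[OF f])
    also have "(\<lambda>j. (?x (f j) - ?v j) - - ?w (f j)) = (\<lambda>j. ?x (f j) + ?w (f j) - ?v j)"
      by (simp add: algebra_simps)
    finally have "L2_set (\<lambda>j. ?x (f j) - ?v j) {..<n} \<le> 2 * L2_set ?w {..<n}"
      using le by simp
    also have "L2_set ?w {..<n} \<le> sqrt (real (card {..<n})) * (s * real n powr (a / 2))"
      using s noise[OF w] by (intro L2_set_le_card) (auto simp: abs_mult)
    also have "\<dots> \<le> sqrt (real n) * ((?B * real n powr (- 1 - 10 * a)) * real n powr (a / 2))"
      using s by (intro mult_mono) auto
    also have "\<dots> = ?B * real n powr (- 1 / 2 - 19 / 2 * a)"
      using n4 by (simp add: powr_half_sqrt[symmetric] powr_add[symmetric] field_simps)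
    also have "\<dots> \<le> ?B * real n powr (- 1 / 2 - 9 * a)"
      using a n1 by (intro mult_left_mono powr_mono) auto
    finally show ?thesis by simp
  qed
  have few: "real (card {j\<in>{..<n}. f j \<noteq> j}) \<le> real n / 4"
    if w: "\<omega> \<in> space M - S" and ls: "ls_fit s \<beta> \<omega> f b" for \<omega> f b
  proof (rule few_moved[OF n4(2) a(1) l1 dn _ _ B _ res[OF w ls]])
    show "well_spread a n d (\<lambda>k. Z k \<omega>)" using g1 w by (auto simp: S_def)
    show "f permutes {..<n}" using ls by (simp add: ls_fit_def)
    show "\<bar>Z (i, j) \<omega>\<bar> \<le> real n ^ 2" if "i < n" "j < d" for i j
      using g1 w that by (auto simp: S_def)
    show "8 * (2 * ?B * real n powr (- 1 / 2 - 9 * a))\<^sup>2 \<le> real n * (real n powr (- 1 - a) / 2 * ?B)\<^sup>2"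
    proof -
      have "8 * (2 * ?B * real n powr (- 1 / 2 - 9 * a))\<^sup>2 = 32 * ?B\<^sup>2 * (real n powr (- 1 - 18 * a))"
      proof -
        have "2 * (- 1 / 2 - 9 * a) = - 1 - 18 * a" by simp
        then have sq: "(real n powr (- 1 / 2 - 9 * a))\<^sup>2 = real n powr (- 1 - 18 * a)"
          by (simp only: powr_square)
        have "8 * (2 * ?B * x)\<^sup>2 = 32 * ?B\<^sup>2 * x\<^sup>2" for x
          by (simp add: power_mult_distrib)
        then show ?thesis by (simp only: sq)
      qed
      also have "real n powr (- 1 - 18 * a) = real n powr (- 16 * a) * real n powr (- 1 - 2 * a)"
      proof -
        have "- 1 - 18 * a = - 16 * a + (- 1 - 2 * a)" by simp
        then show ?thesis by (simp only: powr_add)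
      qed
      also have "32 * ?B\<^sup>2 * (real n powr (- 16 * a) * real n powr (- 1 - 2 * a)) =
          (128 * real n powr (- 16 * a)) * (?B\<^sup>2 / 4 * real n powr (- 1 - 2 * a))" by simp
      also have "\<dots> \<le> 1 * (?B\<^sup>2 / 4 * real n powr (- 1 - 2 * a))"
        using l2 by (intro mult_right_mono) auto
      also have "real n powr (- 1 - 2 * a) = real n * (real n powr (- 1 - a))\<^sup>2"
      proof -
        have "- 1 - 2 * a = 1 + 2 * (- 1 - a)" by simp
        then have "real n powr (- 1 - 2 * a) = real n powr 1 * real n powr (2 * (- 1 - a))"
          by (simp only: powr_add)
        then show ?thesis using n4 by (simp add: powr_square)
      qed
      finally show ?thesis by (simp add: power_mult_distrib power_divide mult_ac)
    qed
    show "2 * ?B * real n powr (- 1 / 2 - 9 * a) \<le> ?B"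
    proof -
      have "real n powr (- 1 / 2 - 9 * a) \<le> real n powr (- 1 / 2)"
        using a n1 by (intro powr_mono) auto
      also have "\<dots> = 1 / sqrt (real n)"
        using powr_minus[of "real n" "1 / 2"] n4 by (simp add: powr_half_sqrt inverse_eq_divide)
      also have "\<dots> \<le> 1 / 2"
        using n4 by (intro divide_left_mono real_le_rsqrt) auto
      finally have "?B * (2 * real n powr (- 1 / 2 - 9 * a)) \<le> ?B * 1"
        by (intro mult_left_mono) auto
      then show ?thesis by (simp add: mult_ac)
    qed
    show "\<not> (\<exists>C\<subseteq>{..<n}. real n / 24 \<le> real (card C) \<and> (\<forall>i\<in>C. \<exists>j\<in>{..<n} - C.
        \<bar>lin d (\<lambda>k. Z k \<omega>) \<beta> i - lin d (\<lambda>k. Z k \<omega>) (\<lambda>l. ?B / real n ^ 5 * z l) j\<bar>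
          \<le> real n powr (- 1 - a) * ?B))" if "z \<in> int_grid (n ^ 6) d" for z
    proof -
      have "\<omega> \<notin> near z" "\<omega> \<in> space M" using w that by (auto simp: S_def S2_def)
      then show ?thesis unfolding near_def by blast
    qed
  qed
  have "well_spread a n d (\<lambda>k. Z k \<omega>)" if "\<omega> \<in> space M - S" for \<omega>
    using g1[of \<omega>] that by (simp add: S_def)
  then show ?thesis by (rule that[OF rare _ noise few res])
qed

text \<open>At scale \<open>g = n powr (-1 - 2 a)\<close> about \<open>n powr (1 - 2 a)\<close> rows have a close neighbour, so by Markov
\<open>n powr (1 - a)\<close> or more of them occur with probability at most \<open>n powr (-a)\<close>.\<close>

lemma almost_exact_rare:
  assumes n: "large a n" and dn: "d \<le> n" and a: "0 < a" "a \<le> 1 / 20"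
    and B: "0 < L2_set \<beta> {..<d}" and s: "0 < s" "s \<le> L2_set \<beta> {..<d} * real n powr (- 1 - 10 * a)"
  obtains S where "rare S (core_risk a n d + real n powr (- a))"
    "\<And>\<omega>. \<omega> \<in> space M - S \<Longrightarrow> well_spread a n d (\<lambda>k. Z k \<omega>)"
    "\<And>\<omega> f b. \<omega> \<in> space M - S \<Longrightarrow> ls_fit s \<beta> \<omega> f b \<Longrightarrow> real (card {j\<in>{..<n}. f j \<noteq> j}) \<le>
       real n * (real n powr (- a) + ((1 + 32 * real n powr (3 * a / 2)) * 2 * real n powr (- 7 * a))\<^sup>2)"
proof -
  let ?B = "L2_set \<beta> {..<d}"
  have n4: "n > 0" "real n > 0" using n by (auto simp: large_def)
  define g where "g = real n powr (- 1 - 2 * a)"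
  define r where "r = real n powr (1 - a)"
  obtain S where S: "rare S (core_risk a n d)"
    and ws: "\<And>\<omega>. \<omega> \<in> space M - S \<Longrightarrow> well_spread a n d (\<lambda>k. Z k \<omega>)"
    and noise: "\<And>\<omega> j. \<omega> \<in> space M - S \<Longrightarrow> j < n \<Longrightarrow> \<bar>Z (j, d) \<omega>\<bar> \<le> real n powr (a / 2)"
    and few: "\<And>\<omega> f b. \<omega> \<in> space M - S \<Longrightarrow> ls_fit s \<beta> \<omega> f b \<Longrightarrow> real (card {j\<in>{..<n}. f j \<noteq> j}) \<le> real n / 4"
    and res: "\<And>\<omega> f b. \<omega> \<in> space M - S \<Longrightarrow> ls_fit s \<beta> \<omega> f b \<Longrightarrow>
      L2_set (\<lambda>j. lin d (\<lambda>k. Z k \<omega>) \<beta> (f j) - lin d (\<lambda>k. Z k \<omega>) b j) {..<n}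
        \<le> 2 * L2_set \<beta> {..<d} * real n powr (- 1 / 2 - 9 * a)"
    by (rule few_moved_rare[OF n dn a B s]) (rule that; assumption)
  define T where "T = {\<omega>\<in>space M. r \<le> real (card {i\<in>{..<n}. \<exists>j\<in>{..<n}. j \<noteq> i \<and>
      \<bar>lin d (\<lambda>k. Z k \<omega>) \<beta> i - lin d (\<lambda>k. Z k \<omega>) \<beta> j\<bar> \<le> g * ?B})}"
  have "rare T (real n ^ 2 * g / r)"
    unfolding T_def using n4 by (intro many_close_rare B) (auto simp: g_def r_def)
  also have "real n ^ 2 * g / r = real n powr (- a)"
  proof -
    have "real n ^ 2 * g = real n powr (2 + (- 1 - 2 * a))"
      unfolding g_def by (rule square_times_powr[OF n4(2)])
    then have "real n ^ 2 * g / r = real n powr (2 + (- 1 - 2 * a) - (1 - a))"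
      by (simp only: r_def powr_diff[symmetric])
    also have "2 + (- 1 - 2 * a) - (1 - a) = - a" by simp
    finally show ?thesis .
  qed
  finally have T: "rare T (real n powr (- a))" .
  have "real (card {j\<in>{..<n}. f j \<noteq> j}) \<le>
       real n * (real n powr (- a) + ((1 + 32 * real n powr (3 * a / 2)) * 2 * real n powr (- 7 * a))\<^sup>2)"
    if w: "\<omega> \<in> space M - (S \<union> T)" and ls: "ls_fit s \<beta> \<omega> f b" for \<omega> f b
  proof -
    let ?K = "1 + 32 * real n powr (3 * a / 2)"
    have wS: "\<omega> \<in> space M - S" using w by simp
    have "real (card {j\<in>{..<n}. f j \<noteq> j}) \<le> r + (?K * (2 * ?B * real n powr (- 1 / 2 - 9 * a)) / (g * ?B))\<^sup>2"
    proof (rule moved_bound[OF n4(1) ws[OF wS] few[OF wS ls] _ res[OF wS ls]])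
      show "f permutes {..<n}" using ls by (simp add: ls_fit_def)
      show "0 < g * ?B" using B n4 by (simp add: g_def)
      show "real (card {i\<in>{..<n}. \<exists>j\<in>{..<n}. j \<noteq> i \<and>
        \<bar>lin d (\<lambda>k. Z k \<omega>) \<beta> i - lin d (\<lambda>k. Z k \<omega>) \<beta> j\<bar> \<le> g * ?B}) \<le> r"
        using w by (auto simp: T_def not_le)
    qed
    also have "?K * (2 * ?B * real n powr (- 1 / 2 - 9 * a)) / (g * ?B) = ?K * 2 * (real n powr (1 / 2) * real n powr (- 7 * a))"
    proof -
      have "real n powr (- 1 / 2 - 9 * a) = g * (real n powr (1 / 2) * real n powr (- 7 * a))"
      proof -
        have "- 1 / 2 - 9 * a = (- 1 - 2 * a) + (1 / 2 + - 7 * a)" by simp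
        then show ?thesis unfolding g_def by (simp only: powr_add)
      qed
      then show ?thesis using B n4 by (simp add: g_def)
    qed
    also have "(?K * 2 * (real n powr (1 / 2) * real n powr (- 7 * a)))\<^sup>2 = real n * (?K * 2 * real n powr (- 7 * a))\<^sup>2"
      using n4 by (simp add: power_mult_distrib powr_half_sqrt mult_ac)
    also have "r = real n * real n powr (- a)"
      using n4 by (simp add: r_def powr_diff powr_minus divide_inverse)
    finally show ?thesis by (simp add: ring_distribs)
  qed
  moreover have "well_spread a n d (\<lambda>k. Z k \<omega>)" if "\<omega> \<in> space M - (S \<union> T)" for \<omega>
    using that by (intro ws) simp
  ultimately show ?thesis using that[OF rare_Un[OF S T]] by presburger
qed

text \<open>Among the fewer than \<open>n ^ 2\<close> pairs of rows one is closer than \<open>n powr (-2 - a) B\<close> with probability at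
most \<open>n powr (-a)\<close>. The tail bound for the projected noise must hold in all \<open>n\<close> rows at once, so it is
applied at level \<open>n powr a\<close>.\<close>

lemma exact_rare:
  assumes n: "large a n" and dn: "d \<le> n" and a: "0 < a" "a \<le> 1 / 20"
    and B: "0 < L2_set \<beta> {..<d}" and s: "0 < s" "s \<le> L2_set \<beta> {..<d} * real n powr (- 2 - 10 * a)"
  obtains S where "rare S (core_risk a n d + real n powr (- a) + real n * (2 * exp (- (real n powr a)\<^sup>2 / 4)))"
    "\<And>\<omega>. \<omega> \<in> space M - S \<Longrightarrow> well_spread a n d (\<lambda>k. Z k \<omega>)"
    "\<And>\<omega> f b. \<omega> \<in> space M - S \<Longrightarrow> ls_fit s \<beta> \<omega> f b \<Longrightarrow> \<forall>j<n. f j = j"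
proof -
  let ?B = "L2_set \<beta> {..<d}"
  have n4: "n > 0" "real n > 0" "real n \<ge> 1" using n by (auto simp: large_def)
  have "real n powr (- 2 - 10 * a) \<le> real n powr (- 1 - 10 * a)"
    using n4 by (intro powr_mono) auto
  then have s': "s \<le> ?B * real n powr (- 1 - 10 * a)"
    using s B by (meson less_imp_le mult_left_mono order_trans)
  obtain S where S: "rare S (core_risk a n d)"
    and ws: "\<And>\<omega>. \<omega> \<in> space M - S \<Longrightarrow> well_spread a n d (\<lambda>k. Z k \<omega>)"
    and noise: "\<And>\<omega> j. \<omega> \<in> space M - S \<Longrightarrow> j < n \<Longrightarrow> \<bar>Z (j, d) \<omega>\<bar> \<le> real n powr (a / 2)"
    and few: "\<And>\<omega> f b. \<omega> \<in> space M - S \<Longrightarrow> ls_fit s \<beta> \<omega> f b \<Longrightarrow> real (card {j\<in>{..<n}. f j \<noteq> j}) \<le> real n / 4"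
    and res: "\<And>\<omega> f b. \<omega> \<in> space M - S \<Longrightarrow> ls_fit s \<beta> \<omega> f b \<Longrightarrow>
      L2_set (\<lambda>j. lin d (\<lambda>k. Z k \<omega>) \<beta> (f j) - lin d (\<lambda>k. Z k \<omega>) b j) {..<n}
        \<le> 2 * L2_set \<beta> {..<d} * real n powr (- 1 / 2 - 9 * a)"
    by (rule few_moved_rare[OF n dn a B s(1) s']) (rule that; assumption)
  define close where "close = (\<lambda>i j. {\<omega>\<in>space M.
     \<bar>lin d (\<lambda>k. Z k \<omega>) \<beta> i - lin d (\<lambda>k. Z k \<omega>) \<beta> j\<bar> \<le> real n powr (- 2 - a) * ?B})"
  define T where "T = (\<Union>(i, j)\<in>{(i, j). i < n \<and> j < n \<and> i \<noteq> j}. close i j)"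
  have "rare T (real n ^ 2 * real n powr (- 2 - a))"
    unfolding T_def close_def by (intro close_pairs_rare B) auto
  also have "real n ^ 2 * real n powr (- 2 - a) = real n powr (- a)"
  proof -
    have "2 + (- 2 - a) = - a" by simp
    then show ?thesis using square_times_powr[OF n4(2), of "- 2 - a"] by (simp only:)
  qed
  finally have T: "rare T (real n powr (- a))" .
  define big where "big = (\<lambda>j. {\<omega>\<in>space M. real n powr a \<le> \<bar>\<Sum>i<n. hat n d (\<lambda>k. Z k \<omega>) j i * Z (i, d) \<omega>\<bar>})"
  define V where "V = (\<Union>j\<in>{..<n}. big j)"
  have V: "rare V (real n * (2 * exp (- (real n powr a)\<^sup>2 / 4)))"
    unfolding V_def big_def using n4 by (intro fitted_noise_rare) auto
  have "\<forall>j<n. f j = j" if w: "\<omega> \<in> space M - (S \<union> T \<union> V)" and ls: "ls_fit s \<beta> \<omega> f b" for \<omega> f b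
  proof -
    have wS: "\<omega> \<in> space M - S" using w by simp
    let ?A = "\<lambda>k. Z k \<omega>"
    have det: "det (gram n d ?A) \<noteq> 0" by (rule det_gram_nonzero[OF ws[OF wS] n4(1)])
    obtain c0 where c0: "\<And>j. (\<Sum>i<n. hat n d ?A j i * (s * Z (i, d) \<omega>)) = lin d ?A c0 j"
      and orth: "\<And>c. (\<Sum>j<n. lin d ?A c j * (s * Z (j, d) \<omega> - lin d ?A c0 j)) = 0"
      by (rule hat_projection[OF det, of "\<lambda>i. s * Z (i, d) \<omega>"]) (rule that; assumption)
    show ?thesis
    proof (rule none_moved[OF n4(1) ws[OF wS] few[OF wS ls] _ _ orth, of _ b])
      show "f permutes {..<n}" using ls by (simp add: ls_fit_def)
      \<comment> \<open>The competitor is the identity with the least-squares coefficients \<open>\<beta> + c0\<close>, whose residual is the orthogonal part of the noise.\<close>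
      have "L2_set (\<lambda>j. lin d ?A \<beta> (f j) + s * Z (f j, d) \<omega> - lin d ?A b j) {..<n}
        \<le> L2_set (\<lambda>j. lin d ?A \<beta> j + s * Z (j, d) \<omega> - lin d ?A (\<lambda>l. \<beta> l + c0 l) j) {..<n}"
        using ls unfolding ls_fit_def by blast
      then show "L2_set (\<lambda>j. lin d ?A \<beta> (f j) + s * Z (f j, d) \<omega> - lin d ?A b j) {..<n}
        \<le> L2_set (\<lambda>j. s * Z (j, d) \<omega> - lin d ?A c0 j) {..<n}"
        by (simp add: lin_add)
      show "\<bar>s * Z (j, d) \<omega>\<bar> \<le> s * real n powr a" if "j < n" for j
      proof -
        have "\<bar>Z (j, d) \<omega>\<bar> \<le> real n powr (a / 2)" by (rule noise[OF wS that])
        also have "\<dots> \<le> real n powr a" using n4 a by (intro powr_mono) auto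
        finally show ?thesis using s by (simp add: abs_mult)
      qed
      show "\<bar>lin d ?A c0 j\<bar> \<le> s * real n powr a" if j: "j < n" for j
      proof -
        have "\<omega> \<in> space M" "\<omega> \<notin> big j" using w j by (auto simp: V_def)
        then have "\<bar>\<Sum>i<n. hat n d ?A j i * Z (i, d) \<omega>\<bar> \<le> real n powr a"
          by (simp add: big_def not_le)
        moreover have "lin d ?A c0 j = s * (\<Sum>i<n. hat n d ?A j i * Z (i, d) \<omega>)"
          unfolding c0[symmetric] by (simp add: sum_distrib_left mult_ac)
        ultimately show ?thesis using s by (simp add: abs_mult)
      qed
      show "real n powr (- 2 - a) * ?B \<le> \<bar>lin d ?A \<beta> i - lin d ?A \<beta> j\<bar>" if "i < n" "j < n" "i \<noteq> j" for i j
      proof -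
        have "\<omega> \<in> space M" "\<omega> \<notin> close i j" using w that by (auto simp: T_def)
        then show ?thesis by (simp add: close_def not_le)
      qed
      let ?K = "32 * real n powr (3 * a / 2)"
      have "2 * (s * real n powr a) + 4 * (s * real n powr a) * (1 + ?K) * (1 + 3 * ?K)
        = s * (real n powr a * (2 + 4 * (1 + ?K) * (1 + 3 * ?K)))"
        by (simp add: algebra_simps)
      also have "\<dots> \<le> (?B * real n powr (- 2 - 10 * a)) * (real n powr a * (2 + 4 * (1 + ?K) * (1 + 3 * ?K)))"
        using s by (intro mult_right_mono) auto
      also have "\<dots> = ?B * real n powr (- 2) * (real n powr (- 9 * a) * (2 + 4 * (1 + ?K) * (1 + 3 * ?K)))"
      proof -
        have "real n powr (- 2 - 10 * a) * real n powr a = real n powr (- 2) * real n powr (- 9 * a)"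
        proof -
          have "- 2 - 10 * a + a = - 2 + - 9 * a" by simp
          then have "real n powr (- 2 - 10 * a + a) = real n powr (- 2 + - 9 * a)" by (simp only:)
          then show ?thesis by (simp only: powr_add)
        qed
        then show ?thesis by (simp add: mult.assoc[symmetric])
      qed
      also have "\<dots> < ?B * real n powr (- 2) * real n powr (- a)"
        using n B n4 unfolding large_def by (intro mult_strict_left_mono) auto
      also have "\<dots> = real n powr (- 2 - a) * ?B"
      proof -
        have "- 2 - a = - 2 + - a" by simp
        then show ?thesis by (simp only: powr_add mult_ac)
      qed
      finally show "2 * (s * real n powr a) + 4 * (s * real n powr a) * (1 + ?K) * (1 + 3 * ?K) < real n powr (- 2 - a) * ?B" .
    qed
  qed
  moreover have "well_spread a n d (\<lambda>k. Z k \<omega>)" if "\<omega> \<in> space M - (S \<union> T \<union> V)" for \<omega>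
    using that by (intro ws) simp
  ultimately show ?thesis using that[OF rare_Un[OF rare_Un[OF S T] V]] by presburger
qed

end

section \<open>Recovery of the permutation\<close>

text \<open>The noise is read in the order of the true permutation, which makes that permutation disappear from the
analysis.\<close>

definition design_noise :: "nat \<Rightarrow> (nat \<Rightarrow> nat) \<Rightarrow> real \<Rightarrow> ('a \<Rightarrow> real mat) \<Rightarrow> ('a \<Rightarrow> real Matrix.vec) \<Rightarrow>
    nat \<times> nat \<Rightarrow> 'a \<Rightarrow> real" where
  "design_noise d p s X w = (\<lambda>(i, j) \<omega>. if j < d then X \<omega> $$ (i, j) else vec_index (w \<omega>) (p i) / s)"

text \<open>The probability of a box splits into design and noise by their independence, and each part is a product.
Reading the noise in the order \<open>p\<close> permutes the factors of the second product.\<close>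

lemma gaussian_array_design_noise:
  assumes g: "gaussian_design M n d s X w" and p: "p permutes {..<n}" and s: "s > 0"
    and n: "n > 0" and d: "d > 0"
  shows "gaussian_array M (design_noise d p s X w) n d"
proof -
  interpret prob_space M using g by (simp add: gaussian_design_def)
  let ?Z = "design_noise d p s X w"
  let ?I = "{..<n} \<times> {..<d}"
  have Xd: "\<And>k. k \<in> ?I \<Longrightarrow> distributed M lborel (\<lambda>\<omega>. X \<omega> $$ k) (normal_density 0 1)"
    and Xi: "indep_vars (\<lambda>_. borel) (\<lambda>k \<omega>. X \<omega> $$ k) ?I"
    and wd: "\<And>i. i < n \<Longrightarrow> distributed M lborel (\<lambda>\<omega>. vec_index (w \<omega>) i) (normal_density 0 s)"
    and wi: "indep_vars (\<lambda>_. borel) (\<lambda>i \<omega>. vec_index (w \<omega>) i) {..<n}"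
    and ind: "indep_set (sets (vimage_algebra (space M) (\<lambda>\<omega>. \<lambda>k\<in>?I. X \<omega> $$ k) (Pi\<^sub>M ?I (\<lambda>_. borel))))
       (sets (vimage_algebra (space M) (\<lambda>\<omega>. \<lambda>i\<in>{..<n}. vec_index (w \<omega>) i) (Pi\<^sub>M {..<n} (\<lambda>_. borel))))"
    using g by (auto simp: gaussian_design_def)
  have pn: "p i < n" if "i < n" for i using permutes_in_image[OF p, of i] that by simp
  have dist: "distributed M lborel (?Z k) std_normal_density" if kI: "k \<in> {..<n} \<times> {..d}" for k
  proof -
    obtain i j where k: "k = (i, j)" "i < n" "j \<le> d" using kI by auto
    show ?thesis
    proof (cases "j < d")
      case True
      then have "?Z k = (\<lambda>\<omega>. X \<omega> $$ k)" by (simp add: design_noise_def k)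
      then show ?thesis using Xd[of k] k True by simp
    next
      case False
      then have "?Z k = (\<lambda>\<omega>. (vec_index (w \<omega>) (p i) - 0) / s)" by (simp add: design_noise_def k)
      then show ?thesis
        using normal_standard_normal_convert[OF s] wd[OF pn[OF k(2)]] by metis
    qed
  qed
  have rv: "random_variable borel (?Z k)" if "k \<in> {..<n} \<times> {..d}" for k
    using distributed_measurable[OF dist[OF that]] by simp
  have "indep_vars (\<lambda>_. borel) ?Z ({..<n} \<times> {..d})"
  proof (subst indep_vars_finite[where E = "\<lambda>_. sets borel"])
    show "{..<n} \<times> {..d} \<noteq> {}" using n by auto
    show "sets borel = sigma_sets (space borel) (sets (borel :: real measure))" by (rule sets.sigma_sets_eq[symmetric])
    show "\<forall>A\<in>({..<n} \<times> {..d}) \<rightarrow> sets borel. prob (\<Inter>k\<in>{..<n} \<times> {..d}. ?Z k -` A k \<inter> space M) =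
        (\<Prod>k\<in>{..<n} \<times> {..d}. prob (?Z k -` A k \<inter> space M))"
    proof
      fix A assume "A \<in> ({..<n} \<times> {..d}) \<rightarrow> sets (borel :: real measure)"
      then have A: "A (i, j) \<in> sets borel" if "i < n" "j \<le> d" for i j using that by auto
      define B where "B = (\<lambda>i. (\<lambda>x. x / s) -` A (Hilbert_Choice.inv p i, d))"
      have B: "B i \<in> sets borel" if "i < n" for i
      proof -
        have "Hilbert_Choice.inv p i < n"
          using permutes_in_image[OF permutes_inv[OF p], of i] that by simp
        then have "(\<lambda>x. x / s) -` A (Hilbert_Choice.inv p i, d) \<inter> space borel \<in> sets borel"
          by (intro measurable_sets[OF _ A]) auto
        then show ?thesis by (simp add: B_def)
      qed
      have Bp: "B (p i) = (\<lambda>x. x / s) -` A (i, d)" for i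
        using permutes_inverses(2)[OF p] by (simp add: B_def)
      define a where "a = (\<lambda>\<omega>. \<lambda>k\<in>?I. X \<omega> $$ k) -` (Pi\<^sub>E ?I A) \<inter> space M"
      define b where "b = (\<lambda>\<omega>. \<lambda>i\<in>{..<n}. vec_index (w \<omega>) i) -` (Pi\<^sub>E {..<n} B) \<inter> space M"
      have "a \<in> sets (vimage_algebra (space M) (\<lambda>\<omega>. \<lambda>k\<in>?I. X \<omega> $$ k) (Pi\<^sub>M ?I (\<lambda>_. borel)))"
        unfolding a_def using A by (intro in_vimage_algebra sets_PiM_I_finite) auto
      moreover have "b \<in> sets (vimage_algebra (space M) (\<lambda>\<omega>. \<lambda>i\<in>{..<n}. vec_index (w \<omega>) i) (Pi\<^sub>M {..<n} (\<lambda>_. borel)))"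
        unfolding b_def using B by (intro in_vimage_algebra sets_PiM_I_finite) auto
      ultimately have ab: "prob (a \<inter> b) = prob a * prob b"
        using indep_setD[OF ind] by blast
      have Za: "?Z k = (\<lambda>\<omega>. X \<omega> $$ k)" if "k \<in> ?I" for k
        using that by (auto simp: design_noise_def)
      have Zb: "?Z (i, d) -` A (i, d) \<inter> space M = (\<lambda>\<omega>. vec_index (w \<omega>) (p i)) -` B (p i) \<inter> space M" for i
        by (auto simp: design_noise_def Bp)
      have a_eq: "a = (\<Inter>k\<in>?I. (\<lambda>\<omega>. X \<omega> $$ k) -` A k \<inter> space M)"
        using n d by (auto simp: a_def PiE_iff)
      have b_eq: "b = (\<Inter>i\<in>{..<n}. (\<lambda>\<omega>. vec_index (w \<omega>) i) -` B i \<inter> space M)"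
        using n by (auto simp: b_def PiE_iff)
      have "prob a = (\<Prod>k\<in>?I. prob ((\<lambda>\<omega>. X \<omega> $$ k) -` A k \<inter> space M))"
        unfolding a_eq using n d A by (intro indep_varsD_finite[OF Xi]) auto
      also have "\<dots> = (\<Prod>k\<in>?I. prob (?Z k -` A k \<inter> space M))"
        by (intro prod.cong refl) (simp only: Za)
      finally have pa: "prob a = (\<Prod>k\<in>?I. prob (?Z k -` A k \<inter> space M))" .
      have "prob b = (\<Prod>i<n. prob ((\<lambda>\<omega>. vec_index (w \<omega>) i) -` B i \<inter> space M))"
        unfolding b_eq using n B by (intro indep_varsD_finite[OF wi]) auto
      also have "\<dots> = (\<Prod>i<n. prob (?Z (i, d) -` A (i, d) \<inter> space M))"
        by (subst prod.permute[OF p]) (simp add: Zb o_def)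
      finally have pb: "prob b = (\<Prod>i<n. prob (?Z (i, d) -` A (i, d) \<inter> space M))" .
      have I: "{..<n} \<times> {..d} = ?I \<union> (\<lambda>i. (i, d)) ` {..<n}" by auto
      have "(\<Inter>k\<in>{..<n} \<times> {..d}. ?Z k -` A k \<inter> space M) = a \<inter> b"
      proof -
        have "\<Inter> (G ` {..<n}) = \<Inter> ((\<lambda>i. G (p i)) ` {..<n})" for G :: "nat \<Rightarrow> 'a set"
          using permutes_image[OF p] image_image[of G p "{..<n}"] by simp
        then have "(\<Inter>i\<in>{..<n}. (\<lambda>\<omega>. vec_index (w \<omega>) i) -` B i \<inter> space M) =
            (\<Inter>i\<in>{..<n}. (\<lambda>\<omega>. vec_index (w \<omega>) (p i)) -` B (p i) \<inter> space M)" .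
        also have "\<dots> = (\<Inter>i\<in>{..<n}. ?Z (i, d) -` A (i, d) \<inter> space M)"
          by (simp only: Zb)
        finally have "b = (\<Inter>k\<in>(\<lambda>i. (i, d)) ` {..<n}. ?Z k -` A k \<inter> space M)"
          by (simp add: b_eq image_image)
        moreover have "a = (\<Inter>k\<in>?I. ?Z k -` A k \<inter> space M)"
          unfolding a_eq by (intro INF_cong refl) (simp only: Za)
        ultimately show ?thesis unfolding I by (simp only: INF_union)
      qed
      moreover have "(\<Prod>k\<in>{..<n} \<times> {..d}. prob (?Z k -` A k \<inter> space M)) = prob a * prob b"
        unfolding I pa pb
        by (subst prod.union_disjoint) (auto simp: prod.reindex inj_on_def)
      ultimately show "prob (\<Inter>k\<in>{..<n} \<times> {..d}. ?Z k -` A k \<inter> space M) =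
        (\<Prod>k\<in>{..<n} \<times> {..d}. prob (?Z k -` A k \<inter> space M))"
        using ab by simp
    qed
  qed (use rv in \<open>auto simp: sets.Int_stable\<close>)
  then show ?thesis
    using dist by (unfold_locales) auto
qed

lemma (in prob_space) prob_ge_rare:
  assumes S: "rare S q" and E: "E \<in> events" and AE: "AE \<omega> in M. \<omega> \<in> space M - S \<longrightarrow> \<omega> \<in> E"
  shows "1 - q \<le> prob E"
proof -
  have "1 - q \<le> 1 - prob S" using S by (simp add: rare_def)
  also have "\<dots> = prob (space M - S)"
    using S by (simp add: rare_def prob_compl)
  also have "\<dots> \<le> prob E"
    using AE E by (intro finite_measure_mono_AE) auto
  finally show ?thesis .
qed

lemma estimator_ls_fit:
  fixes M :: "'a measure"
  assumes g: "gaussian_design M n d s X w" and p: "p permutes {..<n}" and s: "s > 0"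
    and n: "n > 0" and d: "d > 0" and \<beta>: "\<beta> \<in> carrier_vec d"
    and P: "P = mat n n (\<lambda>(i, j). if i = p j then 1 else 0)"
    and \<omega>: "\<omega> \<in> space M" and ws: "well_spread a n d (\<lambda>k. design_noise d p s X w k \<omega>)"
    and max: "is_arg_max (\<lambda>R. sq_norm_vec (proj_mat R (X \<omega>) *\<^sub>v observation P \<beta> (X \<omega>) (w \<omega>)))
        (\<lambda>R. R \<in> perm_mats n) Q"
  obtains f b where "gaussian_array.ls_fit (design_noise d p s X w) n d s (vec_index \<beta>) \<omega> f b"
    "(\<forall>j<n. f j = j) \<Longrightarrow> Q = P"
    "overlap n Q P = 1 - real (card {j\<in>{..<n}. f j \<noteq> j}) / real n"
proof -
  let ?Z = "design_noise d p s X w"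
  interpret gaussian_array M ?Z n d by (rule gaussian_array_design_noise[OF g p s n d])
  have X: "X \<omega> \<in> carrier_mat n d" and w: "w \<omega> \<in> carrier_vec n"
    using g \<omega> by (auto simp: gaussian_design_def)
  have lin_eq: "lin d (\<lambda>k. ?Z k \<omega>) c i = lin d (\<lambda>k. X \<omega> $$ k) c i" for c i
    by (simp add: lin_def design_noise_def)
  have Zd: "s * ?Z (j, d) \<omega> = vec_index (w \<omega>) (p j)" for j
    using s by (simp add: design_noise_def)
  have "gram n d (\<lambda>k. ?Z k \<omega>) = gram n d (\<lambda>k. X \<omega> $$ k)"
    by (intro eq_matI) (auto simp: gram_def design_noise_def)
  then have inv: "det (transpose_mat (X \<omega>) * X \<omega>) \<noteq> 0"
    using det_gram_nonzero[OF ws n] by (simp add: gram_mat[OF X])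
  show ?thesis
  proof (rule estimator_least_squares[OF X inv p P \<beta> w n max])
    fix f b
    assume f: "f permutes {..<n}"
      and le: "\<And>c. L2_set (\<lambda>j. lin d (\<lambda>k. X \<omega> $$ k) (vec_index \<beta>) (f j) + vec_index (w \<omega>) (p (f j)) -
          lin d (\<lambda>k. X \<omega> $$ k) b j) {..<n} \<le>
        L2_set (\<lambda>j. lin d (\<lambda>k. X \<omega> $$ k) (vec_index \<beta>) j + vec_index (w \<omega>) (p j) -
          lin d (\<lambda>k. X \<omega> $$ k) c j) {..<n}"
      and eq: "\<forall>j<n. f j = j \<Longrightarrow> Q = P"
      and ov: "overlap n Q P = 1 - real (card {j\<in>{..<n}. f j \<noteq> j}) / real n"
    have "ls_fit s (vec_index \<beta>) \<omega> f b"
      unfolding ls_fit_def lin_eq Zd using f le by blast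
    then show thesis by (rule that[OF _ eq ov])
  qed
qed

text \<open>Off \<open>S\<close> the design is injective, so the projections exist and a maximiser is a least-squares fit. Exact
and almost exact recovery differ in what such a fit satisfies, \<open>good\<close>, and in what it implies for the
estimate, \<open>R\<close>.\<close>

lemma estimator_property_prob:
  fixes M :: "'a measure"
  assumes g: "gaussian_design M n d s X w" and p: "p permutes {..<n}" and s: "s > 0"
    and n: "n > 0" and d: "d > 0" and \<beta>: "\<beta> \<in> carrier_vec d"
    and P: "P = mat n n (\<lambda>(i, j). if i = p j then 1 else 0)"
    and est: "is_perm_estimator M n X (\<lambda>\<omega>. observation P \<beta> (X \<omega>) (w \<omega>)) P_hat"
    and S: "prob_space.rare M S q"
    and ws: "\<And>\<omega>. \<omega> \<in> space M - S \<Longrightarrow> well_spread a n d (\<lambda>k. design_noise d p s X w k \<omega>)"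
    and fit: "\<And>\<omega> f b. \<omega> \<in> space M - S \<Longrightarrow>
      gaussian_array.ls_fit (design_noise d p s X w) n d s (vec_index \<beta>) \<omega> f b \<Longrightarrow> good f"
    and R: "\<And>f Q. good f \<Longrightarrow> ((\<forall>j<n. f j = j) \<Longrightarrow> Q = P) \<Longrightarrow>
      overlap n Q P = 1 - real (card {j\<in>{..<n}. f j \<noteq> j}) / real n \<Longrightarrow> R Q"
  shows "1 - q \<le> measure M {\<omega>\<in>space M. R (P_hat \<omega>)}"
proof -
  interpret gaussian_array M "design_noise d p s X w" n d
    by (rule gaussian_array_design_noise[OF g p s n d])
  have meas: "P_hat \<in> measurable M (count_space (perm_mats n))"
    and max: "AE \<omega> in M. is_arg_max (\<lambda>R. sq_norm_vec (proj_mat R (X \<omega>) *\<^sub>v observation P \<beta> (X \<omega>) (w \<omega>)))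
        (\<lambda>R. R \<in> perm_mats n) (P_hat \<omega>)"
    using est by (auto simp: is_perm_estimator_def)
  show ?thesis
  proof (rule prob_ge_rare[OF S])
    have "P_hat -` {Q\<in>perm_mats n. R Q} \<inter> space M \<in> events"
      by (rule measurable_sets[OF meas]) auto
    also have "P_hat -` {Q\<in>perm_mats n. R Q} \<inter> space M = {\<omega>\<in>space M. R (P_hat \<omega>)}"
      using measurable_space[OF meas] by auto
    finally show "{\<omega>\<in>space M. R (P_hat \<omega>)} \<in> events" .
    show "AE \<omega> in M. \<omega> \<in> space M - S \<longrightarrow> \<omega> \<in> {\<omega>\<in>space M. R (P_hat \<omega>)}"
      using max
    proof eventually_elim
      case (elim \<omega>)
      show ?case
      proof
        assume w: "\<omega> \<in> space M - S"
        then have "\<omega> \<in> space M" by simp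
        have "R (P_hat \<omega>)"
          by (rule estimator_ls_fit[OF g p s n d \<beta> P \<open>\<omega> \<in> space M\<close> ws[OF w] elim]) (rule R[OF fit[OF w]])
        then show "\<omega> \<in> {\<omega>\<in>space M. R (P_hat \<omega>)}" using w by simp
      qed
    qed
  qed
qed

text \<open>The cases \<open>k = 2\<close> and \<open>k = 1\<close> are the thresholds of exact and of almost exact recovery.\<close>

lemma noise_level_bound:
  assumes \<beta>: "\<beta> \<in> carrier_vec d" and s: "s > 0" and n: "n > 0"
    and snr: "SNR \<beta> s \<ge> real n powr (2 * k + \<epsilon>)" and a: "20 * a \<le> \<epsilon>"
  shows "0 < L2_set (vec_index \<beta>) {..<d}" "s \<le> L2_set (vec_index \<beta>) {..<d} * real n powr (- k - 10 * a)"
proof -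
  let ?B = "L2_set (vec_index \<beta>) {..<d}"
  have n1: "real n \<ge> 1" using n by simp
  have "SNR \<beta> s = ?B\<^sup>2 / s\<^sup>2"
    unfolding SNR_def sq_norm_vec_sum[OF \<beta>] L2_set_power2 ..
  moreover have "real n powr (2 * (k + 10 * a)) \<le> real n powr (2 * k + \<epsilon>)"
    using a n1 by (intro powr_mono) auto
  ultimately have "(real n powr (k + 10 * a))\<^sup>2 \<le> (?B / s)\<^sup>2"
    using snr by (simp add: powr_square power_divide)
  then have le: "real n powr (k + 10 * a) \<le> ?B / s"
    by (rule power2_le_imp_le) (use s in simp)
  moreover have pos: "0 < real n powr (k + 10 * a)" using n by simp
  ultimately have "0 < ?B / s" by linarith
  then show "0 < ?B" using s by (simp add: zero_less_divide_iff)
  have "s * real n powr (k + 10 * a) \<le> ?B" using le s by (simp add: field_simps)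
  then have "s \<le> ?B / real n powr (k + 10 * a)" using pos by (simp add: field_simps)
  also have "\<dots> = ?B * real n powr (- (k + 10 * a))"
    by (simp only: powr_minus divide_inverse)
  also have "- (k + 10 * a) = - k - 10 * a" by simp
  finally show "s \<le> ?B * real n powr (- k - 10 * a)" .
qed

theorem theorem1:
  fixes \<epsilon> :: real
    and d :: "nat \<Rightarrow> nat"
    and \<sigma> :: "nat \<Rightarrow> real"
    and M :: "nat \<Rightarrow> 'a measure"
    and X :: "nat \<Rightarrow> 'a \<Rightarrow> real mat"
    and w :: "nat \<Rightarrow> 'a \<Rightarrow> real Matrix.vec"
  assumes "\<epsilon> > 0"
    and "\<And>n. n \<ge> 1 \<Longrightarrow> d n \<ge> 1"
    and "(\<lambda>n. real (d n)) \<in> o(\<lambda>n. real n)"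
    and "\<And>n. n \<ge> 1 \<Longrightarrow> \<sigma> n > 0"
    and "\<And>n. n \<ge> 1 \<Longrightarrow> gaussian_design (M n) n (d n) (\<sigma> n) (X n) (w n)"
  shows
    "(\<exists>\<delta> :: nat \<Rightarrow> real. \<delta> \<longlonglongrightarrow> 0 \<and>
       (\<forall>n\<ge>1. \<forall>P\<in>perm_mats n. \<forall>\<beta>\<in>carrier_vec (d n). \<forall>P_hat.
          SNR \<beta> (\<sigma> n) \<ge> real n powr (4 + \<epsilon>) \<longrightarrow>
          is_perm_estimator (M n) n (X n) (\<lambda>\<omega>. observation P \<beta> (X n \<omega>) (w n \<omega>)) P_hat \<longrightarrow>
          measure (M n) {\<omega> \<in> space (M n). P_hat \<omega> = P} \<ge> 1 - \<delta> n)) \<and>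
     (\<exists>\<eta> \<delta> :: nat \<Rightarrow> real. \<eta> \<longlonglongrightarrow> 0 \<and> \<delta> \<longlonglongrightarrow> 0 \<and>
       (\<forall>n\<ge>1. \<forall>P\<in>perm_mats n. \<forall>\<beta>\<in>carrier_vec (d n). \<forall>P_hat.
          SNR \<beta> (\<sigma> n) \<ge> real n powr (2 + \<epsilon>) \<longrightarrow>
          is_perm_estimator (M n) n (X n) (\<lambda>\<omega>. observation P \<beta> (X n \<omega>) (w n \<omega>)) P_hat \<longrightarrow>
          measure (M n) {\<omega> \<in> space (M n). overlap n (P_hat \<omega>) P \<ge> 1 - \<eta> n} \<ge> 1 - \<delta> n))"
proof -
  \<comment> \<open>The losses by factors \<open>n powr a\<close> add up to less than the slack \<open>n powr \<epsilon>\<close>, and the cap keeps \<open>n powr (3 * a / 2)\<close> below \<open>n\<close>.\<close>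
  define a where "a = min \<epsilon> 1 / 20"
  have a: "0 < a" "a \<le> 1 / 20" and a\<epsilon>: "20 * a \<le> \<epsilon>"
    using assms(1) by (auto simp: a_def)
  define ok where "ok = (\<lambda>n. large a n \<and> d n \<le> n)"
  have "eventually (\<lambda>n. real (d n) \<le> 1 * real n) sequentially"
    using landau_o.smallD[OF assms(3), of 1] by simp
  then have ok: "eventually ok sequentially"
    using eventually_large[OF a] unfolding ok_def by eventually_elim auto
  define ra where "ra = (\<lambda>n. core_risk a n (d n) + real n powr (- a) + real n * (2 * exp (- (real n powr a)\<^sup>2 / 4)))"
  define rb where "rb = (\<lambda>n. core_risk a n (d n) + real n powr (- a))"
  define \<eta> where "\<eta> = (\<lambda>n::nat. real n powr (- a) + ((1 + 32 * real n powr (3 * a / 2)) * 2 * real n powr (- 7 * a))\<^sup>2)"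
  \<comment> \<open>For the finitely many other \<open>n\<close> the bound 1 on the failure probability is trivial.\<close>
  define \<delta>a where "\<delta>a = (\<lambda>n. if ok n then ra n else 1)"
  define \<delta>b where "\<delta>b = (\<lambda>n. if ok n then rb n else 1)"
  have la: "(\<lambda>n. real n powr (- a)) \<longlonglongrightarrow> 0" using a by real_asymp
  have lb: "(\<lambda>n. real n * (2 * exp (- (real n powr a)\<^sup>2 / 4))) \<longlonglongrightarrow> 0" using a by real_asymp
  have \<eta>: "\<eta> \<longlonglongrightarrow> 0" unfolding \<eta>_def using a by real_asymp
  have "rb \<longlonglongrightarrow> 0 + 0" "ra \<longlonglongrightarrow> 0 + 0 + 0"
    unfolding ra_def rb_def by (intro tendsto_add la lb core_risk_tendsto_zero a assms(3))+
  then have "rb \<longlonglongrightarrow> 0" "ra \<longlonglongrightarrow> 0" by simp_all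
  moreover have "eventually (\<lambda>n. \<delta>a n = ra n) sequentially" "eventually (\<lambda>n. \<delta>b n = rb n) sequentially"
    using ok by (auto simp: \<delta>a_def \<delta>b_def elim: eventually_mono)
  ultimately have \<delta>a: "\<delta>a \<longlonglongrightarrow> 0" and \<delta>b: "\<delta>b \<longlonglongrightarrow> 0"
    by (simp_all add: tendsto_cong)
  have exact: "1 - \<delta>a n \<le> measure (M n) {\<omega> \<in> space (M n). P_hat \<omega> = P}"
    if n: "n \<ge> 1" and P: "P \<in> perm_mats n" and \<beta>: "\<beta> \<in> carrier_vec (d n)"
      and snr: "SNR \<beta> (\<sigma> n) \<ge> real n powr (4 + \<epsilon>)"
      and est: "is_perm_estimator (M n) n (X n) (\<lambda>\<omega>. observation P \<beta> (X n \<omega>) (w n \<omega>)) P_hat"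
    for n P \<beta> P_hat
  proof (cases "ok n")
    case False
    then show ?thesis by (simp add: \<delta>a_def)
  next
    case True
    then have n4: "large a n" "d n \<le> n" "n > 0" "d n > 0" and s0: "\<sigma> n > 0"
      using n assms(2)[OF n] assms(4)[OF n] by (auto simp: ok_def)
    obtain p where p: "p permutes {..<n}" and Pp: "P = mat n n (\<lambda>(i, j). if i = p j then 1 else 0)"
      using P by (auto simp: perm_mats_def)
    interpret gaussian_array "M n" "design_noise (d n) p (\<sigma> n) (X n) (w n)" n "d n"
      by (rule gaussian_array_design_noise[OF assms(5)[OF n] p s0 n4(3,4)])
    have "SNR \<beta> (\<sigma> n) \<ge> real n powr (2 * 2 + \<epsilon>)" using snr by simp
    note s = noise_level_bound[OF \<beta> s0 n4(3) this a\<epsilon>]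
    show ?thesis
    proof (rule exact_rare[OF n4(1,2) a s(1) s0 s(2)])
      fix S assume S: "rare S (core_risk a n (d n) + real n powr (- a) + real n * (2 * exp (- (real n powr a)\<^sup>2 / 4)))"
        and ws: "\<And>\<omega>. \<omega> \<in> space (M n) - S \<Longrightarrow> well_spread a n (d n) (\<lambda>k. design_noise (d n) p (\<sigma> n) (X n) (w n) k \<omega>)"
        and fit: "\<And>\<omega> f b. \<omega> \<in> space (M n) - S \<Longrightarrow> ls_fit (\<sigma> n) (vec_index \<beta>) \<omega> f b \<Longrightarrow> \<forall>j<n. f j = j"
      have "1 - ra n \<le> measure (M n) {\<omega> \<in> space (M n). P_hat \<omega> = P}"
        unfolding ra_def
        by (rule estimator_property_prob[OF assms(5)[OF n] p s0 n4(3,4) \<beta> Pp est S ws fit])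
      then show ?thesis using True by (simp add: \<delta>a_def)
    qed
  qed
  have almost: "1 - \<delta>b n \<le> measure (M n) {\<omega> \<in> space (M n). overlap n (P_hat \<omega>) P \<ge> 1 - \<eta> n}"
    if n: "n \<ge> 1" and P: "P \<in> perm_mats n" and \<beta>: "\<beta> \<in> carrier_vec (d n)"
      and snr: "SNR \<beta> (\<sigma> n) \<ge> real n powr (2 + \<epsilon>)"
      and est: "is_perm_estimator (M n) n (X n) (\<lambda>\<omega>. observation P \<beta> (X n \<omega>) (w n \<omega>)) P_hat"
    for n P \<beta> P_hat
  proof (cases "ok n")
    case False
    then show ?thesis by (simp add: \<delta>b_def)
  next
    case True
    then have n4: "large a n" "d n \<le> n" "n > 0" "d n > 0" and s0: "\<sigma> n > 0"
      using n assms(2)[OF n] assms(4)[OF n] by (auto simp: ok_def)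
    obtain p where p: "p permutes {..<n}" and Pp: "P = mat n n (\<lambda>(i, j). if i = p j then 1 else 0)"
      using P by (auto simp: perm_mats_def)
    interpret gaussian_array "M n" "design_noise (d n) p (\<sigma> n) (X n) (w n)" n "d n"
      by (rule gaussian_array_design_noise[OF assms(5)[OF n] p s0 n4(3,4)])
    have "SNR \<beta> (\<sigma> n) \<ge> real n powr (2 * 1 + \<epsilon>)" using snr by simp
    note s = noise_level_bound[OF \<beta> s0 n4(3) this a\<epsilon>]
    show ?thesis
    proof (rule almost_exact_rare[OF n4(1,2) a s(1) s0 s(2)])
      fix S assume S: "rare S (core_risk a n (d n) + real n powr (- a))"
        and ws: "\<And>\<omega>. \<omega> \<in> space (M n) - S \<Longrightarrow> well_spread a n (d n) (\<lambda>k. design_noise (d n) p (\<sigma> n) (X n) (w n) k \<omega>)"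
        and fit: "\<And>\<omega> f b. \<omega> \<in> space (M n) - S \<Longrightarrow> ls_fit (\<sigma> n) (vec_index \<beta>) \<omega> f b \<Longrightarrow>
          real (card {j\<in>{..<n}. f j \<noteq> j}) \<le>
           real n * (real n powr (- a) + ((1 + 32 * real n powr (3 * a / 2)) * 2 * real n powr (- 7 * a))\<^sup>2)"
      have "1 - rb n \<le> measure (M n) {\<omega> \<in> space (M n). overlap n (P_hat \<omega>) P \<ge> 1 - \<eta> n}"
        unfolding rb_def
      proof (rule estimator_property_prob[OF assms(5)[OF n] p s0 n4(3,4) \<beta> Pp est S ws fit])
        fix f Q
        assume "real (card {j\<in>{..<n}. f j \<noteq> j}) \<le>
           real n * (real n powr (- a) + ((1 + 32 * real n powr (3 * a / 2)) * 2 * real n powr (- 7 * a))\<^sup>2)"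
          and ov: "overlap n Q P = 1 - real (card {j\<in>{..<n}. f j \<noteq> j}) / real n"
        then have "real (card {j\<in>{..<n}. f j \<noteq> j}) \<le> real n * \<eta> n" by (simp only: \<eta>_def)
        then have "real (card {j\<in>{..<n}. f j \<noteq> j}) / real n \<le> \<eta> n"
          using n4(3) by (simp add: field_simps)
        then show "1 - \<eta> n \<le> overlap n Q P" unfolding ov by linarith
      qed
      then show ?thesis using True by (simp add: \<delta>b_def)
    qed
  qed
  show ?thesis
  proof (intro conjI exI)
    show "\<delta>a \<longlonglongrightarrow> 0" "\<eta> \<longlonglongrightarrow> 0" "\<delta>b \<longlonglongrightarrow> 0" by (rule \<delta>a \<eta> \<delta>b)+
  qed (intro allI ballI impI exact almost; assumption)+
qed

end
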